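(* Let $a,b>0$ be constants with $a+b<\tfrac12$. There exists $\varepsilon_0>0$ such that for every fixed $0<\varepsilon<\varepsilon_0$ the following holds. Consider data $n,\boldsymbol{s},\boldsymbol{t},H$ with $n\to\infty$, where $x_j=y_j=x$ for all $j$, such that uniformly $s_j-s$, $t_j-s$, $x$ are $O(n^{1/2+\varepsilon})$; $X=O(n^{1+2\varepsilon})$; and $\frac{(1-2\lambda)^2}{3A}\le a\log n$. Let $G$ be uniformly random in $\mathcal{D}(\boldsymbol{s},\boldsymbol{t})$. Then (i) the expected number of digraphs $H'\in\mathcal{I}(H)$ with every arc of $H'$ an arc of $G$ is \[p^X|\mathcal{I}(H)|\exp\Bigl(-\frac{(1-\lambda)x(x-2)}{2\lambda}-\frac{(R+C)x}{2\lambda^2n^2}+O(n^{-b})\Bigr);\] (ii) the expected number of digraphs $H'\in\mathcal{I}(H)$ that are arc-disjoint from $G$ is \[(1-p)^X|\mathcal{I}(H)|\exp\Bigl(-\frac{\lambda x(x-2)}{2(1-\lambda)}-\frac{(R+C)x}{2(1-\lambda)^2n^2}+O(n^{-b})\Bigr).\]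
   Context: A simple digraph has no loops and no multiple arcs. $\boldsymbol{s}=(s_1,\dots,s_n)$, $\boldsymbol{t}=(t_1,\dots,t_n)$ are vectors of positive integers with equal sums; $\mathcal{D}(\boldsymbol{s},\boldsymbol{t})$ is the set of simple digraphs on $\{w_1,\dots,w_n\}$ with out-degree $s_j$ and in-degree $t_j$ at $w_j$. $H$ is a fixed simple digraph on the same vertices with out-degrees $x_j$, in-degrees $y_j$, and $X$ arcs. $\mathcal{I}(H)$ is the set of digraphs on $\{w_1,\dots,w_n\}$ isomorphic to $H$ (so $|\mathcal{I}(H)|=n!/\operatorname{aut}(H)$). $s=n^{-1}\sum_js_j$, $\lambda=s/n$, $A=\tfrac12\lambda(1-\lambda)$, $p=s/(n-1)$, $R=\sum_j(s_j-s)^2$, $C=\sum_j(t_j-s)^2$. Asymptotic notation refers to $n\to\infty$. *)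

theory Defs
  imports Complex_Main
begin

text \<open>Digraphs on the vertex set {0..<n} are represented by their arc sets.\<close>

definition arcs_on :: "nat \<Rightarrow> (nat \<times> nat) set" where
  "arcs_on n = {(i, j). i < n \<and> j < n \<and> i \<noteq> j}"

definition outdeg :: "(nat \<times> nat) set \<Rightarrow> nat \<Rightarrow> nat" where
  "outdeg G v = card {w. (v, w) \<in> G}"

definition indeg :: "(nat \<times> nat) set \<Rightarrow> nat \<Rightarrow> nat" where
  "indeg G v = card {w. (w, v) \<in> G}"

definition digraphs_deg :: "nat \<Rightarrow> (nat \<Rightarrow> nat) \<Rightarrow> (nat \<Rightarrow> nat) \<Rightarrow> (nat \<times> nat) set set" where
  "digraphs_deg n s t =
     {G. G \<subseteq> arcs_on n \<and> (\<forall>v<n. outdeg G v = s v \<and> indeg G v = t v)}"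

definition iso_copies :: "nat \<Rightarrow> (nat \<times> nat) set \<Rightarrow> (nat \<times> nat) set set" where
  "iso_copies n H =
     {H'. \<exists>\<sigma>. bij_betw \<sigma> {..<n} {..<n} \<and> H' = (\<lambda>(u, v). (\<sigma> u, \<sigma> v)) ` H}"

definition expect_unif :: "'a set \<Rightarrow> ('a \<Rightarrow> real) \<Rightarrow> real" where
  "expect_unif S f = (\<Sum>G\<in>S. f G) / real (card S)"

end

theory Submission
  imports Defs "HOL-Real_Asymp.Real_Asymp"
begin

text \<open>
  Digraphs with given degrees are 0/1 matrices with given row and column sums avoiding a sparse set \<open>F\<close> of
  forbidden cells (initially the diagonal). Switching a pair of entries between two rows \<open>i\<close> and \<open>j\<close> gives the exact identity
  \<open>P(i,k) - P(j,k) = E[1(k \<in> S) D / |S|]\<close>, where \<open>S\<close> is the set of free columns in which the two rows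
  differ and \<open>D\<close> is the (essentially known) difference of the numbers of ones of the two rows in \<open>S\<close>; summing over \<open>j\<close>
  recovers \<open>P(i,k)\<close> from the column sum. Conditioning on the presence of an arc leads to another instance of the same problem, so
  an estimate of \<open>P\<close> that is uniform over all instances controls the correlations between arcs, hence the
  moments of \<open>|S|\<close>, and the identity then returns a better estimate. Starting from a lower tail bound for \<open>|S|\<close>,
  the relative error improves from \<open>n^(-1/2)\<close> to \<open>n^(-1)\<close> to \<open>n^(-3/2)\<close>, up to factors \<open>n^o(1)\<close>. The last estimate suffices to multiply
  the conditional probabilities of all arcs of \<open>H\<close>. The only term depending on the position of \<open>H\<close> is a bilinear
  statistic, whose exponential moment over all relabellings is handled by an exchangeable-pair argument. Arc-disjoint copies
  are copies in the complement.
\<close>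

section \<open>Conditioning and switching\<close>

text \<open>H has n*x arcs with x below a small power of n, so conditional arc probabilities are
  wanted with relative error well below 1/n; this fixes the target n^(-3/2). A round gains n^(-1/2)
  for the following reason. If all probabilities given at most three arcs are known up to kappa, the
  mean of 1(k in S)/|S|, itself of order 1/n, is known up to kappa/n, and the switching identity
  multiplies it by a difference of row sums of order at most n^(1/2), powers of \<open>L\<close>
  aside. Forbidden cells act at order 1/n: they may be bounded in the second approximation but have
  to be evaluated in the third, where the diagonal supplies the passage from \<open>lam\<close> to p
  = lam*n/(n-1). Conditioning stays inside the class only with \<open>L\<close> doubled, which
  explains the thresholds with 2*L, 4*L and 8*L; complementation doubles it once more. A class could
  also be empty, and then every expectation is 0 by division by zero; existence is therefore proved
  separately, by a walk through degree sequences that rests on the same tail bound. The bound on (1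
  - 2*lam)^2 enters as lam*(1 - lam) \<ge> 1/L.\<close>

lemma expect_unif_add: "expect_unif S (\<lambda>G. f G + g G) = expect_unif S f + expect_unif S g"
  by (simp add: expect_unif_def sum.distrib add_divide_distrib)

lemma expect_unif_diff: "expect_unif S (\<lambda>G. f G - g G) = expect_unif S f - expect_unif S g"
  by (simp add: expect_unif_def sum_subtractf diff_divide_distrib)

lemma expect_unif_cmult: "expect_unif S (\<lambda>G. c * f G) = c * expect_unif S f"
  by (simp add: expect_unif_def sum_distrib_left)

lemma expect_unif_sum: "expect_unif S (\<lambda>G. \<Sum>l\<in>A. f l G) = (\<Sum>l\<in>A. expect_unif S (f l))"
  unfolding expect_unif_def by (subst sum.swap) (simp add: sum_divide_distrib)

lemma expect_unif_const: "finite S \<Longrightarrow> S \<noteq> {} \<Longrightarrow> expect_unif S (\<lambda>G. c) = c"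
  by (simp add: expect_unif_def)

lemma expect_unif_mono: "(\<And>G. G \<in> S \<Longrightarrow> f G \<le> g G) \<Longrightarrow> expect_unif S f \<le> expect_unif S g"
  unfolding expect_unif_def by (intro divide_right_mono sum_mono) auto

lemma expect_unif_cong: "(\<And>G. G \<in> S \<Longrightarrow> f G = g G) \<Longrightarrow> expect_unif S f = expect_unif S g"
  unfolding expect_unif_def by (simp cong: sum.cong)

lemma expect_unif_abs: "\<bar>expect_unif S f\<bar> \<le> expect_unif S (\<lambda>G. \<bar>f G\<bar>)"
  unfolding expect_unif_def by (simp add: abs_divide divide_right_mono sum_abs)

lemma expect_unif_nonneg: "(\<And>G. G \<in> S \<Longrightarrow> 0 \<le> f G) \<Longrightarrow> 0 \<le> expect_unif S f"
  unfolding expect_unif_def by (simp add: sum_nonneg)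

text \<open>The condition \<open>0 \<le> c\<close> covers an empty \<open>S\<close>, where division
  by zero makes the expectation 0.\<close>

lemma expect_unif_le_const:
  "(\<And>G. G \<in> S \<Longrightarrow> f G \<le> c) \<Longrightarrow> 0 \<le> c \<Longrightarrow> expect_unif S f \<le> c"
  using sum_bounded_above[of S f c]
  by (cases "card S = 0") (auto simp: expect_unif_def divide_le_eq mult.commute)

lemma expect_unif_of_bool:
  "finite S \<Longrightarrow> expect_unif S (\<lambda>G. of_bool (P G)) = real (card {G\<in>S. P G}) / real (card S)"
  by (simp add: expect_unif_def sum.If_cases of_bool_def Int_def)

text \<open>Arc sets are read as 0/1 matrices, so loops are excluded only through \<open>F\<close>.
  An arbitrary \<open>F\<close> makes the family stable under conditioning: arcs known to be present
  are deleted, their cells forbidden and the margins lowered.\<close>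

definition biadj :: "nat \<Rightarrow> (nat \<Rightarrow> nat) \<Rightarrow> (nat \<Rightarrow> nat) \<Rightarrow> (nat \<times> nat) set \<Rightarrow> (nat \<times> nat) set set" where
  "biadj n s t F =
     {G. G \<subseteq> {..<n} \<times> {..<n} - F \<and> (\<forall>v<n. outdeg G v = s v \<and> indeg G v = t v)}"

lemma finite_biadj [simp]: "finite (biadj n s t F)"
  by (rule finite_subset[of _ "Pow ({..<n} \<times> {..<n})"]) (auto simp: biadj_def)

lemma biadj_finite_graph: "G \<in> biadj n s t F \<Longrightarrow> finite G"
  by (rule finite_subset[of _ "{..<n} \<times> {..<n}"]) (auto simp: biadj_def)

lemma digraphs_deg_eq_biadj: "digraphs_deg n s t = biadj n s t (Id_on {..<n})"
  unfolding digraphs_deg_def biadj_def arcs_on_def by (intro Collect_cong conj_cong) auto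

section \<open>Degrees of unions and differences of arc sets\<close>

lemma finite_out: "finite G \<Longrightarrow> finite {w. (v, w) \<in> G}"
  by (rule finite_subset[of _ "snd ` G"]) force+

lemma finite_in: "finite G \<Longrightarrow> finite {w. (w, v) \<in> G}"
  by (rule finite_subset[of _ "fst ` G"]) force+

lemma outdeg_Diff: "E \<subseteq> G \<Longrightarrow> finite G \<Longrightarrow> outdeg (G - E) v = outdeg G v - outdeg E v"
proof -
  assume a: "E \<subseteq> G" "finite G"
  have "{w. (v, w) \<in> G - E} = {w. (v, w) \<in> G} - {w. (v, w) \<in> E}" by auto
  then show ?thesis unfolding outdeg_def
    using a by (simp add: card_Diff_subset finite_out finite_subset Collect_mono subset_iff)
qed

lemma indeg_Diff: "E \<subseteq> G \<Longrightarrow> finite G \<Longrightarrow> indeg (G - E) v = indeg G v - indeg E v"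
proof -
  assume a: "E \<subseteq> G" "finite G"
  have "{w. (w, v) \<in> G - E} = {w. (w, v) \<in> G} - {w. (w, v) \<in> E}" by auto
  then show ?thesis unfolding indeg_def
    using a by (simp add: card_Diff_subset finite_in finite_subset Collect_mono subset_iff)
qed

lemma outdeg_Un: "E \<inter> G = {} \<Longrightarrow> finite G \<Longrightarrow> finite E \<Longrightarrow> outdeg (G \<union> E) v = outdeg G v + outdeg E v"
proof -
  assume a: "E \<inter> G = {}" "finite G" "finite E"
  have "{w. (v, w) \<in> G \<union> E} = {w. (v, w) \<in> G} \<union> {w. (v, w) \<in> E}" by auto
  then show ?thesis unfolding outdeg_def
    using a by (simp, subst card_Un_disjoint) (auto simp: finite_out)
qed

lemma indeg_Un: "E \<inter> G = {} \<Longrightarrow> finite G \<Longrightarrow> finite E \<Longrightarrow> indeg (G \<union> E) v = indeg G v + indeg E v"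
proof -
  assume a: "E \<inter> G = {}" "finite G" "finite E"
  have "{w. (w, v) \<in> G \<union> E} = {w. (w, v) \<in> G} \<union> {w. (w, v) \<in> E}" by auto
  then show ?thesis unfolding indeg_def
    using a by (simp, subst card_Un_disjoint) (auto simp: finite_in)
qed

lemma sum_outdeg: "G \<subseteq> {..<n} \<times> {..<n} \<Longrightarrow> (\<Sum>v<n. outdeg G v) = card G"
proof -
  assume a: "G \<subseteq> {..<n} \<times> {..<n}"
  then have f: "finite G" by (rule finite_subset) simp
  have "card (SIGMA v:{..<n}. {w. (v, w) \<in> G}) = (\<Sum>v<n. outdeg G v)"
    unfolding outdeg_def using f by (subst card_SigmaI) (auto simp: finite_out)
  moreover have "(SIGMA v:{..<n}. {w. (v, w) \<in> G}) = G" using a by auto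
  ultimately show ?thesis by simp
qed

lemma indeg_converse: "indeg G v = outdeg (G\<inverse>) v"
  by (simp add: indeg_def outdeg_def)

lemma sum_indeg: "G \<subseteq> {..<n} \<times> {..<n} \<Longrightarrow> (\<Sum>v<n. indeg G v) = card G"
  using sum_outdeg[of "G\<inverse>" n] by (auto simp: indeg_converse card_inverse)

section \<open>Probability of containing given arcs, and conditioning on them\<close>

definition arc_prob :: "(nat \<times> nat) set set \<Rightarrow> (nat \<times> nat) set \<Rightarrow> real" where
  "arc_prob S E = expect_unif S (\<lambda>G. of_bool (E \<subseteq> G))"

lemma arc_prob_card: "finite S \<Longrightarrow> arc_prob S E = real (card {G\<in>S. E \<subseteq> G}) / real (card S)"
  unfolding arc_prob_def by (rule expect_unif_of_bool)

lemma arc_prob_nonneg: "0 \<le> arc_prob S E"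
  unfolding arc_prob_def by (rule expect_unif_nonneg) auto

lemma arc_prob_le1: "arc_prob S E \<le> 1"
  unfolding arc_prob_def by (rule expect_unif_le_const) auto

lemma arc_prob_empty: "finite S \<Longrightarrow> S \<noteq> {} \<Longrightarrow> arc_prob S {} = 1"
  by (simp add: arc_prob_def expect_unif_const)

text \<open>Forbidding the cells of \<open>E\<close> after deleting it makes adding \<open>E\<close>
  back a two-sided inverse. The bounds on the degrees of \<open>E\<close> keep the subtraction of
  natural numbers exact.\<close>

lemma bij_betw_biadj_remove:
  assumes E: "E \<subseteq> {..<n} \<times> {..<n} - F"
    and deg: "\<And>v. v < n \<Longrightarrow> outdeg E v \<le> s v \<and> indeg E v \<le> t v"
  shows "bij_betw (\<lambda>G. G - E) {G \<in> biadj n s t F. E \<subseteq> G}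
     (biadj n (\<lambda>v. s v - outdeg E v) (\<lambda>v. t v - indeg E v) (F \<union> E))"
proof (rule bij_betw_byWitness[where f' = "\<lambda>G. G \<union> E"])
  have fE: "finite E" by (rule finite_subset[OF E]) simp
  show "\<forall>G\<in>{G \<in> biadj n s t F. E \<subseteq> G}. G - E \<union> E = G" by auto
  show "\<forall>G\<in>biadj n (\<lambda>v. s v - outdeg E v) (\<lambda>v. t v - indeg E v) (F \<union> E). G \<union> E - E = G"
    by (auto simp: biadj_def)
  show "(\<lambda>G. G - E) ` {G \<in> biadj n s t F. E \<subseteq> G}
      \<subseteq> biadj n (\<lambda>v. s v - outdeg E v) (\<lambda>v. t v - indeg E v) (F \<union> E)"
  proof safe
    fix G assume G: "G \<in> biadj n s t F" and EG: "E \<subseteq> G"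
    have fG: "finite G" using G by (rule biadj_finite_graph)
    show "G - E \<in> biadj n (\<lambda>v. s v - outdeg E v) (\<lambda>v. t v - indeg E v) (F \<union> E)"
      using G outdeg_Diff[OF EG fG] indeg_Diff[OF EG fG] by (auto simp: biadj_def)
  qed
  show "(\<lambda>G. G \<union> E) ` biadj n (\<lambda>v. s v - outdeg E v) (\<lambda>v. t v - indeg E v) (F \<union> E)
      \<subseteq> {G \<in> biadj n s t F. E \<subseteq> G}"
  proof safe
    fix G assume G: "G \<in> biadj n (\<lambda>v. s v - outdeg E v) (\<lambda>v. t v - indeg E v) (F \<union> E)"
    have fG: "finite G" using G by (rule biadj_finite_graph)
    have dj: "E \<inter> G = {}" using G by (auto simp: biadj_def)
    show "G \<union> E \<in> biadj n s t F"
      using G E deg outdeg_Un[OF dj fG fE] indeg_Un[OF dj fG fE] by (auto simp: biadj_def)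
  qed
qed

text \<open>The chain rule, with the conditional distribution realised as the uniform one on
  \<open>S'\<close>. If no graph contains \<open>E\<close>, both sides are 0.\<close>

lemma arc_prob_insert:
  assumes E: "E \<subseteq> {..<n} \<times> {..<n} - F" and e: "e \<notin> E"
    and deg: "\<And>v. v < n \<Longrightarrow> outdeg E v \<le> s v \<and> indeg E v \<le> t v"
  defines "S' \<equiv> biadj n (\<lambda>v. s v - outdeg E v) (\<lambda>v. t v - indeg E v) (F \<union> E)"
  shows "arc_prob (biadj n s t F) (insert e E) = arc_prob (biadj n s t F) E * arc_prob S' {e}"
proof -
  let ?S = "biadj n s t F"
  have b: "bij_betw (\<lambda>G. G - E) {G \<in> ?S. E \<subseteq> G} S'"
    unfolding S'_def by (rule bij_betw_biadj_remove[OF E deg])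
  have c1: "card {G \<in> ?S. E \<subseteq> G} = card S'" by (rule bij_betw_same_card[OF b])
  have "bij_betw (\<lambda>G. G - E) {G \<in> {G \<in> ?S. E \<subseteq> G}. e \<in> G} {G \<in> S'. e \<in> G}"
    unfolding bij_betw_def
  proof
    show "inj_on (\<lambda>G. G - E) {G \<in> {G \<in> ?S. E \<subseteq> G}. e \<in> G}"
      by (rule inj_on_subset[OF bij_betw_imp_inj_on[OF b]]) auto
    have img: "(\<lambda>G. G - E) ` {G \<in> ?S. E \<subseteq> G} = S'" by (rule bij_betw_imp_surj_on[OF b])
    show "(\<lambda>G. G - E) ` {G \<in> {G \<in> ?S. E \<subseteq> G}. e \<in> G} = {G \<in> S'. e \<in> G}"
      unfolding img[symmetric] using e by blast
  qed
  from bij_betw_same_card[OF this]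
  have c2: "card {G \<in> ?S. insert e E \<subseteq> G} = card {G \<in> S'. {e} \<subseteq> G}"
  proof -
    have "{G \<in> ?S. insert e E \<subseteq> G} = {G \<in> {G \<in> ?S. E \<subseteq> G}. e \<in> G}" by auto
    then show ?thesis using \<open>card {G \<in> {G \<in> ?S. E \<subseteq> G}. e \<in> G} = _\<close> by simp
  qed
  have f: "finite S'" by (simp add: S'_def)
  have "card {G \<in> S'. {e} \<subseteq> G} \<le> card S'" by (rule card_mono[OF f]) auto
  then show ?thesis
    unfolding arc_prob_card[OF finite_biadj] arc_prob_card[OF f] c1 c2 by (cases "card S' = 0") simp_all
qed

section \<open>Switchings between two rows\<close>

definition excl :: "nat \<Rightarrow> (nat \<times> nat) set \<Rightarrow> nat \<Rightarrow> nat \<Rightarrow> (nat \<times> nat) set \<Rightarrow> nat set" where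
  "excl n F i j G = {l. l < n \<and> (i, l) \<notin> F \<and> (j, l) \<notin> F \<and> (i, l) \<in> G \<and> (j, l) \<notin> G}"

definition sdiff :: "nat \<Rightarrow> (nat \<times> nat) set \<Rightarrow> nat \<Rightarrow> nat \<Rightarrow> (nat \<times> nat) set \<Rightarrow> nat set" where
  "sdiff n F i j G = {l. l < n \<and> (i, l) \<notin> F \<and> (j, l) \<notin> F \<and> ((i, l) \<in> G) \<noteq> ((j, l) \<in> G)}"

text \<open>The elementary interchange that preserves all margins. \<open>excl\<close> and
  \<open>sdiff\<close> only use columns free in both rows, so an interchange along them never hits
  \<open>F\<close>.\<close>

definition switch :: "nat \<Rightarrow> nat \<Rightarrow> nat \<Rightarrow> nat \<Rightarrow> (nat \<times> nat) set \<Rightarrow> (nat \<times> nat) set" where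
  "switch i j k l G = (G - {(i, k), (j, l)}) \<union> {(i, l), (j, k)}"

lemma finite_excl [simp]: "finite (excl n F i j G)"
  by (auto simp: excl_def)

lemma finite_sdiff [simp]: "finite (sdiff n F i j G)"
  by (auto simp: sdiff_def)

lemma card_sdiff: "card (sdiff n F i j G) = card (excl n F i j G) + card (excl n F j i G)"
  by (subst card_Un_disjoint[symmetric]) (auto simp: excl_def sdiff_def intro!: arg_cong[of _ _ card])

lemma card_exchange:
  assumes "finite A" "k \<in> A" "l \<notin> A" shows "card (insert l (A - {k})) = card A"
proof -
  have "card (insert l (A - {k})) = Suc (card (A - {k}))" using assms by simp
  also have "\<dots> = card A" by (rule card_Suc_Diff1[OF assms(1,2)])
  finally show ?thesis .
qed

lemma switch_swap: "switch j i k l G = switch i j l k G"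
  by (auto simp: switch_def)

lemma switch_biadj:
  assumes G: "G \<in> biadj n s t F" and ij: "i \<noteq> j" "i < n" "j < n"
    and k: "k \<in> excl n F i j G" and l: "l \<in> excl n F j i G"
  shows "switch i j k l G \<in> biadj n s t F"
proof -
  have kl: "k \<noteq> l" using k l by (auto simp: excl_def)
  note kd = k[unfolded excl_def] and ld = l[unfolded excl_def]
  have fG: "finite G" using G by (rule biadj_finite_graph)
  have o: "outdeg (switch i j k l G) v = outdeg G v" for v
  proof -
    consider "v = i" | "v = j" | "v \<noteq> i" "v \<noteq> j" by blast
    then show ?thesis
    proof cases
      case 1
      have "{w. (i, w) \<in> switch i j k l G} = insert l ({w. (i, w) \<in> G} - {k})"
        using kl ij by (auto simp: switch_def)
      then show ?thesis unfolding outdeg_def 1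
        using kd ld by (simp only:) (rule card_exchange, auto simp: finite_out fG)
    next
      case 2
      have "{w. (j, w) \<in> switch i j k l G} = insert k ({w. (j, w) \<in> G} - {l})"
        using kl ij by (auto simp: switch_def)
      then show ?thesis unfolding outdeg_def 2
        using kd ld by (simp only:) (rule card_exchange, auto simp: finite_out fG)
    next
      case 3
      then show ?thesis unfolding outdeg_def switch_def by simp
    qed
  qed
  have i: "indeg (switch i j k l G) v = indeg G v" for v
  proof -
    consider "v = k" | "v = l" | "v \<noteq> k" "v \<noteq> l" by blast
    then show ?thesis
    proof cases
      case 1
      have "{w. (w, k) \<in> switch i j k l G} = insert j ({w. (w, k) \<in> G} - {i})"
        using kl ij by (auto simp: switch_def)
      then show ?thesis unfolding indeg_def 1
        using kd ld by (simp only:) (rule card_exchange, auto simp: finite_in fG)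
    next
      case 2
      have "{w. (w, l) \<in> switch i j k l G} = insert i ({w. (w, l) \<in> G} - {j})"
        using kl ij by (auto simp: switch_def)
      then show ?thesis unfolding indeg_def 2
        using kd ld by (simp only:) (rule card_exchange, auto simp: finite_in fG)
    next
      case 3
      then show ?thesis unfolding indeg_def switch_def by simp
    qed
  qed
  show ?thesis using G o i kd ld ij by (auto simp: biadj_def switch_def)
qed

lemma switch_excl:
  assumes ij: "i \<noteq> j" and k: "k \<in> excl n F i j G" and l: "l \<in> excl n F j i G"
  shows "l \<in> excl n F i j (switch i j k l G)" "k \<in> excl n F j i (switch i j k l G)"
    "switch i j l k (switch i j k l G) = G" "sdiff n F i j (switch i j k l G) = sdiff n F i j G"
proof -
  have kl: "k \<noteq> l" using k l by (auto simp: excl_def)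
  show "l \<in> excl n F i j (switch i j k l G)" "k \<in> excl n F j i (switch i j k l G)"
    "switch i j l k (switch i j k l G) = G" "sdiff n F i j (switch i j k l G) = sdiff n F i j G"
    using ij k l kl by (auto simp: excl_def switch_def sdiff_def)
qed

text \<open>Count pairs of a matrix and a partner column \<open>l\<close>: for fixed
  \<open>k\<close>, switching is a bijection between the pairs with \<open>k\<close> in row
  \<open>i\<close> only and \<open>l\<close> in row \<open>j\<close> only and the pairs with these
  roles exchanged. The set of columns where the rows differ does not change, so a weight depending
  on \<open>sdiff\<close> alone is carried along.\<close>

lemma switch_sum:
  fixes g :: "nat set \<Rightarrow> real"
  assumes ij: "i \<noteq> j" "i < n" "j < n"
  shows "(\<Sum>G\<in>biadj n s t F. g (sdiff n F i j G) * of_bool (k \<in> excl n F i j G) * real (card (excl n F j i G)))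
       = (\<Sum>G\<in>biadj n s t F. g (sdiff n F i j G) * of_bool (k \<in> excl n F j i G) * real (card (excl n F i j G)))"
proof -
  let ?S = "biadj n s t F"
  have *: "(\<Sum>G\<in>?S. g (sdiff n F i j G) * of_bool (k \<in> excl n F a b G) * real (card (excl n F b a G)))
     = (\<Sum>(G,l)\<in>(SIGMA G:{G\<in>?S. k \<in> excl n F a b G}. excl n F b a G). g (sdiff n F i j G))" for a b
  proof -
    have "(\<Sum>(G,l)\<in>(SIGMA G:{G\<in>?S. k \<in> excl n F a b G}. excl n F b a G). g (sdiff n F i j G))
      = (\<Sum>G\<in>{G\<in>?S. k \<in> excl n F a b G}. \<Sum>l\<in>excl n F b a G. g (sdiff n F i j G))"
      by (subst sum.Sigma) auto
    also have "\<dots> = (\<Sum>G\<in>{G\<in>?S. k \<in> excl n F a b G}. g (sdiff n F i j G) * real (card (excl n F b a G)))"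
      by (simp add: mult.commute)
    also have "\<dots> = (\<Sum>G\<in>?S. if k \<in> excl n F a b G then g (sdiff n F i j G) * real (card (excl n F b a G)) else 0)"
      by (rule sum.inter_filter) simp
    also have "\<dots> = (\<Sum>G\<in>?S. g (sdiff n F i j G) * of_bool (k \<in> excl n F a b G) * real (card (excl n F b a G)))"
      by (rule sum.cong) auto
    finally show ?thesis ..
  qed
  show ?thesis unfolding *
  proof (rule sum.reindex_bij_witness[where
        i = "\<lambda>(G,l). (switch j i k l G, l)" and j = "\<lambda>(G,l). (switch i j k l G, l)"], goal_cases)
    case (1 a)
    then obtain G l where "a = (G, l)" "k \<in> excl n F i j G" "l \<in> excl n F j i G" by auto
    then show ?case using switch_excl(3)[OF ij(1)] by (simp add: switch_swap[of j i])
  next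
    case (2 a)
    then obtain G l where "a = (G, l)" "G \<in> ?S" "k \<in> excl n F i j G" "l \<in> excl n F j i G" by auto
    then show ?case using switch_biadj[OF _ ij] switch_excl(1,2)[OF ij(1)] by simp
  next
    case (3 a)
    then obtain G l where "a = (G, l)" "k \<in> excl n F j i G" "l \<in> excl n F i j G" by auto
    then show ?case using switch_excl(3)[of j i k n F G l] ij(1) by (simp add: switch_swap[of j i])
  next
    case (4 a)
    then obtain G l where "a = (G, l)" "G \<in> ?S" "k \<in> excl n F j i G" "l \<in> excl n F i j G" by auto
    then show ?case using switch_biadj[of G n s t F j i k l] ij switch_excl(1,2)[of j i k n F G l] by simp
  next
    case (5 a)
    then obtain G l where "a = (G, l)" "k \<in> excl n F i j G" "l \<in> excl n F j i G" by auto
    then show ?case using switch_excl(4)[OF ij(1)] by simp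
  qed
qed

lemma arc_prob_single: "arc_prob S {e} = expect_unif S (\<lambda>G. of_bool (e \<in> G))"
  by (simp add: arc_prob_def)

text \<open>Let S be the set of columns where the rows differ and p, q the numbers of ones of the
  two rows in it. If \<open>k\<close> is in S, the difference of the two indicators is (p - q)/|S|
  plus twice a quantity that changes sign under switching; \<open>switch_sum\<close> with weight
  1/|S| removes the latter in the mean.\<close>

lemma arc_prob_row_diff:
  fixes s t :: "nat \<Rightarrow> nat"
  assumes ij: "i \<noteq> j" "i < n" "j < n" and k: "k < n" "(i, k) \<notin> F" "(j, k) \<notin> F"
  defines "S \<equiv> biadj n s t F"
  shows "arc_prob S {(i, k)} - arc_prob S {(j, k)} =
    expect_unif S (\<lambda>G. of_bool (k \<in> sdiff n F i j G) *
      (real (card (excl n F i j G)) - real (card (excl n F j i G))) / real (card (sdiff n F i j G)))"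
proof -
  let ?m = "\<lambda>a b G. real (card (excl n F a b G))"
  let ?o = "\<lambda>a b G. (of_bool (k \<in> excl n F a b G) :: real)"
  let ?c = "\<lambda>G. real (card (sdiff n F i j G))"
  have *: "(of_bool ((i,k) \<in> G) - of_bool ((j,k) \<in> G) :: real)
     = of_bool (k \<in> sdiff n F i j G) * (?m i j G - ?m j i G) / ?c G
       + 2 * (1 / ?c G * ?o i j G * ?m j i G - 1 / ?c G * ?o j i G * ?m i j G)" for G
  proof (cases "k \<in> sdiff n F i j G")
    case True
    then have c0: "?c G > 0" by (auto simp: card_gt_0_iff)
    have c: "?c G = ?m i j G + ?m j i G" by (simp add: card_sdiff)
    have o: "?o i j G = of_bool ((i,k) \<in> G)" "?o j i G = of_bool ((j,k) \<in> G)"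
      "((i,k) \<in> G) \<noteq> ((j,k) \<in> G)"
      using True k by (auto simp: sdiff_def excl_def)
    have "x - y = (p - q) / d + 2 * (1 / d * x * q - 1 / d * y * p)"
      if "d = p + q" "d > 0" "x = 0 \<and> y = 1 \<or> x = 1 \<and> y = 0" for x y p q d :: real
    proof -
      have "q / d = 1 - p / d" using that by (simp add: field_simps)
      then show ?thesis using that(3) by (auto simp: diff_divide_distrib)
    qed
    from this[OF c c0] show ?thesis using True o by simp
  next
    case False
    then have "k \<notin> excl n F i j G" "k \<notin> excl n F j i G" "((i,k) \<in> G) = ((j,k) \<in> G)"
      using k by (auto simp: sdiff_def excl_def)
    then show ?thesis using False by simp
  qed
  have z: "expect_unif S (\<lambda>G. 1 / ?c G * ?o i j G * ?m j i G) = expect_unif S (\<lambda>G. 1 / ?c G * ?o j i G * ?m i j G)"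
    unfolding expect_unif_def S_def using switch_sum[OF ij, of "\<lambda>A. 1 / real (card A)"] by simp
  show ?thesis
    unfolding arc_prob_single expect_unif_diff[symmetric] *
    by (simp only: expect_unif_add expect_unif_cmult expect_unif_diff z diff_self mult_zero_right add_0_right)
qed

section \<open>A lower tail bound for the symmetric difference of two rows\<close>

definition rt :: "nat \<Rightarrow> real" where "rt n = sqrt (real n)"

text \<open>\<^term>\<open>L\<close> stands for a small power of \<^term>\<open>n\<close>: it absorbs constants, logarithms and
  the factors \<open>n^\<epsilon>\<close>, so that every estimate below is explicit, a power of \<^term>\<open>L\<close> over a power of \<open>\<surd>n\<close>. The density
  \<^term>\<open>lam\<close> is that of the initial instance and is kept fixed when arcs are conditioned on.\<close>

locale near_regular =
  fixes n :: nat and L lam :: real and s t :: "nat \<Rightarrow> nat" and F :: "(nat \<times> nat) set"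
  assumes L_ge: "100 \<le> L"
    and L_pow: "L ^ 20 \<le> real n"
    and n_large: "2 * real n ^ 3 \<le> 2 powr rt n"
    and lam_var: "1 / L \<le> lam * (1 - lam)"
    and s_near: "\<And>v. v < n \<Longrightarrow> \<bar>real (s v) - lam * real n\<bar> \<le> L * rt n"
    and t_near: "\<And>v. v < n \<Longrightarrow> \<bar>real (t v) - lam * real n\<bar> \<le> L * rt n"
    and sum_st: "(\<Sum>v<n. s v) = (\<Sum>v<n. t v)"
    and sum_near: "\<bar>real (\<Sum>v<n. s v) - lam * real n ^ 2\<bar> \<le> L * real n"
    and F_sub: "F \<subseteq> {..<n} \<times> {..<n}"
    and F_out: "\<And>v. v < n \<Longrightarrow> real (outdeg F v) \<le> L"
    and F_in: "\<And>v. v < n \<Longrightarrow> real (indeg F v) \<le> L"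
begin

abbreviation "r \<equiv> rt n"
abbreviation "Om \<equiv> biadj n s t F"

section \<open>Numerical consequences of the size of \<open>L\<close>\<close>

lemma n_eq: "real n = r * r" by (simp add: rt_def)

lemma r_ge: "L ^ 10 \<le> r"
proof -
  have "(L ^ 10)\<^sup>2 \<le> real n" using L_pow by (simp flip: power_mult)
  then show ?thesis unfolding rt_def by (rule real_le_rsqrt)
qed

lemma L_pos: "L > 0" using L_ge by simp

lemma r_ge_pow: "k \<le> 10 \<Longrightarrow> L ^ k \<le> r"
  using r_ge power_increasing[of k 10 L] L_ge by linarith

text \<open>One spare factor \<open>L \<ge> 100\<close> is traded for the numeral 100; this is how
  many constants below disappear into powers of \<open>L\<close>.\<close>

lemma r_ge_const: "k \<le> 9 \<Longrightarrow> 100 * L ^ k \<le> r"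
proof -
  assume "k \<le> 9"
  then have "L ^ Suc k \<le> r" by (intro r_ge_pow) simp
  moreover have "100 * L ^ k \<le> L ^ Suc k" using L_ge by simp
  ultimately show ?thesis by linarith
qed

lemma r_ge_100: "100 \<le> r" using r_ge_const[of 0] by simp

lemma r_pos: "r > 0" using r_ge_100 by linarith

lemma L_le_Lr: "L \<le> L * r"
  using mult_left_mono[of 1 r L] r_ge_100 L_pos by linarith

lemma n_pos: "n > 0" using r_pos by (cases n) (auto simp: rt_def)

lemma lam_bounds: "0 < lam" "lam < 1" "1 / L \<le> lam" "1 / L \<le> 1 - lam"
proof -
  have p: "0 < lam * (1 - lam)" using lam_var L_pos by (smt (verit) divide_pos_pos)
  show a: "0 < lam" "lam < 1" using p by (auto simp: zero_less_mult_iff)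
  have "lam * (1 - lam) \<le> lam * 1" "lam * (1 - lam) \<le> 1 * (1 - lam)"
    using a by (intro mult_mono; simp)+
  then show "1 / L \<le> lam" "1 / L \<le> 1 - lam" using lam_var by auto
qed

lemma finite_F: "finite F" by (rule finite_subset[OF F_sub]) simp

lemma Om_disj: "G \<in> Om \<Longrightarrow> e \<in> G \<Longrightarrow> e \<notin> F" by (auto simp: biadj_def)
lemma Om_bnd: "G \<in> Om \<Longrightarrow> (a, b) \<in> G \<Longrightarrow> a < n \<and> b < n" by (auto simp: biadj_def)
lemma Om_out: "G \<in> Om \<Longrightarrow> v < n \<Longrightarrow> card {w. (v, w) \<in> G} = s v" by (auto simp: biadj_def outdeg_def)
lemma Om_in: "G \<in> Om \<Longrightarrow> v < n \<Longrightarrow> card {w. (w, v) \<in> G} = t v" by (auto simp: biadj_def indeg_def)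

lemma F_row: "v < n \<Longrightarrow> real (card {w. (v, w) \<in> F}) \<le> L" using F_out by (simp add: outdeg_def)
lemma F_col: "v < n \<Longrightarrow> real (card {w. (w, v) \<in> F}) \<le> L" using F_in by (simp add: indeg_def)

context
  fixes i j :: nat
  assumes ij: "i \<noteq> j" "i < n" "j < n"
begin

text \<open>\<open>common q\<close> and \<open>avoided q\<close> supply the columns u and v for a
  switch of row \<open>i\<close> with a third row \<open>q\<close>: row \<open>i\<close> loses an
  arc that row \<open>j\<close> shares and gains one in a column where row \<open>j\<close> has a
  free empty cell. Both columns then join the difference of rows \<open>i\<close> and
  \<open>j\<close>.\<close>

definition common :: "nat \<Rightarrow> (nat \<times> nat) set \<Rightarrow> nat set" where
  "common q G = {u. u < n \<and> (i,u) \<in> G \<and> (j,u) \<in> G \<and> (q,u) \<notin> G \<and> (q,u) \<notin> F}"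
definition avoided :: "nat \<Rightarrow> (nat \<times> nat) set \<Rightarrow> nat set" where
  "avoided q G = {v. v < n \<and> (q,v) \<in> G \<and> (i,v) \<notin> G \<and> (i,v) \<notin> F \<and> (j,v) \<notin> G \<and> (j,v) \<notin> F}"

lemma finite_common: "finite (common q G)" by (auto simp: common_def)
lemma finite_avoided: "finite (avoided q G)" by (auto simp: avoided_def)

text \<open>Rows that differ in at most \<open>d\<close> columns share almost all of their about
  \<open>lam * n\<close> ones, and each such column has about \<open>(1 - lam) * n\<close> free
  empty cells. The pairs number about \<open>lam * (1 - lam) * n^2\<close>, which is at least
  \<open>n^2 / L\<close>; the factor 3/4 absorbs the errors.\<close>

lemma card_common_sum:
  assumes G: "G \<in> Om" and c: "real (card (sdiff n F i j G)) \<le> d" and d: "d \<le> real n / (8 * L)"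
  shows "real n * (3 * real n / (4 * L)) \<le> (\<Sum>q<n. real (card (common q G)))"
proof -
  let ?B = "{u. (i,u) \<in> G \<and> (j,u) \<in> G}"
  have fG: "finite G" using G by (rule biadj_finite_graph)
  have fB: "finite ?B" by (rule finite_subset[OF _ finite_out[OF fG, of i]]) auto
  have fS: "finite {u. (a,u) \<in> G}" for a by (rule finite_out[OF fG])
  have "{u. (i,u) \<in> G} \<subseteq> ?B \<union> (sdiff n F i j G \<union> {u. (j,u) \<in> F})"
    using Om_bnd[OF G] Om_disj[OF G] by (auto simp: sdiff_def)
  then have "card {u. (i,u) \<in> G} \<le> card (?B \<union> (sdiff n F i j G \<union> {u. (j,u) \<in> F}))"
    by (intro card_mono) (auto simp: fB finite_out finite_F)
  also have "\<dots> \<le> card ?B + (card (sdiff n F i j G) + card {u. (j,u) \<in> F})"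
    by (meson add_left_mono card_Un_le le_trans)
  finally have "real (s i) \<le> real (card ?B) + d + L"
    using c F_row[OF ij(3)] Om_out[OF G ij(2)] by linarith
  then have B: "lam * real n - L * r - d - L \<le> real (card ?B)" using s_near[OF ij(2)] by linarith
  have col: "(1 - lam) * real n - L * r - L \<le> real (card {q. q < n \<and> (q,u) \<notin> G \<and> (q,u) \<notin> F})" if "u < n" for u
  proof -
    have "{..<n} \<subseteq> {q. q < n \<and> (q,u) \<notin> G \<and> (q,u) \<notin> F} \<union> ({q. (q,u) \<in> G} \<union> {q. (q,u) \<in> F})" by auto
    then have "card {..<n} \<le> card ({q. q < n \<and> (q,u) \<notin> G \<and> (q,u) \<notin> F} \<union> ({q. (q,u) \<in> G} \<union> {q. (q,u) \<in> F}))"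
      by (intro card_mono) (auto simp: finite_in finite_F fG)
    also have "\<dots> \<le> card {q. q < n \<and> (q,u) \<notin> G \<and> (q,u) \<notin> F} + (card {q. (q,u) \<in> G} + card {q. (q,u) \<in> F})"
      by (meson add_left_mono card_Un_le le_trans)
    finally have "real n \<le> real (card {q. q < n \<and> (q,u) \<notin> G \<and> (q,u) \<notin> F}) + real (t u) + L"
      using F_col[OF that] Om_in[OF G that] by simp
    then show ?thesis using t_near[OF that] by (simp add: algebra_simps)
  qed
  have "(\<Sum>q<n. real (card (common q G))) = (\<Sum>q<n. \<Sum>u\<in>?B. of_bool ((q,u) \<notin> G \<and> (q,u) \<notin> F))"
  proof (rule sum.cong)
    fix q assume "q \<in> {..<n}"
    have "common q G = {u\<in>?B. (q,u) \<notin> G \<and> (q,u) \<notin> F}" using Om_bnd[OF G] by (auto simp: common_def)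
    then show "real (card (common q G)) = (\<Sum>u\<in>?B. of_bool ((q,u) \<notin> G \<and> (q,u) \<notin> F))"
      using fB by (simp add: of_bool_def sum.If_cases Int_def)
  qed simp
  also have "\<dots> = (\<Sum>u\<in>?B. \<Sum>q<n. of_bool ((q,u) \<notin> G \<and> (q,u) \<notin> F))" by (rule sum.swap)
  also have "\<dots> = (\<Sum>u\<in>?B. real (card {q. q < n \<and> (q,u) \<notin> G \<and> (q,u) \<notin> F}))"
    by (simp add: of_bool_def sum.If_cases Int_def)
  also have "\<dots> \<ge> (\<Sum>u\<in>?B. (1 - lam) * real n - L * r - L)"
    using col Om_bnd[OF G] by (intro sum_mono) auto
  finally have S: "real (card ?B) * ((1 - lam) * real n - L * r - L) \<le> (\<Sum>q<n. real (card (common q G)))" by simp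
  have e: "L * r + L \<le> real n / (16 * L)"
  proof -
    have "100 * L ^ 2 \<le> r" by (rule r_ge_const) simp
    then have "32 * L ^ 2 \<le> r" using zero_le_power2[of L] by linarith
    then have "r * (32 * L ^ 2) \<le> r * r" using r_pos by (intro mult_left_mono) auto
    moreover from L_le_Lr have "(L * r + L) * (16 * L) \<le> (2 * (L * r)) * (16 * L)" using L_pos by (intro mult_right_mono) auto
    ultimately have "(L * r + L) * (16 * L) \<le> real n" by (simp add: n_eq power2_eq_square algebra_simps)
    then show ?thesis using L_pos by (simp add: le_divide_eq)
  qed
  define N where "N = real n"
  define y where "y = N / L"
  have y: "N = y * L" "0 \<le> y" using L_pos by (auto simp: y_def N_def)
  have a1: "lam * N - 3 * y / 16 \<le> real (card ?B)" using B e d by (simp add: y_def N_def)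
  have a2: "(1 - lam) * N - y / 16 \<le> (1 - lam) * real n - L * r - L" using e by (simp add: y_def N_def)
  have "y \<le> lam * N" "y \<le> (1 - lam) * N"
    using lam_bounds mult_right_mono[of "1/L" _ N] by (auto simp: y_def N_def)
  then have "(lam * N - 3 * y / 16) * ((1 - lam) * N - y / 16) \<le> real (card ?B) * ((1 - lam) * real n - L * r - L)"
    using a1 a2 y by (intro mult_mono) auto
  moreover have "N * (3 * N / (4 * L)) \<le> (lam * N - 3 * y / 16) * ((1 - lam) * N - y / 16)"
  proof -
    have "(1 / L) * (N * N) \<le> (lam * (1 - lam)) * (N * N)" by (intro mult_right_mono lam_var) auto
    then have "y * N \<le> lam * (1 - lam) * N * N" by (simp add: y_def algebra_simps)
    moreover have "lam * (y * N) \<le> y * N" "(1 - lam) * (y * N) \<le> y * N" "0 \<le> lam * (y * N)" "0 \<le> (1 - lam) * (y * N)"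
      using lam_bounds y by (auto simp: mult_left_le_one_le N_def)
    moreover have "N * (3 * N / (4 * L)) = 3 / 4 * (y * N)" by (simp add: y_def)
    moreover have "(lam * N - 3 * y / 16) * ((1 - lam) * N - y / 16)
      = lam * (1 - lam) * N * N - lam * (y * N) / 16 - 3 / 16 * ((1 - lam) * (y * N)) + 3 * (y * y) / 256"
      by (simp add: field_simps)
    moreover have "0 \<le> y * y" by simp
    ultimately show ?thesis by linarith
  qed
  ultimately show ?thesis using S by (simp add: N_def)
qed

text \<open>Rows \<open>i\<close> and \<open>q\<close> have nearly equal sums, so the ones of
  \<open>q\<close> missing from \<open>i\<close> are about as many as the ones of \<open>i\<close>
  missing from \<open>q\<close>, and the latter include \<open>common q\<close>. A one of
  \<open>q\<close> missing from \<open>i\<close> fails to be avoided only at a forbidden cell or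
  where rows \<open>i\<close> and \<open>j\<close> differ.\<close>

lemma card_avoided_ge:
  assumes G: "G \<in> Om" and c: "real (card (sdiff n F i j G)) \<le> d" and q: "q < n"
  shows "real (card (common q G)) - (2 * L * r + 2 * L + d) \<le> real (card (avoided q G))"
proof -
  have fG: "finite G" using G by (rule biadj_finite_graph)
  have f: "finite {u. (a,u) \<in> G}" for a by (rule finite_out[OF fG])
  let ?I = "{u. (i,u) \<in> G}" and ?Q = "{u. (q,u) \<in> G}"
  have "common q G \<subseteq> ?I - ?Q" by (auto simp: common_def)
  then have "card (common q G) \<le> card (?I - ?Q)" by (intro card_mono) (auto simp: f)
  moreover have "card (?I - ?Q) + card (?I \<inter> ?Q) = s i"
    using Om_out[OF G ij(2)] card_Diff_subset_Int[of ?I ?Q] card_mono[of ?I "?I \<inter> ?Q"] f by auto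
  moreover have "card (?Q - ?I) + card (?I \<inter> ?Q) = s q"
    using Om_out[OF G q] card_Diff_subset_Int[of ?Q ?I] card_mono[of ?Q "?Q \<inter> ?I"] f by (auto simp: Int_commute)
  moreover have "?Q - ?I \<subseteq> avoided q G \<union> (sdiff n F i j G \<union> ({v. (i,v) \<in> F} \<union> {v. (j,v) \<in> F}))"
    using Om_bnd[OF G] by (auto simp: avoided_def sdiff_def)
  then have "card (?Q - ?I) \<le> card (avoided q G \<union> (sdiff n F i j G \<union> ({v. (i,v) \<in> F} \<union> {v. (j,v) \<in> F})))"
    by (intro card_mono) (auto simp: finite_out finite_F finite_avoided)
  then have "card (?Q - ?I) \<le> card (avoided q G) + (card (sdiff n F i j G) + (card {v. (i,v) \<in> F} + card {v. (j,v) \<in> F}))"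
    by (meson add_left_mono card_Un_le le_trans)
  ultimately show ?thesis
    using c F_row[OF ij(2)] F_row[OF ij(3)] s_near[OF ij(2)] s_near[OF q] by linarith
qed

text \<open>Each product is at least u*(u - C) with u the size of \<open>common q\<close>. Replacing
  u^2 by its tangent 2*a*u - a^2 at the guaranteed mean a makes the sum over \<open>q\<close> linear
  in the known total.\<close>

lemma card_moves_ge:
  assumes G: "G \<in> Om" and c: "real (card (sdiff n F i j G)) \<le> d" and d: "d \<le> real n / (8 * L)"
  shows "3 * real n ^ 3 / (8 * L\<^sup>2) \<le> (\<Sum>q<n. real (card (common q G)) * real (card (avoided q G)))"
proof -
  define a where "a = 3 * real n / (4 * L)"
  define C where "C = 2 * L * r + 2 * L + d"
  let ?u = "\<lambda>q. real (card (common q G))"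
  have C: "C \<le> real n / (4 * L)"
  proof -
    have "100 * L ^ 2 \<le> r" by (rule r_ge_const) simp
    then have "32 * L ^ 2 \<le> r" using zero_le_power2[of L] by linarith
    then have "r * (32 * L ^ 2) \<le> r * r" using r_pos by (intro mult_left_mono) auto
    moreover from L_le_Lr have "(2 * L * r + 2 * L) * (8 * L) \<le> (4 * (L * r)) * (8 * L)" using L_pos by (intro mult_right_mono) auto
    ultimately have "(2 * L * r + 2 * L) * (8 * L) \<le> real n" by (simp add: n_eq power2_eq_square algebra_simps)
    then have "2 * L * r + 2 * L \<le> real n / (8 * L)" using L_pos by (simp add: le_divide_eq)
    then show ?thesis using d by (simp add: C_def)
  qed
  have a0: "0 \<le> a" using L_pos by (simp add: a_def)
  have S: "real n * a \<le> (\<Sum>q<n. ?u q)" using card_common_sum[OF assms] by (simp add: a_def)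
  have "(2 * a - C) * ?u q - a * a \<le> ?u q * real (card (avoided q G))" if "q < n" for q
  proof -
    have "?u q * (?u q - C) \<le> ?u q * real (card (avoided q G))"
      using card_avoided_ge[OF G c that] by (intro mult_left_mono) (auto simp: C_def)
    moreover have "0 \<le> (?u q - a) * (?u q - a)" by simp
    ultimately show ?thesis by (simp add: algebra_simps)
  qed
  then have "(\<Sum>q<n. (2 * a - C) * ?u q - a * a) \<le> (\<Sum>q<n. ?u q * real (card (avoided q G)))"
    by (intro sum_mono) auto
  then have "(2 * a - C) * (\<Sum>q<n. ?u q) - real n * (a * a) \<le> (\<Sum>q<n. ?u q * real (card (avoided q G)))"
    by (simp add: sum_subtractf sum_distrib_left)
  moreover have "(2 * a - C) * (real n * a) \<le> (2 * a - C) * (\<Sum>q<n. ?u q)"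
  proof (rule mult_left_mono[OF S])
    have "real n / (4 * L) \<le> 2 * a" using L_pos by (simp add: a_def field_simps)
    then show "0 \<le> 2 * a - C" using C by linarith
  qed
  moreover have "(2 * a - C) * (real n * a) - real n * (a * a) = real n * a * (a - C)" by (simp add: algebra_simps)
  moreover have "real n * a * (real n / (2 * L)) \<le> real n * a * (a - C)"
  proof (intro mult_left_mono)
    have "a = real n / (2 * L) + real n / (4 * L)" using L_pos by (simp add: a_def field_simps)
    then show "real n / (2 * L) \<le> a - C" using C by linarith
  qed (use a0 in auto)
  moreover have "real n * a * (real n / (2 * L)) = 3 * real n ^ 3 / (8 * L\<^sup>2)"
    by (simp add: a_def power2_eq_square power3_eq_cube)
  ultimately show ?thesis by linarith
qed

text \<open>If rows \<open>i\<close> and \<open>j\<close> differ in few columns, a switch of row \<open>i\<close> with a third row makes them differ in two more; there are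
  of order \<open>n^3\<close> such switches, but few that lead back.\<close>

lemma sdiff_tail_step:
  assumes d: "real d + 2 \<le> real n / (8 * L)"
  shows "24 * real (card {G\<in>Om. card (sdiff n F i j G) \<le> d}) \<le> real (card {G\<in>Om. card (sdiff n F i j G) \<le> d + 2})"
proof -
  let ?A = "{G\<in>Om. card (sdiff n F i j G) \<le> d}" and ?B = "{G\<in>Om. card (sdiff n F i j G) \<le> d + 2}"
  define X where "X = (SIGMA G:?A. SIGMA q:{..<n}. common q G \<times> avoided q G)"
  \<comment> \<open>The target of the injection: the new matrix with \<open>q\<close>,
    \<open>u\<close>, \<open>v\<close> determines the old one, and \<open>u\<close>,
    \<open>v\<close> both lie in the new difference, which has at most \<open>n / (8 * L)\<close>
    columns.\<close>
  define Y where "Y = (SIGMA G:?B. {..<n} \<times> (sdiff n F i j G \<times> sdiff n F i j G))"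
  have key: "i \<noteq> q" "q \<noteq> j" "u \<in> excl n F i q G" "v \<in> excl n F q i G"
    "sdiff n F i j (switch i q u v G) = insert u (insert v (sdiff n F i j G))"
    if "G \<in> Om" "u \<in> common q G" "v \<in> avoided q G" for G q u v
    using that ij Om_disj[OF that(1)] by (auto simp: common_def avoided_def excl_def sdiff_def switch_def)
  have "(3 * real n ^ 3 / (8 * L\<^sup>2)) * real (card ?A) = (\<Sum>G\<in>?A. 3 * real n ^ 3 / (8 * L\<^sup>2))" by simp
  also have "\<dots> \<le> (\<Sum>G\<in>?A. \<Sum>q<n. real (card (common q G)) * real (card (avoided q G)))"
  proof (rule sum_mono)
    fix G assume "G \<in> ?A"
    then show "3 * real n ^ 3 / (8 * L\<^sup>2) \<le> (\<Sum>q<n. real (card (common q G)) * real (card (avoided q G)))"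
      using d by (intro card_moves_ge[where d = "real d"]) auto
  qed
  also have "\<dots> = real (card X)"
    unfolding X_def by (subst card_SigmaI) (auto simp: finite_common finite_avoided card_cartesian_product)
  also have "card X \<le> card Y"
  proof (rule card_inj_on_le[where f = "\<lambda>(G,q,u,v). (switch i q u v G,q,u,v)"])
    show "inj_on (\<lambda>(G,q,u,v). (switch i q u v G,q,u,v)) X"
    proof (rule inj_onI, clarsimp simp: X_def)
      fix G G' q u v
      assume *: "G \<in> Om" "u \<in> common q G" "v \<in> avoided q G" "G' \<in> Om" "u \<in> common q G'" "v \<in> avoided q G'"
        "switch i q u v G = switch i q u v G'"
      show "G = G'"
        using switch_excl(3)[OF key(1,3,4)[OF *(1,2,3)]] switch_excl(3)[OF key(1,3,4)[OF *(4,5,6)]] *(7) by metis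
    qed
    show "(\<lambda>(G,q,u,v). (switch i q u v G,q,u,v)) ` X \<subseteq> Y"
    proof (clarsimp simp: X_def Y_def)
      fix G q u v assume *: "G \<in> Om" "u \<in> common q G" "v \<in> avoided q G" "q < n" "card (sdiff n F i j G) \<le> d"
      note k = key[OF *(1,2,3)]
      show "switch i q u v G \<in> Om \<and> card (sdiff n F i j (switch i q u v G)) \<le> Suc (Suc d)
         \<and> u \<in> sdiff n F i j (switch i q u v G) \<and> v \<in> sdiff n F i j (switch i q u v G)"
        unfolding k(5) using switch_biadj[OF *(1) k(1) ij(2) *(4) k(3,4)] *(5)
        by (auto simp: card_insert_if)
    qed
    show "finite Y" unfolding Y_def by auto
  qed
  also have "real (card Y) = (\<Sum>G\<in>?B. real n * (real (card (sdiff n F i j G)) * real (card (sdiff n F i j G))))"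
    unfolding Y_def by (subst card_SigmaI) (auto simp: card_cartesian_product)
  also have "\<dots> \<le> (\<Sum>G\<in>?B. real n * (real n / (8 * L) * (real n / (8 * L))))"
  proof (rule sum_mono)
    fix G assume "G \<in> ?B"
    then have "real (card (sdiff n F i j G)) \<le> real n / (8 * L)" using d by auto
    then show "real n * (real (card (sdiff n F i j G)) * real (card (sdiff n F i j G)))
      \<le> real n * (real n / (8 * L) * (real n / (8 * L)))" by (intro mult_left_mono mult_mono) auto
  qed
  \<comment> \<open>In units of \<open>n^3 / L^2\<close>, each matrix has at least 3/8 moves forward
    and at most 1/64 backward; the quotient is 24.\<close>
  also have "\<dots> = (real n ^ 3 / (64 * L\<^sup>2)) * real (card ?B)"
    by (simp add: power2_eq_square power3_eq_cube)
  finally have "(real n ^ 3 / (64 * L\<^sup>2)) * (24 * real (card ?A)) \<le> (real n ^ 3 / (64 * L\<^sup>2)) * real (card ?B)"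
    by simp
  moreover have "0 < real n ^ 3 / (64 * L\<^sup>2)" using n_pos L_pos by simp
  ultimately show ?thesis using mult_le_cancel_left_pos by blast
qed

text \<open>Each step raises the threshold by 2 and at least doubles the count, as long as the
  threshold stays below \<open>n / (8 * L)\<close>. Of the factor 24 only 2 is kept.\<close>

lemma sdiff_tail_iter:
  assumes "real d + 2 * real k \<le> real n / (8 * L)"
  shows "2 ^ k * real (card {G\<in>Om. card (sdiff n F i j G) \<le> d}) \<le> real (card Om)"
  using assms
proof (induction k arbitrary: d)
  case 0
  then show ?case by (simp add: card_mono)
next
  case (Suc k)
  have "2 * real (card {G\<in>Om. card (sdiff n F i j G) \<le> d}) \<le> 24 * real (card {G\<in>Om. card (sdiff n F i j G) \<le> d})" by simp
  also have "\<dots> \<le> real (card {G\<in>Om. card (sdiff n F i j G) \<le> d + 2})"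
    using Suc.prems by (intro sdiff_tail_step) simp
  finally have "2 ^ k * (2 * real (card {G\<in>Om. card (sdiff n F i j G) \<le> d})) \<le>
      2 ^ k * real (card {G\<in>Om. card (sdiff n F i j G) \<le> d + 2})" by (intro mult_left_mono) auto
  also have "\<dots> \<le> real (card Om)" using Suc.prems by (intro Suc.IH) simp
  finally show ?case by simp
qed

text \<open>Starting at \<open>n / (16 * L)\<close> there is room for about
  \<open>n / (32 * L)\<close> steps of size 2 before \<open>n / (8 * L)\<close>. These are at least
  r - 1 steps, and \<open>n_large\<close> gives 2^(r - 1) \<ge> n^3.\<close>

lemma sdiff_tail:
  "expect_unif Om (\<lambda>G. of_bool (real (card (sdiff n F i j G)) < real n / (16 * L))) \<le> 1 / real n ^ 3"
proof -
  define k where "k = nat \<lfloor>real n / (32 * L)\<rfloor>"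
  define d where "d = nat \<lfloor>real n / (16 * L)\<rfloor>"
  have nn: "0 \<le> real n / (32 * L)" "0 \<le> real n / (16 * L)" using L_pos by auto
  have k: "real k \<le> real n / (32 * L)" "real n / (32 * L) - 1 \<le> real k" unfolding k_def using nn(1) by linarith+
  have d: "real d \<le> real n / (16 * L)" unfolding d_def using nn(2) by linarith
  have "real d + 2 * real k \<le> real n / (16 * L) + 2 * (real n / (32 * L))" using k d by linarith
  also have "\<dots> = real n / (8 * L)" using L_pos by (simp add: field_simps)
  finally have it: "2 ^ k * real (card {G\<in>Om. card (sdiff n F i j G) \<le> d}) \<le> real (card Om)" by (rule sdiff_tail_iter)
  have "{G\<in>Om. real (card (sdiff n F i j G)) < real n / (16 * L)} \<subseteq> {G\<in>Om. card (sdiff n F i j G) \<le> d}"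
    unfolding d_def using nn(2) by (auto simp: le_nat_floor)
  then have sub: "real (card {G\<in>Om. real (card (sdiff n F i j G)) < real n / (16 * L)}) \<le> real (card {G\<in>Om. card (sdiff n F i j G) \<le> d})"
    by (intro of_nat_mono card_mono) auto
  have "r \<le> real n / (32 * L)"
  proof -
    have "32 * L \<le> r" using r_ge_const[of 1] L_pos by simp
    then have "r * (32 * L) \<le> r * r" using r_pos by (intro mult_left_mono) auto
    then show ?thesis using L_pos by (simp add: n_eq le_divide_eq)
  qed
  then have "2 powr r \<le> 2 powr (real k + 1)" using k by (intro powr_mono) auto
  also have "\<dots> = 2 * 2 ^ k" by (simp add: powr_add powr_realpow)
  finally have nk: "real n ^ 3 \<le> 2 ^ k" using n_large by linarith
  let ?c = "real (card {G\<in>Om. real (card (sdiff n F i j G)) < real n / (16 * L)})"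
  have "?c * real n ^ 3 \<le> ?c * 2 ^ k" using nk by (intro mult_left_mono) auto
  also have "\<dots> \<le> real (card {G\<in>Om. card (sdiff n F i j G) \<le> d}) * 2 ^ k" using sub by (intro mult_right_mono) auto
  also have "\<dots> \<le> real (card Om)" using it by (simp add: mult.commute)
  finally have "?c * real n ^ 3 \<le> real (card Om)" .
  then show ?thesis unfolding expect_unif_of_bool[OF finite_biadj] using n_pos
    by (cases "card Om = 0") (auto simp: divide_le_eq field_simps)
qed

end

end

section \<open>Arc probabilities, first approximation\<close>

lemma arc_prob_eq_0:
  assumes E: "E \<subseteq> {..<n} \<times> {..<n} - F"
    and deg: "\<And>v. v < n \<Longrightarrow> outdeg E v \<le> s v \<and> indeg E v \<le> t v"
    and e: "biadj n (\<lambda>v. s v - outdeg E v) (\<lambda>v. t v - indeg E v) (F \<union> E) = {}"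
  shows "arc_prob (biadj n s t F) E = 0"
  using bij_betw_same_card[OF bij_betw_biadj_remove[OF E deg]] e by (simp add: arc_prob_card)

context near_regular
begin

abbreviation "cS i j G \<equiv> real (card (sdiff n F i j G))"
abbreviation "mdiff i j G \<equiv> real (card (excl n F i j G)) - real (card (excl n F j i G))"
abbreviation "inS k i j G \<equiv> (of_bool (k \<in> sdiff n F i j G) :: real)"
abbreviation "bad i j G \<equiv> (of_bool (cS i j G < real n / (16 * L)) :: real)"
abbreviation "P e \<equiv> arc_prob Om {e}"

text \<open>Columns in which both rows have an arc cancel in the difference of the row sums. The
  discrepancy inside the columns free for both rows is therefore the difference of the degrees,
  corrected by the arcs opposite a forbidden cell, of which each row has at most
  \<open>L\<close>.\<close>

lemma mdiff_eq:
  assumes G: "G \<in> Om" and ij: "i < n" "j < n"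
  shows "mdiff i j G = real (s i) - real (s j) - real (card {l. (i,l) \<in> G \<and> (j,l) \<in> F})
    + real (card {l. (j,l) \<in> G \<and> (i,l) \<in> F})"
proof -
  have fG: "finite G" using G by (rule biadj_finite_graph)
  have *: "real (s a) = real (card (excl n F a b G)) + real (card {l. (a,l) \<in> G \<and> (b,l) \<in> F})
      + real (card {l. (a,l) \<in> G \<and> (b,l) \<in> G})" if "a < n" for a b
  proof -
    have f: "finite {l. (a,l) \<in> G \<and> Q l}" for Q by (rule finite_subset[OF _ finite_out[OF fG, of a]]) auto
    have "\<And>l. (a,l) \<in> G \<Longrightarrow> l < n \<and> (a,l) \<notin> F" 
      by (intro conjI, rule conjunct2[OF Om_bnd[OF G]], assumption, rule Om_disj[OF G])
    then have eq: "{l. (a,l) \<in> G} = (excl n F a b G \<union> {l. (a,l) \<in> G \<and> (b,l) \<in> F}) \<union> {l. (a,l) \<in> G \<and> (b,l) \<in> G}"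
      unfolding excl_def by blast
    have "s a = card {l. (a,l) \<in> G}" using Om_out[OF G that] ..
    also have "\<dots> = card ((excl n F a b G \<union> {l. (a,l) \<in> G \<and> (b,l) \<in> F}) \<union> {l. (a,l) \<in> G \<and> (b,l) \<in> G})"
      by (rule arg_cong[OF eq])
    also have "\<dots> = card (excl n F a b G) + card {l. (a,l) \<in> G \<and> (b,l) \<in> F} + card {l. (a,l) \<in> G \<and> (b,l) \<in> G}"
    proof -
      have "(excl n F a b G \<union> {l. (a,l) \<in> G \<and> (b,l) \<in> F}) \<inter> {l. (a,l) \<in> G \<and> (b,l) \<in> G} = {}"
        "excl n F a b G \<inter> {l. (a,l) \<in> G \<and> (b,l) \<in> F} = {}"
        using Om_disj[OF G] by (auto simp: excl_def)
      then show ?thesis by (simp add: card_Un_disjoint f)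
    qed
    finally show ?thesis by simp
  qed
  have "{l. (j,l) \<in> G \<and> (i,l) \<in> G} = {l. (i,l) \<in> G \<and> (j,l) \<in> G}" by auto
  then show ?thesis using *[OF ij(1), of j] *[OF ij(2), of i] by simp
qed

lemma card_forbidden_le:
  assumes "j < n" shows "real (card {l. Q l \<and> (j,l) \<in> F}) \<le> L"
proof -
  have "card {l. Q l \<and> (j,l) \<in> F} \<le> card {l. (j,l) \<in> F}" by (rule card_mono) (auto simp: finite_out finite_F)
  then show ?thesis using F_row[OF assms] by linarith
qed

lemma mdiff_bounds:
  assumes G: "G \<in> Om" and ij: "i < n" "j < n"
  shows "\<bar>mdiff i j G - (real (s i) - real (s j))\<bar> \<le> L" "\<bar>mdiff i j G\<bar> \<le> 3 * L * r" "\<bar>mdiff i j G\<bar> \<le> cS i j G"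
proof -
  show a: "\<bar>mdiff i j G - (real (s i) - real (s j))\<bar> \<le> L"
    unfolding mdiff_eq[OF assms]
    using card_forbidden_le[OF ij(1), of "\<lambda>l. (j,l) \<in> G"] card_forbidden_le[OF ij(2), of "\<lambda>l. (i,l) \<in> G"] by linarith
  have "L \<le> L * r" by (rule L_le_Lr)
  then show "\<bar>mdiff i j G\<bar> \<le> 3 * L * r" using a s_near[OF ij(1)] s_near[OF ij(2)] by linarith
  show "\<bar>mdiff i j G\<bar> \<le> cS i j G" by (simp add: card_sdiff)
qed

lemma cS_pos: "k \<in> sdiff n F i j G \<Longrightarrow> 1 \<le> cS i j G"
  by (metis One_nat_def Suc_leI card_gt_0_iff empty_iff finite_sdiff of_nat_1 of_nat_le_iff)

text \<open>For \<open>k\<close> in the difference the denominator is at least 1, so the rare event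
  of a small difference costs no more than its indicator.\<close>

lemma inv_cS: "k \<in> sdiff n F i j G \<Longrightarrow> 1 / cS i j G \<le> 16 * L / real n + bad i j G"
proof -
  assume k: "k \<in> sdiff n F i j G"
  have c: "1 \<le> cS i j G" by (rule cS_pos[OF k])
  have n0: "0 < real n" using n_pos by simp
  show ?thesis
  proof (cases "cS i j G < real n / (16 * L)")
    case True
    have "1 / cS i j G \<le> 1" using c by simp
    moreover have "0 \<le> 16 * L / real n" using L_pos by simp
    ultimately show ?thesis using True by simp
  next
    case False
    then have "1 / cS i j G \<le> 1 / (real n / (16 * L))" using n0 L_pos c by (intro divide_left_mono mult_pos_pos) auto
    then show ?thesis using False by simp
  qed
qed

lemma expect_bad: "i \<noteq> j \<Longrightarrow> i < n \<Longrightarrow> j < n \<Longrightarrow> expect_unif Om (bad i j) \<le> 1 / real n ^ 3"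
  by (rule sdiff_tail)

lemma inv_n3: "1 / real n ^ 3 \<le> 1 / r" "1 / real n ^ 3 \<le> 1 / real n ^ 2" "1 / real n ^ 2 \<le> 1 / real n"
proof -
  have n1: "1 \<le> real n" using n_pos by simp
  have "r \<le> real n" unfolding n_eq using r_ge_100 by simp
  also have "real n \<le> real n ^ 3" using power_increasing[of 1 3 "real n"] n1 by simp
  finally show "1 / real n ^ 3 \<le> 1 / r" using r_pos n_pos by (intro divide_left_mono) auto
  show "1 / real n ^ 3 \<le> 1 / real n ^ 2" "1 / real n ^ 2 \<le> 1 / real n"
    using power_increasing[of 2 3 "real n"] power_increasing[of 1 2 "real n"] n1
    by (auto intro!: divide_left_mono)
qed

text \<open>Off the bad event the ratio is at most 3*L*r times 16*L/n, whence 48; on it the ratio is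
  at most 1 because |p - q| \<le> |S|, and the tail bound pays for the remaining 1.\<close>

lemma row_diff_le:
  assumes ij: "i \<noteq> j" "i < n" "j < n" and k: "k < n" "(i,k) \<notin> F" "(j,k) \<notin> F"
  shows "\<bar>P (i,k) - P (j,k)\<bar> \<le> 49 * L\<^sup>2 / r"
proof -
  have "\<bar>P (i,k) - P (j,k)\<bar> \<le> expect_unif Om (\<lambda>G. \<bar>inS k i j G * mdiff i j G / cS i j G\<bar>)"
    unfolding arc_prob_row_diff[OF ij k] by (rule expect_unif_abs)
  also have "\<dots> \<le> expect_unif Om (\<lambda>G. 48 * L\<^sup>2 / r + bad i j G)"
  proof (rule expect_unif_mono)
    fix G assume G: "G \<in> Om"
    note m = mdiff_bounds[OF G ij(2,3)]
    have z: "0 \<le> 48 * L\<^sup>2 / r" using r_pos by simp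
    show "\<bar>inS k i j G * mdiff i j G / cS i j G\<bar> \<le> 48 * L\<^sup>2 / r + bad i j G"
    proof (cases "k \<in> sdiff n F i j G")
      case True
      have c: "1 \<le> cS i j G" by (rule cS_pos[OF True])
      have eq: "\<bar>inS k i j G * mdiff i j G / cS i j G\<bar> = \<bar>mdiff i j G\<bar> * (1 / cS i j G)" using True by (simp add: abs_divide)
      show ?thesis
      proof (cases "cS i j G < real n / (16 * L)")
        case True
        have "\<bar>mdiff i j G\<bar> * (1 / cS i j G) \<le> 1" using c m(3) by simp
        then show ?thesis unfolding eq using True z by (simp only: of_bool_eq True)
      next
        case False
        have "\<bar>mdiff i j G\<bar> * (1 / cS i j G) \<le> (3 * L * r) * (16 * L / real n)"
          using inv_cS[OF True] False m(2) L_pos by (intro mult_mono) auto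
        also have "\<dots> = 48 * L\<^sup>2 / r" using r_pos
          by (simp add: n_eq power2_eq_square field_simps)
        finally show ?thesis unfolding eq by simp
      qed
    next
      case False
      then show ?thesis using z by simp
    qed
  qed
  also have "\<dots> \<le> 48 * L\<^sup>2 / r + expect_unif Om (bad i j)"
    unfolding expect_unif_add by (intro add_right_mono expect_unif_le_const) (use r_pos in auto)
  also have "\<dots> \<le> 48 * L\<^sup>2 / r + 1 / r" using expect_bad[OF ij] inv_n3(1) by linarith
  also have "\<dots> \<le> 49 * L\<^sup>2 / r"
  proof -
    have "1 \<le> L\<^sup>2" using L_ge by simp
    then show ?thesis using r_pos by (simp flip: add_divide_distrib add: divide_right_mono)
  qed
  finally show ?thesis .
qed

lemma P_forbidden: "e \<in> F \<Longrightarrow> P e = 0"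
proof -
  assume "e \<in> F"
  then have "\<And>G. G \<in> Om \<Longrightarrow> of_bool (e \<in> G) = (0::real)" using Om_disj by (metis of_bool_eq(1))
  then show ?thesis unfolding arc_prob_single expect_unif_def by simp
qed

end

text \<open>Over an empty class all expectations are 0, so averages of constants and exact column
  sums call for this assumption. For conditioned instances it follows from positivity of the
  conditioning event, for the initial one from \<open>nonempty_loopless\<close>.\<close>

locale near_regular_ne = near_regular +
  assumes Om_ne: "Om \<noteq> {}"
begin

lemma col_sum: "k < n \<Longrightarrow> (\<Sum>j<n. P (j,k)) = real (t k)"
proof -
  assume k: "k < n"
  have "(\<Sum>j<n. P (j,k)) = expect_unif Om (\<lambda>G. \<Sum>j<n. of_bool ((j,k) \<in> G))"
    unfolding expect_unif_sum arc_prob_single ..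
  also have "\<dots> = expect_unif Om (\<lambda>G. real (t k))"
  proof (rule expect_unif_cong)
    fix G assume G: "G \<in> Om"
    have "{j. j < n \<and> (j,k) \<in> G} = {j. (j,k) \<in> G}" using Om_bnd[OF G] by auto
    then show "(\<Sum>j<n. of_bool ((j,k) \<in> G)) = real (t k)"
      using Om_in[OF G k] by (simp add: of_bool_def sum.If_cases Int_def)
  qed
  also have "\<dots> = real (t k)" using Om_ne by (simp add: expect_unif_const)
  finally show ?thesis .
qed

text \<open>Averages over the rows: column sums are known exactly.\<close>

lemma P_from_row_diffs:
  assumes ik: "i < n" "k < n" "(i,k) \<notin> F"
    and a: "\<And>j. j < n \<Longrightarrow> j \<noteq> i \<Longrightarrow> (j,k) \<notin> F \<Longrightarrow> \<bar>P (i,k) - P (j,k) - a j\<bar> \<le> \<epsilon>"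
    and ai: "a i = 0" and B: "\<And>j. j < n \<Longrightarrow> \<bar>a j\<bar> \<le> B" and \<epsilon>: "0 \<le> \<epsilon>"
  shows "\<bar>real n * P (i,k) - real (t k) - real (indeg F k) * P (i,k) - (\<Sum>j<n. a j)\<bar> \<le> real n * \<epsilon> + L * B"
proof -
  \<comment> \<open>A forbidden cell has probability 0, so its difference to row \<open>i\<close> is
    \<open>P (i,k)\<close> itself; the last term removes exactly this and leaves \<open>a j\<close>
    as the error of that row.\<close>
  let ?f = "\<lambda>j. P (i,k) - P (j,k) - a j - of_bool ((j,k) \<in> F) * P (i,k)"
  have dF: "(\<Sum>j<n. of_bool ((j,k) \<in> F)) = real (indeg F k)"
  proof -
    have "{j. j < n \<and> (j,k) \<in> F} = {j. (j,k) \<in> F}" using F_sub by auto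
    then show ?thesis by (simp add: indeg_def of_bool_def sum.If_cases Int_def)
  qed
  have "(\<Sum>j<n. ?f j) = real n * P (i,k) - (\<Sum>j<n. P (j,k)) - (\<Sum>j<n. a j) - (\<Sum>j<n. of_bool ((j,k) \<in> F)) * P (i,k)"
    unfolding sum_subtractf sum_distrib_right by simp
  then have eq: "(\<Sum>j<n. ?f j) = real n * P (i,k) - real (t k) - real (indeg F k) * P (i,k) - (\<Sum>j<n. a j)"
    unfolding dF col_sum[OF ik(2)] by simp
  have B0: "0 \<le> B" using B[OF ik(1)] by linarith
  have "\<bar>\<Sum>j<n. ?f j\<bar> \<le> (\<Sum>j<n. \<bar>?f j\<bar>)" by (rule sum_abs)
  also have "\<dots> \<le> (\<Sum>j<n. \<epsilon> + of_bool ((j,k) \<in> F) * B)"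
  proof (rule sum_mono)
    fix j assume "j \<in> {..<n}"
    then show "\<bar>?f j\<bar> \<le> \<epsilon> + of_bool ((j,k) \<in> F) * B"
      using a[of j] ai B[of j] \<epsilon> P_forbidden[of "(j,k)"] ik(3)
      by (cases "j = i"; cases "(j,k) \<in> F") auto
  qed
  also have "\<dots> = real n * \<epsilon> + real (indeg F k) * B"
    unfolding sum.distrib sum_distrib_right[symmetric] dF by simp
  also have "\<dots> \<le> real n * \<epsilon> + L * B" using F_in[OF ik(2)] B0 by (intro add_left_mono mult_right_mono) auto
  finally show ?thesis unfolding eq .
qed

lemma P_le1: "P e \<le> 1" by (rule arc_prob_le1)
lemma P_nonneg: "0 \<le> P e" by (rule arc_prob_nonneg)

text \<open>The choice \<open>a = 0\<close> is enough at this precision: the entries of a column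
  differ by O(L^2 / r), and their exact sum \<open>t k\<close> is \<open>lam * n\<close> up to
  \<open>L * r\<close>.\<close>

lemma P_approx0:
  assumes ik: "i < n" "k < n" "(i,k) \<notin> F"
  shows "\<bar>P (i,k) - lam\<bar> \<le> L ^ 3 / r"
proof -
  have "\<bar>real n * P (i,k) - real (t k) - real (indeg F k) * P (i,k) - (\<Sum>j<n. 0)\<bar> \<le> real n * (49 * L\<^sup>2 / r) + L * 0"
    using row_diff_le[OF _ ik(1) _ ik(2,3)] r_pos by (intro P_from_row_diffs ik) auto
  moreover have "real n * (49 * L\<^sup>2 / r) = 49 * L\<^sup>2 * r" using r_pos by (simp add: n_eq)
  moreover have "0 \<le> real (indeg F k) * P (i,k)" using P_nonneg by simp
  moreover have "real (indeg F k) * P (i,k) \<le> L * 1" using F_in[OF ik(2)] P_le1 P_nonneg L_pos by (intro mult_mono) auto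
  ultimately have "\<bar>real n * P (i,k) - lam * real n\<bar> \<le> 49 * L\<^sup>2 * r + L + L * r" using t_near[OF ik(2)] by simp
  moreover have "L * r \<le> L\<^sup>2 * r"
    using L_ge r_pos by (intro mult_right_mono) (auto simp: power2_eq_square)
  moreover note L_le_Lr
  ultimately have "\<bar>real n * P (i,k) - lam * real n\<bar> \<le> 51 * (L\<^sup>2 * r)" by linarith
  also have "\<dots> \<le> L * (L\<^sup>2 * r)" using L_ge r_pos by (intro mult_right_mono) auto
  finally have "\<bar>real n * (P (i,k) - lam)\<bar> \<le> L ^ 3 * r" by (simp add: algebra_simps power2_eq_square power3_eq_cube)
  then have "r * r * \<bar>P (i,k) - lam\<bar> \<le> r * L ^ 3" by (simp add: n_eq abs_mult mult.commute)
  then have "r * (r * \<bar>P (i,k) - lam\<bar>) \<le> r * L ^ 3" by (simp only: mult.assoc)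
  then have "r * \<bar>P (i,k) - lam\<bar> \<le> L ^ 3" using r_pos mult_le_cancel_left_pos by blast
  then show ?thesis using r_pos by (simp add: le_divide_eq mult.commute)
qed

end

section \<open>Conditioning on a sparse set of arcs\<close>

context near_regular
begin

lemma s_ge_L: "v < n \<Longrightarrow> L \<le> real (s v)" "v < n \<Longrightarrow> L \<le> real (t v)"
proof -
  have "2 * L * r \<le> lam * real n"
  proof -
    have "100 * L ^ 2 \<le> r" by (rule r_ge_const) simp
    then have "2 * L ^ 2 \<le> r" using zero_le_power2[of L] by linarith
    then have "r * (2 * L ^ 2) \<le> r * r" using r_pos by (intro mult_left_mono) auto
    then have "2 * L * r \<le> 1 / L * real n" using L_pos by (simp add: n_eq field_simps power2_eq_square)
    also have "\<dots> \<le> lam * real n" using lam_bounds by (intro mult_right_mono) auto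
    finally show ?thesis .
  qed
  moreover have "L \<le> L * r" by (rule L_le_Lr)
  ultimately have "L \<le> lam * real n - L * r" by linarith
  then show "v < n \<Longrightarrow> L \<le> real (s v)" "v < n \<Longrightarrow> L \<le> real (t v)" using s_near[of v] t_near[of v] by linarith+
qed

text \<open>The degrees of \<open>E\<close> are at most \<open>L\<close>, within the allowed
  deviation \<open>L * r\<close>, and the total drops by at most \<open>L * n\<close>, which is the
  slack in \<open>sum_near\<close>. So everything, including the number of forbidden cells per line,
  fits with \<open>L\<close> doubled and the same \<open>lam\<close>.\<close>

lemma conditioned:
  assumes L2: "(2 * L) ^ 20 \<le> real n" and E: "E \<subseteq> {..<n} \<times> {..<n} - F"
    and deg: "\<And>v. v < n \<Longrightarrow> real (outdeg E v) \<le> L \<and> real (indeg E v) \<le> L"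
  shows "near_regular n (2 * L) lam (\<lambda>v. s v - outdeg E v) (\<lambda>v. t v - indeg E v) (F \<union> E)"
    "\<And>v. v < n \<Longrightarrow> outdeg E v \<le> s v \<and> indeg E v \<le> t v"
proof -
  have fE: "finite E" by (rule finite_subset[OF E]) simp
  show le: "outdeg E v \<le> s v \<and> indeg E v \<le> t v" if "v < n" for v
    using deg[OF that] s_ge_L[OF that] by linarith
  have LL: "L \<le> L * r" by (rule L_le_Lr)
  have sumE: "(\<Sum>v<n. outdeg E v) = card E" "(\<Sum>v<n. indeg E v) = card E"
    using E by (auto intro!: sum_outdeg sum_indeg)
  have sum1: "(\<Sum>v<n. s v - outdeg E v) = (\<Sum>v<n. s v) - card E"
    using le by (subst sum_subtractf_nat) (auto simp: sumE)
  have sum2: "(\<Sum>v<n. t v - indeg E v) = (\<Sum>v<n. t v) - card E"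
    using le by (subst sum_subtractf_nat) (auto simp: sumE)
  have "real (\<Sum>v<n. outdeg E v) \<le> (\<Sum>v<n. L)" unfolding of_nat_sum by (rule sum_mono) (use deg in auto)
  then have cE: "real (card E) \<le> L * real n" unfolding sumE by (simp add: mult.commute)
  have cE2: "card E \<le> (\<Sum>v<n. s v)" unfolding sumE(1)[symmetric] by (rule sum_mono) (use le in auto)
  have dj: "E \<inter> F = {}" using E by auto
  show "near_regular n (2 * L) lam (\<lambda>v. s v - outdeg E v) (\<lambda>v. t v - indeg E v) (F \<union> E)"
  proof
    show "100 \<le> 2 * L" using L_ge by simp
    show "(2 * L) ^ 20 \<le> real n" by fact
    show "2 * real n ^ 3 \<le> 2 powr r" by (rule n_large)
    show "1 / (2 * L) \<le> lam * (1 - lam)" using lam_var L_pos by (simp add: field_simps)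
    show "\<bar>real (s v - outdeg E v) - lam * real n\<bar> \<le> 2 * L * r" if "v < n" for v
    proof -
      have "real (s v - outdeg E v) = real (s v) - real (outdeg E v)" using le[OF that] by (simp add: of_nat_diff)
      then show ?thesis using s_near[OF that] deg[OF that] LL by linarith
    qed
    show "\<bar>real (t v - indeg E v) - lam * real n\<bar> \<le> 2 * L * r" if "v < n" for v
    proof -
      have "real (t v - indeg E v) = real (t v) - real (indeg E v)" using le[OF that] by (simp add: of_nat_diff)
      then show ?thesis using t_near[OF that] deg[OF that] LL by linarith
    qed
    show "(\<Sum>v<n. s v - outdeg E v) = (\<Sum>v<n. t v - indeg E v)" unfolding sum1 sum2 sum_st ..
    show "\<bar>real (\<Sum>v<n. s v - outdeg E v) - lam * (real n)\<^sup>2\<bar> \<le> 2 * L * real n"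
      unfolding sum1 of_nat_diff[OF cE2] using cE sum_near by linarith
    show "F \<union> E \<subseteq> {..<n} \<times> {..<n}" using F_sub E by auto
    show "real (outdeg (F \<union> E) v) \<le> 2 * L" if "v < n" for v
      using outdeg_Un[OF dj finite_F fE] F_out[OF that] deg[OF that] by simp
    show "real (indeg (F \<union> E) v) \<le> 2 * L" if "v < n" for v
      using indeg_Un[OF dj finite_F fE] F_in[OF that] deg[OF that] by simp
  qed
qed

text \<open>A single-arc estimate in the conditioned instance becomes a joint one: multiplying by
  the probability of \<open>E\<close>, at most 1, cannot enlarge the error. \<open>approx\<close> is
  asked for non-empty instances only, since otherwise both joint probabilities vanish.\<close>

lemma arc_prob_insert_approx:
  assumes L2: "(2 * L) ^ 20 \<le> real n" and E: "E \<subseteq> {..<n} \<times> {..<n} - F"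
    and deg: "\<And>v. v < n \<Longrightarrow> real (outdeg E v) \<le> L \<and> real (indeg E v) \<le> L"
    and e: "e \<in> {..<n} \<times> {..<n} - F" "e \<notin> E" and \<kappa>: "0 \<le> \<kappa>"
    and approx: "near_regular_ne n (2 * L) lam (\<lambda>v. s v - outdeg E v) (\<lambda>v. t v - indeg E v) (F \<union> E) \<Longrightarrow>
      \<bar>arc_prob (biadj n (\<lambda>v. s v - outdeg E v) (\<lambda>v. t v - indeg E v) (F \<union> E)) {e} - q\<bar> \<le> \<kappa>"
  shows "\<bar>arc_prob Om (insert e E) - q * arc_prob Om E\<bar> \<le> \<kappa>"
proof -
  note c = conditioned[OF L2 E deg]
  let ?S = "biadj n (\<lambda>v. s v - outdeg E v) (\<lambda>v. t v - indeg E v) (F \<union> E)"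
  have ins: "arc_prob Om (insert e E) = arc_prob Om E * arc_prob ?S {e}" by (rule arc_prob_insert[OF E e(2) c(2)])
  show ?thesis
  proof (cases "?S = {}")
    case True
    then have "arc_prob Om E = 0" using arc_prob_eq_0[OF E c(2)] by blast
    then show ?thesis using ins \<kappa> by simp
  next
    case False
    then have "near_regular_ne n (2 * L) lam (\<lambda>v. s v - outdeg E v) (\<lambda>v. t v - indeg E v) (F \<union> E)"
      using c(1) by (simp add: near_regular_ne_def near_regular_ne_axioms_def)
    then have "\<bar>arc_prob ?S {e} - q\<bar> \<le> \<kappa>" by (rule approx)
    then have "arc_prob Om E * \<bar>arc_prob ?S {e} - q\<bar> \<le> 1 * \<kappa>"
      by (intro mult_mono arc_prob_le1) auto
    moreover have "arc_prob Om (insert e E) - q * arc_prob Om E = arc_prob Om E * (arc_prob ?S {e} - q)"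
      unfolding ins by (simp add: algebra_simps)
    ultimately show ?thesis by (simp add: abs_mult arc_prob_nonneg)
  qed
qed

lemma small_deg:
  assumes "finite E" "card E \<le> 3"
  shows "real (outdeg E v) \<le> L \<and> real (indeg E v) \<le> L" "outdeg E v \<le> 3" "indeg E v \<le> 3"
proof -
  have "outdeg E v \<le> card E" unfolding outdeg_def
    by (rule card_inj_on_le[where f = "\<lambda>w. (v,w)"]) (auto simp: inj_on_def assms)
  moreover have "indeg E v \<le> card E" unfolding indeg_def
    by (rule card_inj_on_le[where f = "\<lambda>w. (w,v)"]) (auto simp: inj_on_def assms)
  ultimately show "outdeg E v \<le> 3" "indeg E v \<le> 3" using assms by linarith+
  then show "real (outdeg E v) \<le> L \<and> real (indeg E v) \<le> L" using L_ge by linarith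
qed

text \<open>The constant 8 is \<open>2^3\<close>: the estimate with \<open>L^3\<close> is used at
  the doubled \<open>L\<close>.\<close>

lemma arc_prob_insert_approx0:
  assumes L2: "(2 * L) ^ 20 \<le> real n" and E: "E \<subseteq> {..<n} \<times> {..<n} - F" "card E \<le> 3"
    and e: "e \<in> {..<n} \<times> {..<n} - F" "e \<notin> E"
  shows "\<bar>arc_prob Om (insert e E) - lam * arc_prob Om E\<bar> \<le> 8 * L ^ 3 / r"
proof (rule arc_prob_insert_approx[OF L2 E(1) _ e])
  have fE: "finite E" by (rule finite_subset[OF E(1)]) simp
  show "real (outdeg E v) \<le> L \<and> real (indeg E v) \<le> L" for v by (rule small_deg[OF fE E(2)])
  show "0 \<le> 8 * L ^ 3 / r" using L_pos r_pos by simp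
  assume c: "near_regular_ne n (2 * L) lam (\<lambda>v. s v - outdeg E v) (\<lambda>v. t v - indeg E v) (F \<union> E)"
  obtain i k where ik: "e = (i,k)" by (cases e)
  then have "(i,k) \<notin> F \<union> E" "i < n" "k < n" using e by auto
  with near_regular_ne.P_approx0[OF c] show "\<bar>arc_prob (biadj n (\<lambda>v. s v - outdeg E v) (\<lambda>v. t v - indeg E v) (F \<union> E)) {e} - lam\<bar> \<le> 8 * L ^ 3 / r"
    unfolding ik by (fastforce simp: power_mult_distrib)
qed

end

section \<open>Moments of the symmetric difference\<close>

context near_regular_ne
begin

text \<open>Joint probabilities factor through \<open>q\<close> up to \<open>\<kappa>\<close>. Three
  arcs in \<open>E\<close> are allowed because the second moment of the size of \<open>sdiff\<close>
  involves two rows and two columns, that is four cells. The condition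
  \<open>1 / n \<le> \<kappa>\<close> lets the n diagonal terms of such a double sum be
  absorbed.\<close>

definition quasi :: "(nat \<times> nat \<Rightarrow> real) \<Rightarrow> real \<Rightarrow> bool" where
  "quasi q \<kappa> \<longleftrightarrow> 1 / real n \<le> \<kappa> \<and> (\<forall>e\<in>{..<n} \<times> {..<n} - F. 0 \<le> q e \<and> q e \<le> 1) \<and>
    (\<forall>E e. E \<subseteq> {..<n} \<times> {..<n} - F \<longrightarrow> card E \<le> 3 \<longrightarrow> e \<in> {..<n} \<times> {..<n} - F \<longrightarrow> e \<notin> E \<longrightarrow>
      \<bar>arc_prob Om (insert e E) - q e * arc_prob Om E\<bar> \<le> \<kappa>)"

definition free :: "nat \<Rightarrow> nat \<Rightarrow> nat set" where
  "free i j = {l. l < n \<and> (i,l) \<notin> F \<and> (j,l) \<notin> F}"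

lemma finite_free [simp]: "finite (free i j)" by (auto simp: free_def)

lemma card_free_le: "card (free i j) \<le> n"
  using card_mono[of "{..<n}" "free i j"] by (auto simp: free_def)

lemma card_free_ge:
  assumes "i < n" "j < n"
  shows "real n - 2 * L \<le> real (card (free i j))"
proof -
  have "{..<n} \<subseteq> free i j \<union> ({l. (i,l) \<in> F} \<union> {l. (j,l) \<in> F})" by (auto simp: free_def)
  then have "card {..<n} \<le> card (free i j \<union> ({l. (i,l) \<in> F} \<union> {l. (j,l) \<in> F}))"
    by (intro card_mono) (auto simp: finite_out finite_F)
  also have "\<dots> \<le> card (free i j) + (card {l. (i,l) \<in> F} + card {l. (j,l) \<in> F})"
    by (meson add_left_mono card_Un_le le_trans)
  finally show ?thesis using F_row[OF assms(1)] F_row[OF assms(2)] by simp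
qed

lemma cS_eq_sum: "cS i j G = (\<Sum>l\<in>free i j. inS l i j G)"
proof -
  have "sdiff n F i j G = {l \<in> free i j. l \<in> sdiff n F i j G}" by (auto simp: free_def sdiff_def)
  then have "card (sdiff n F i j G) = card {l \<in> free i j. l \<in> sdiff n F i j G}" by metis
  then show ?thesis by (simp add: of_bool_def sum.If_cases Int_def)
qed

text \<open>The probability that exactly one of two independent cells with probabilities
  \<open>q (i,l)\<close> and \<open>q (j,l)\<close> is occupied; \<open>Mv\<close> is the resulting
  prediction for the size of the difference of the rows.\<close>

definition Qv :: "(nat \<times> nat \<Rightarrow> real) \<Rightarrow> nat \<Rightarrow> nat \<Rightarrow> nat \<Rightarrow> real" where
  "Qv q i j l = q (i,l) + q (j,l) - 2 * q (i,l) * q (j,l)"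

definition Mv :: "(nat \<times> nat \<Rightarrow> real) \<Rightarrow> nat \<Rightarrow> nat \<Rightarrow> real" where
  "Mv q i j = (\<Sum>l\<in>free i j. Qv q i j l)"

context
  fixes q :: "nat \<times> nat \<Rightarrow> real" and \<kappa> :: real and i j :: nat
  assumes qu: "quasi q \<kappa>" and ij: "i \<noteq> j" "i < n" "j < n"
begin

abbreviation "Q \<equiv> Qv q i j"
abbreviation "M \<equiv> Mv q i j"

lemma dev_eq_sum: "cS i j G - M = (\<Sum>l\<in>free i j. inS l i j G - Q l)"
  by (simp only: cS_eq_sum Mv_def sum_subtractf)

lemma kappa_ge: "1 / real n \<le> \<kappa>" using qu by (simp add: quasi_def)

lemma kappa_pos: "0 < \<kappa>"
proof -
  have "0 < 1 / real n" using n_pos by simp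
  then show ?thesis using kappa_ge by linarith
qed

lemma kappa_n: "1 \<le> \<kappa> * real n" using kappa_ge n_pos by (simp add: field_simps)

lemma q_bounds: "a = i \<or> a = j \<Longrightarrow> l \<in> free i j \<Longrightarrow> 0 \<le> q (a,l) \<and> q (a,l) \<le> 1"
  using qu ij by (auto simp: quasi_def free_def)

lemma Q_bounds: "l \<in> free i j \<Longrightarrow> 0 \<le> Q l \<and> Q l \<le> 1"
proof -
  assume l: "l \<in> free i j"
  let ?a = "q (i,l)" and ?b = "q (j,l)"
  have b: "0 \<le> ?a" "?a \<le> 1" "0 \<le> ?b" "?b \<le> 1" using q_bounds[OF _ l] by auto
  have "Q l = ?a * (1 - ?b) + ?b * (1 - ?a)" by (simp add: Qv_def algebra_simps)
  moreover have "1 - Q l = ?a * ?b + (1 - ?a) * (1 - ?b)" by (simp add: Qv_def algebra_simps)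
  moreover have "0 \<le> ?a * (1 - ?b) + ?b * (1 - ?a)" "0 \<le> ?a * ?b + (1 - ?a) * (1 - ?b)"
    using b by (intro add_nonneg_nonneg mult_nonneg_nonneg; simp)+
  ultimately have "0 \<le> Q l" "0 \<le> 1 - Q l" by simp_all
  then show ?thesis by simp
qed

lemma inS_eq: "l \<in> free i j \<Longrightarrow> inS l i j G =
    of_bool ((i,l) \<in> G) + of_bool ((j,l) \<in> G) - 2 * of_bool ({(i,l),(j,l)} \<subseteq> G)"
  by (auto simp: sdiff_def free_def)

text \<open>Inclusion-exclusion over the two cells: one error \<open>\<kappa>\<close> for each
  single cell and two for the pair, which enters with coefficient 2; together 6.\<close>

lemma expect_E_inS:
  assumes E: "E \<subseteq> {..<n} \<times> {..<n} - F" "card E \<le> 2" and l: "l \<in> free i j" "(i,l) \<notin> E" "(j,l) \<notin> E"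
  shows "\<bar>expect_unif Om (\<lambda>G. of_bool (E \<subseteq> G) * inS l i j G) - Q l * arc_prob Om E\<bar> \<le> 6 * \<kappa>"
proof -
  have fE: "finite E" by (rule finite_subset[OF E(1)]) simp
  have il: "(i,l) \<in> {..<n} \<times> {..<n} - F" "(j,l) \<in> {..<n} \<times> {..<n} - F" using l ij by (auto simp: free_def)
  have step: "\<bar>arc_prob Om (insert e E') - q e * arc_prob Om E'\<bar> \<le> \<kappa>"
    if "E' \<subseteq> {..<n} \<times> {..<n} - F" "card E' \<le> 3" "e \<in> {..<n} \<times> {..<n} - F" "e \<notin> E'" for e E'
    using qu that unfolding quasi_def by blast
  have eq: "expect_unif Om (\<lambda>G. of_bool (E \<subseteq> G) * inS l i j G)
    = arc_prob Om (insert (i,l) E) + arc_prob Om (insert (j,l) E) - 2 * arc_prob Om (insert (j,l) (insert (i,l) E))"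
    unfolding arc_prob_def expect_unif_add[symmetric] expect_unif_cmult[symmetric] expect_unif_diff[symmetric]
    by (rule expect_unif_cong) (auto simp: inS_eq[OF l(1)])
  have 1: "\<bar>arc_prob Om (insert (i,l) E) - q (i,l) * arc_prob Om E\<bar> \<le> \<kappa>"
    using E l il by (intro step) auto
  have 2: "\<bar>arc_prob Om (insert (j,l) E) - q (j,l) * arc_prob Om E\<bar> \<le> \<kappa>"
    using E l il by (intro step) auto
  have 3: "\<bar>arc_prob Om (insert (j,l) (insert (i,l) E)) - q (j,l) * arc_prob Om (insert (i,l) E)\<bar> \<le> \<kappa>"
    using E l il ij(1) fE by (intro step) (auto simp: card_insert_if)
  have qb: "0 \<le> q (j,l)" "q (j,l) \<le> 1" using q_bounds[OF _ l(1)] by auto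
  have "\<bar>q (j,l) * (arc_prob Om (insert (i,l) E) - q (i,l) * arc_prob Om E)\<bar> \<le> 1 * \<kappa>"
    unfolding abs_mult using 1 qb by (intro mult_mono) auto
  then have 4: "\<bar>q (j,l) * arc_prob Om (insert (i,l) E) - q (i,l) * q (j,l) * arc_prob Om E\<bar> \<le> \<kappa>"
    by (simp add: algebra_simps)
  have "Q l * arc_prob Om E = q (i,l) * arc_prob Om E + q (j,l) * arc_prob Om E - 2 * (q (i,l) * q (j,l) * arc_prob Om E)"
    by (simp add: Qv_def algebra_simps)
  then show ?thesis unfolding eq using 1 2 3 4 by linarith
qed

lemma expect_inS: "l \<in> free i j \<Longrightarrow> \<bar>expect_unif Om (inS l i j) - Q l\<bar> \<le> 6 * \<kappa>"
  using expect_E_inS[of "{}" l] Om_ne by (simp add: arc_prob_empty)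

lemma expect_inS_arc:
  assumes l: "l \<in> free i j" and e: "e \<in> {..<n} \<times> {..<n} - F" "e \<noteq> (i,l)" "e \<noteq> (j,l)"
  shows "\<bar>expect_unif Om (\<lambda>G. of_bool (e \<in> G) * inS l i j G) - Q l * P e\<bar> \<le> 6 * \<kappa>"
  using expect_E_inS[of "{e}" l] assms by simp

lemma expect_inS_inS:
  assumes kl: "k \<in> free i j" "l \<in> free i j" "k \<noteq> l"
  shows "\<bar>expect_unif Om (\<lambda>G. inS k i j G * (inS l i j G - Q l))\<bar> \<le> 24 * \<kappa>"
proof -
  let ?f = "\<lambda>E. expect_unif Om (\<lambda>G. of_bool (E \<subseteq> G) * inS l i j G) - Q l * arc_prob Om E"
  have f: "?f E = expect_unif Om (\<lambda>G. of_bool (E \<subseteq> G) * (inS l i j G - Q l))" for E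
    unfolding arc_prob_def expect_unif_cmult[symmetric] expect_unif_diff[symmetric]
    by (rule expect_unif_cong) (simp add: algebra_simps)
  have "expect_unif Om (\<lambda>G. inS k i j G * (inS l i j G - Q l)) = ?f {(i,k)} + ?f {(j,k)} - 2 * ?f {(i,k),(j,k)}"
    unfolding f expect_unif_add[symmetric] expect_unif_cmult[symmetric] expect_unif_diff[symmetric]
    by (rule expect_unif_cong) (simp add: inS_eq[OF kl(1)] algebra_simps)
  moreover have "\<bar>?f {(i,k)}\<bar> \<le> 6 * \<kappa>" "\<bar>?f {(j,k)}\<bar> \<le> 6 * \<kappa>" "\<bar>?f {(i,k),(j,k)}\<bar> \<le> 6 * \<kappa>"
    using kl ij by (intro expect_E_inS; auto simp: free_def card_insert_if)+
  moreover have "\<bar>a + b - 2 * c\<bar> \<le> 24 * \<kappa>" if "\<bar>a\<bar> \<le> 6 * \<kappa>" "\<bar>b\<bar> \<le> 6 * \<kappa>" "\<bar>c\<bar> \<le> 6 * \<kappa>" for a b c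
    using that by linarith
  ultimately show ?thesis by simp
qed

text \<open>One column and the whole size have covariance of order \<open>\<kappa> * n\<close>,
  where Cauchy-Schwarz would give only sqrt kappa times n. The term l = k is at most 1, hence at
  most \<open>\<kappa> * n\<close>.\<close>

lemma expect_inS_dev:
  assumes k: "k \<in> free i j"
  shows "\<bar>expect_unif Om (\<lambda>G. inS k i j G * (cS i j G - M))\<bar> \<le> 25 * \<kappa> * real n"
proof -
  have "expect_unif Om (\<lambda>G. inS k i j G * (cS i j G - M)) = (\<Sum>l\<in>free i j. expect_unif Om (\<lambda>G. inS k i j G * (inS l i j G - Q l)))"
  proof -
    have "expect_unif Om (\<lambda>G. inS k i j G * (cS i j G - M)) = expect_unif Om (\<lambda>G. \<Sum>l\<in>free i j. inS k i j G * (inS l i j G - Q l))"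
      by (rule expect_unif_cong) (simp only: dev_eq_sum sum_distrib_left)
    then show ?thesis by (simp only: expect_unif_sum)
  qed
  then have "\<bar>expect_unif Om (\<lambda>G. inS k i j G * (cS i j G - M))\<bar> \<le> (\<Sum>l\<in>free i j. \<bar>expect_unif Om (\<lambda>G. inS k i j G * (inS l i j G - Q l))\<bar>)" by (simp only: sum_abs)
  also have "\<dots> \<le> (\<Sum>l\<in>free i j. 24 * \<kappa> + of_bool (l = k))"
  proof (rule sum_mono)
    fix l assume l: "l \<in> free i j"
    show "\<bar>expect_unif Om (\<lambda>G. inS k i j G * (inS l i j G - Q l))\<bar> \<le> 24 * \<kappa> + of_bool (l = k)"
    proof (cases "l = k")
      case True
      have "\<bar>expect_unif Om (\<lambda>G. inS k i j G * (inS l i j G - Q l))\<bar> \<le> expect_unif Om (\<lambda>G. \<bar>inS k i j G * (inS l i j G - Q l)\<bar>)"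
        by (rule expect_unif_abs)
      also have "\<dots> \<le> 1" using Q_bounds[OF l] by (intro expect_unif_le_const) auto
      finally show ?thesis using True kappa_pos by simp
    next
      case False
      then show ?thesis using expect_inS_inS[OF k l] by auto
    qed
  qed
  also have "\<dots> = 24 * \<kappa> * real (card (free i j)) + 1"
    unfolding sum.distrib using k by (simp add: of_bool_def mult.commute)
  also have "\<dots> \<le> 24 * \<kappa> * real n + \<kappa> * real n"
    using kappa_n kappa_pos card_free_le[of i j] by (intro add_mono mult_left_mono) auto
  finally show ?thesis by simp
qed

lemma expect_var:
  "expect_unif Om (\<lambda>G. (cS i j G - M)\<^sup>2) \<le> 31 * \<kappa> * real n ^ 2"
proof -
  let ?c = "\<lambda>k l. expect_unif Om (\<lambda>G. (inS k i j G - Q k) * (inS l i j G - Q l))"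
  have "expect_unif Om (\<lambda>G. (cS i j G - M)\<^sup>2) = (\<Sum>k\<in>free i j. \<Sum>l\<in>free i j. ?c k l)"
  proof -
    have "expect_unif Om (\<lambda>G. (cS i j G - M)\<^sup>2)
      = expect_unif Om (\<lambda>G. \<Sum>k\<in>free i j. \<Sum>l\<in>free i j. (inS k i j G - Q k) * (inS l i j G - Q l))"
      by (rule expect_unif_cong) (simp only: dev_eq_sum power2_eq_square sum_product)
    then show ?thesis by (simp only: expect_unif_sum)
  qed
  also have "\<dots> \<le> (\<Sum>k\<in>free i j. \<Sum>l\<in>free i j. 30 * \<kappa> + of_bool (l = k))"
  proof (intro sum_mono)
    fix k l assume k: "k \<in> free i j" and l: "l \<in> free i j"
    show "?c k l \<le> 30 * \<kappa> + of_bool (l = k)"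
    proof (cases "l = k")
      case True
      have "?c k l \<le> 1"
      proof (rule expect_unif_le_const)
        fix G
        have "\<bar>inS k i j G - Q k\<bar> \<le> 1" "\<bar>inS l i j G - Q l\<bar> \<le> 1" using Q_bounds[OF k] Q_bounds[OF l] by auto
        then have "\<bar>inS k i j G - Q k\<bar> * \<bar>inS l i j G - Q l\<bar> \<le> 1 * 1" by (intro mult_mono) auto
        then show "(inS k i j G - Q k) * (inS l i j G - Q l) \<le> 1" by (metis abs_le_D1 abs_mult mult_1)
      qed auto
      then show ?thesis using True kappa_pos by simp
    next
      case False
      have "?c k l = expect_unif Om (\<lambda>G. inS k i j G * (inS l i j G - Q l)) - Q k * expect_unif Om (\<lambda>G. inS l i j G - Q l)"
        unfolding expect_unif_cmult[symmetric] expect_unif_diff[symmetric] by (rule expect_unif_cong) (simp add: algebra_simps)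
      moreover have "expect_unif Om (\<lambda>G. inS l i j G - Q l) = expect_unif Om (inS l i j) - Q l"
        unfolding expect_unif_diff using Om_ne by (simp add: expect_unif_const)
      moreover have "\<bar>Q k * (expect_unif Om (inS l i j) - Q l)\<bar> \<le> 1 * (6 * \<kappa>)"
        unfolding abs_mult using Q_bounds[OF k] expect_inS[OF l] by (intro mult_mono) auto
      ultimately show ?thesis using expect_inS_inS[OF k l] False by auto
    qed
  qed
  also have "\<dots> = (\<Sum>k\<in>free i j. 30 * \<kappa> * real (card (free i j)) + 1)"
    by (intro sum.cong) (auto simp: sum.distrib of_bool_def mult.commute)
  also have "\<dots> = 30 * \<kappa> * (real (card (free i j)) * real (card (free i j))) + real (card (free i j))"
    by (simp add: algebra_simps)
  also have "\<dots> \<le> 30 * \<kappa> * (real n * real n) + real n * (\<kappa> * real n)"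
  proof (intro add_mono mult_left_mono mult_mono)
    have "real n * 1 \<le> real n * (\<kappa> * real n)" using kappa_n by (intro mult_left_mono) auto
    then show "real (card (free i j)) \<le> real n * (\<kappa> * real n)" using card_free_le[of i j] by simp
  qed (use card_free_le[of i j] kappa_pos in auto)
  finally show ?thesis by (simp add: power2_eq_square algebra_simps)
qed

lemma M_bounds: "0 \<le> M" "M \<le> real n"
proof -
  show "0 \<le> M" unfolding Mv_def using Q_bounds by (intro sum_nonneg) auto
  have "M \<le> (\<Sum>l\<in>free i j. 1)" unfolding Mv_def using Q_bounds by (intro sum_mono) auto
  then show "M \<le> real n" using card_free_le[of i j] by simp
qed

lemma cS_le_n: "cS i j G \<le> real n"
  using card_mono[of "{..<n}" "sdiff n F i j G"] by (auto simp: sdiff_def)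

lemma dev_le_n: "\<bar>cS i j G - M\<bar> \<le> real n"
  using M_bounds cS_le_n[of G] by auto

text \<open>The reciprocal is expanded about \<open>M\<close> by the exact identity 1/c = 1/M - (c -
  M)/M^2 + (c - M)^2/(M^2*c). The linear term is controlled by \<open>expect_inS_dev\<close>, the
  last one by the variance with 1/c bounded through the tail estimate. This makes the error relative
  to 1/n of order \<open>\<kappa>\<close>, not of order sqrt kappa.\<close>

lemma expect_inS_inv:
  assumes k: "k \<in> free i j" and M: "real n / (2 * L) \<le> M"
  shows "\<bar>expect_unif Om (\<lambda>G. inS k i j G / cS i j G) - Q k / M\<bar> \<le> L ^ 5 * \<kappa> / real n"
proof -
  let ?N = "real n"
  have N0: "0 < ?N" using n_pos by simp
  have M0: "0 < M" using M N0 L_pos by (smt (verit) divide_pos_pos)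
  have iM: "1 / M \<le> 2 * L / ?N"
  proof -
    have "1 / M \<le> 1 / (?N / (2 * L))" using M M0 N0 L_pos by (intro divide_left_mono mult_pos_pos) auto
    then show ?thesis by simp
  qed
  have iM2: "1 / M\<^sup>2 \<le> 4 * L\<^sup>2 / ?N\<^sup>2"
    using power_mono[OF iM, of 2] M0 by (simp add: power_divide power_mult_distrib)
  have ex: "inS k i j G / cS i j G = (1 / M) * inS k i j G - (1 / M\<^sup>2) * (inS k i j G * (cS i j G - M))
      + (1 / M\<^sup>2) * (inS k i j G * (cS i j G - M)\<^sup>2 / cS i j G)" for G
  proof (cases "k \<in> sdiff n F i j G")
    case True
    have "1 / c = 1 / M - 1 / M\<^sup>2 * (c - M) + 1 / M\<^sup>2 * ((c - M)\<^sup>2 / c)" if "c > 0" for c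
      using that M0 by (simp add: field_simps power2_eq_square)
    then show ?thesis using True cS_pos[OF True] by auto
  next
    case False
    then show ?thesis by simp
  qed
  have third: "expect_unif Om (\<lambda>G. inS k i j G * (cS i j G - M)\<^sup>2 / cS i j G) \<le> 497 * L * \<kappa> * ?N"
  proof -
    have "expect_unif Om (\<lambda>G. inS k i j G * (cS i j G - M)\<^sup>2 / cS i j G)
      \<le> expect_unif Om (\<lambda>G. 16 * L / ?N * (cS i j G - M)\<^sup>2 + ?N\<^sup>2 * bad i j G)"
    proof (rule expect_unif_mono)
      fix G
      show "inS k i j G * (cS i j G - M)\<^sup>2 / cS i j G \<le> 16 * L / ?N * (cS i j G - M)\<^sup>2 + ?N\<^sup>2 * bad i j G"
      proof (cases "k \<in> sdiff n F i j G")
        case True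
        have "(cS i j G - M)\<^sup>2 * (1 / cS i j G) \<le> (cS i j G - M)\<^sup>2 * (16 * L / ?N + bad i j G)"
          using inv_cS[OF True] by (intro mult_left_mono) auto
        moreover have "(cS i j G - M)\<^sup>2 * bad i j G \<le> ?N\<^sup>2 * bad i j G"
          using power_mono[OF dev_le_n[of G], of 2] by (intro mult_right_mono) auto
        ultimately show ?thesis using True by (simp add: algebra_simps)
      next
        case False
        then show ?thesis using L_pos by simp
      qed
    qed
    also have "\<dots> = 16 * L / ?N * expect_unif Om (\<lambda>G. (cS i j G - M)\<^sup>2) + ?N\<^sup>2 * expect_unif Om (bad i j)"
      by (simp only: expect_unif_add expect_unif_cmult)
    also have "\<dots> \<le> 16 * L / ?N * (31 * \<kappa> * ?N\<^sup>2) + ?N\<^sup>2 * (1 / ?N ^ 3)"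
      using expect_var expect_bad[OF ij] L_pos by (intro add_mono mult_left_mono) auto
    also have "\<dots> = 496 * L * \<kappa> * ?N + 1 / ?N" using N0 by (simp add: power2_eq_square power3_eq_cube)
    also have "\<dots> \<le> 497 * L * \<kappa> * ?N"
    proof -
      have "1 / ?N \<le> \<kappa>" by (rule kappa_ge)
      also have "\<kappa> * 1 \<le> \<kappa> * (L * ?N)" using kappa_pos L_ge n_pos
        by (intro mult_left_mono) (auto intro: order_trans[OF _ mult_mono[of 1 L 1 ?N]])
      finally show ?thesis by (simp add: algebra_simps)
    qed
    finally show ?thesis .
  qed
  have third0: "0 \<le> expect_unif Om (\<lambda>G. inS k i j G * (cS i j G - M)\<^sup>2 / cS i j G)"
    by (rule expect_unif_nonneg) auto
  have eq: "expect_unif Om (\<lambda>G. inS k i j G / cS i j G) - Q k / M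
     = (1 / M) * (expect_unif Om (inS k i j) - Q k) - (1 / M\<^sup>2) * expect_unif Om (\<lambda>G. inS k i j G * (cS i j G - M))
      + (1 / M\<^sup>2) * expect_unif Om (\<lambda>G. inS k i j G * (cS i j G - M)\<^sup>2 / cS i j G)"
    unfolding ex expect_unif_add expect_unif_diff expect_unif_cmult by (simp add: algebra_simps)
  have b1: "\<bar>(1 / M) * (expect_unif Om (inS k i j) - Q k)\<bar> \<le> 2 * L / ?N * (6 * \<kappa>)"
    unfolding abs_mult using expect_inS[OF k] iM M0 L_pos by (intro mult_mono) auto
  have b2: "\<bar>(1 / M\<^sup>2) * expect_unif Om (\<lambda>G. inS k i j G * (cS i j G - M))\<bar> \<le> 4 * L\<^sup>2 / ?N\<^sup>2 * (25 * \<kappa> * ?N)"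
    unfolding abs_mult using expect_inS_dev[OF k] iM2 by (intro mult_mono) auto
  have b3: "\<bar>(1 / M\<^sup>2) * expect_unif Om (\<lambda>G. inS k i j G * (cS i j G - M)\<^sup>2 / cS i j G)\<bar> \<le> 4 * L\<^sup>2 / ?N\<^sup>2 * (497 * L * \<kappa> * ?N)"
    unfolding abs_mult using third third0 iM2 by (intro mult_mono) auto
  have "\<bar>expect_unif Om (\<lambda>G. inS k i j G / cS i j G) - Q k / M\<bar>
     \<le> 2 * L / ?N * (6 * \<kappa>) + 4 * L\<^sup>2 / ?N\<^sup>2 * (25 * \<kappa> * ?N) + 4 * L\<^sup>2 / ?N\<^sup>2 * (497 * L * \<kappa> * ?N)"
    unfolding eq using b1 b2 b3 by linarith
  also have "\<dots> = (12 * L + 100 * L\<^sup>2 + 1988 * L ^ 3) * (\<kappa> / ?N)"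
    using N0 by (simp add: field_simps power2_eq_square power3_eq_cube)
  also have "\<dots> \<le> L ^ 5 * (\<kappa> / ?N)"
  proof (rule mult_right_mono)
    have "L \<le> L ^ 3" "L\<^sup>2 \<le> L ^ 3" using power_increasing[of 1 3 L] power_increasing[of 2 3 L] L_ge by auto
    moreover have "0 \<le> L ^ 3" using L_pos by simp
    ultimately have "12 * L + 100 * L\<^sup>2 + 1988 * L ^ 3 \<le> 100 * 100 * L ^ 3" by linarith
    also have "\<dots> \<le> L * L * L ^ 3" using L_ge by (intro mult_right_mono mult_mono) auto
    finally show "12 * L + 100 * L\<^sup>2 + 1988 * L ^ 3 \<le> L ^ 5" by (simp add: numeral_eq_Suc algebra_simps)
    show "0 \<le> \<kappa> / ?N" using kappa_pos by simp
  qed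
  finally show ?thesis by simp
qed

text \<open>Serves the arcs opposite forbidden cells. A first-order bound will do for them: they are
  at most \<open>L\<close> in number per row and are not multiplied by a difference of row
  sums.\<close>

lemma expect_inS_inv_weighted:
  assumes k: "k \<in> free i j" and M: "real n / (2 * L) \<le> M" and Z: "\<And>G. 0 \<le> Z G \<and> Z G \<le> (1::real)"
  shows "\<bar>expect_unif Om (\<lambda>G. inS k i j G * Z G / cS i j G) - expect_unif Om (\<lambda>G. inS k i j G * Z G) / M\<bar>
    \<le> L ^ 4 * \<kappa> * r / real n"
proof -
  let ?N = "real n"
  have N0: "0 < ?N" using n_pos by simp
  have M0: "0 < M" using M N0 L_pos by (smt (verit) divide_pos_pos)
  have iM: "1 / M \<le> 2 * L / ?N"
  proof -
    have "1 / M \<le> 1 / (?N / (2 * L))" using M M0 N0 L_pos by (intro divide_left_mono mult_pos_pos) auto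
    then show ?thesis by simp
  qed
  have "\<bar>expect_unif Om (\<lambda>G. inS k i j G * Z G / cS i j G) - expect_unif Om (\<lambda>G. inS k i j G * Z G) / M\<bar>
    = \<bar>expect_unif Om (\<lambda>G. inS k i j G * Z G / cS i j G - 1 / M * (inS k i j G * Z G))\<bar>"
    unfolding expect_unif_diff expect_unif_cmult by simp
  also have "\<dots> \<le> expect_unif Om (\<lambda>G. \<bar>inS k i j G * Z G / cS i j G - 1 / M * (inS k i j G * Z G)\<bar>)"
    by (rule expect_unif_abs)
  also have "\<dots> \<le> expect_unif Om (\<lambda>G. 1 / M * (16 * L / ?N * (r + 1 / r * (cS i j G - M)\<^sup>2) + ?N * bad i j G))"
  proof (rule expect_unif_mono)
    fix G
    show "\<bar>inS k i j G * Z G / cS i j G - 1 / M * (inS k i j G * Z G)\<bar>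
      \<le> 1 / M * (16 * L / ?N * (r + 1 / r * (cS i j G - M)\<^sup>2) + ?N * bad i j G)"
    proof (cases "k \<in> sdiff n F i j G")
      case True
      let ?c = "cS i j G"
      have c: "1 \<le> ?c" by (rule cS_pos[OF True])
      have "inS k i j G * Z G / ?c - 1 / M * (inS k i j G * Z G) = 1 / M * (Z G * ((M - ?c) * (1 / ?c)))"
      proof -
        have "z / c - 1 / M * z = 1 / M * (z * ((M - c) * (1 / c)))" if "c > 0" for z c
          using that M0 by (simp add: field_simps)
        from this[of ?c "Z G"] show ?thesis using True c by simp
      qed
      also have "\<bar>\<dots>\<bar> = 1 / M * (Z G * (\<bar>?c - M\<bar> * (1 / ?c)))" using M0 Z[of G] c by (simp add: abs_mult abs_minus_commute)
      also have "\<dots> \<le> 1 / M * (1 * (16 * L / ?N * (r + 1 / r * (?c - M)\<^sup>2) + ?N * bad i j G))"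
      proof (intro mult_left_mono mult_mono)
        have "\<bar>?c - M\<bar> * (1 / ?c) \<le> \<bar>?c - M\<bar> * (16 * L / ?N + bad i j G)"
          using inv_cS[OF True] by (intro mult_left_mono) auto
        moreover have "\<bar>?c - M\<bar> * bad i j G \<le> ?N * bad i j G"
          using dev_le_n[of G] by (intro mult_right_mono) auto
        moreover have "\<bar>?c - M\<bar> * (16 * L / ?N) \<le> (r + 1 / r * (?c - M)\<^sup>2) * (16 * L / ?N)"
        proof (rule mult_right_mono)
          \<comment> \<open>AM-GM with weight \<open>r\<close>, which up to powers of
            \<open>L\<close> is the standard deviation of the size when \<open>\<kappa>\<close> is
            about 1/n.\<close>
          have "0 \<le> (r - \<bar>?c - M\<bar>)\<^sup>2" by simp
          then have "2 * (r * \<bar>?c - M\<bar>) \<le> r * r + (?c - M)\<^sup>2" by (simp add: power2_diff power2_eq_square algebra_simps)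
          moreover have "0 \<le> r * r" "0 \<le> (?c - M)\<^sup>2" by simp_all
          ultimately have "r * \<bar>?c - M\<bar> \<le> r * r + (?c - M)\<^sup>2" by linarith
          then show "\<bar>?c - M\<bar> \<le> r + 1 / r * (?c - M)\<^sup>2" using r_pos by (simp add: field_simps)
        qed (use L_pos in auto)
        ultimately show "\<bar>?c - M\<bar> * (1 / ?c) \<le> 16 * L / ?N * (r + 1 / r * (?c - M)\<^sup>2) + ?N * bad i j G"
          by (simp add: algebra_simps)
      qed (use M0 Z[of G] c in auto)
      finally show ?thesis by simp
    next
      case False
      then show ?thesis using M0 L_pos r_pos by simp
    qed
  qed
  also have "\<dots> = 1 / M * (16 * L / ?N * (r + 1 / r * expect_unif Om (\<lambda>G. (cS i j G - M)\<^sup>2)) + ?N * expect_unif Om (bad i j))"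
    using Om_ne by (simp only: expect_unif_add expect_unif_cmult expect_unif_const finite_biadj not_False_eq_True)
  also have "\<dots> \<le> 2 * L / ?N * (16 * L / ?N * (r + 1 / r * (31 * \<kappa> * ?N\<^sup>2)) + ?N * (1 / ?N ^ 3))"
    using expect_var expect_bad[OF ij] iM M0 L_pos r_pos
    by (intro mult_mono add_mono mult_left_mono order_refl add_nonneg_nonneg mult_nonneg_nonneg expect_unif_nonneg) auto
  also have "\<dots> \<le> 2 * L / ?N * (16 * L / ?N * (32 * \<kappa> * ?N * r) + \<kappa> * r)"
  proof (intro mult_left_mono add_mono)
    have "r * 1 \<le> r * (\<kappa> * ?N)" using kappa_n r_pos by (intro mult_left_mono) auto
    then show "r + 1 / r * (31 * \<kappa> * ?N\<^sup>2) \<le> 32 * \<kappa> * ?N * r"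
      using r_pos by (simp add: n_eq power2_eq_square algebra_simps)
    have "?N * (1 / ?N ^ 3) = 1 / ?N ^ 2" using N0 by (simp add: power2_eq_square power3_eq_cube)
    also have "\<dots> \<le> \<kappa>" using inv_n3(3) kappa_ge by linarith
    also have "\<kappa> * 1 \<le> \<kappa> * r" using kappa_pos r_ge_100 by (intro mult_left_mono) auto
    finally show "?N * (1 / ?N ^ 3) \<le> \<kappa> * r" by simp
  qed (use L_pos in auto)
  also have "\<dots> = (1024 * L\<^sup>2 + 2 * L) * (\<kappa> * r / ?N)" using N0 by (simp add: field_simps power2_eq_square)
  also have "\<dots> \<le> L ^ 4 * (\<kappa> * r / ?N)"
  proof (rule mult_right_mono)
    have "L \<le> L\<^sup>2" using power_increasing[of 1 2 L] L_ge by simp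
    moreover have "0 \<le> L\<^sup>2" by simp
    ultimately have "1024 * L\<^sup>2 + 2 * L \<le> 100 * 100 * L\<^sup>2" by linarith
    also have "\<dots> \<le> L * L * L\<^sup>2" using L_ge by (intro mult_right_mono mult_mono) auto
    finally show "1024 * L\<^sup>2 + 2 * L \<le> L ^ 4" by (simp add: numeral_eq_Suc algebra_simps)
  qed (use kappa_pos r_pos in simp)
  finally show ?thesis by simp
qed

end

end

section \<open>Arc probabilities, second approximation\<close>

context near_regular_ne
begin

abbreviation "T \<equiv> real (\<Sum>v<n. s v)"

lemma quasi0:
  assumes L2: "(2 * L) ^ 20 \<le> real n"
  shows "quasi (\<lambda>e. lam) (8 * L ^ 3 / r)"
  unfolding quasi_def
proof (intro conjI allI impI ballI)
  have "1 / real n \<le> 1 / r"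
  proof (rule divide_left_mono)
    show "r \<le> real n" unfolding n_eq using r_ge_100 by simp
  qed (use r_pos n_pos in auto)
  also have "\<dots> \<le> 8 * L ^ 3 / r"
  proof (rule divide_right_mono)
    have "1 \<le> L ^ 3" using L_ge by (simp add: one_le_power)
    then show "1 \<le> 8 * L ^ 3" by linarith
  qed (use r_pos in simp)
  finally show "1 / real n \<le> 8 * L ^ 3 / r" .
qed (use lam_bounds arc_prob_insert_approx0[OF L2] in auto)

text \<open>The known part of the discrepancy, the difference of the row sums, is separated from the
  arcs opposite a forbidden cell. Columns forbidden in both rows carry no arc and drop out.\<close>

lemma row_diff_split:
  assumes ij: "i \<noteq> j" "i < n" "j < n" and k: "k < n" "(i,k) \<notin> F" "(j,k) \<notin> F"
  shows "P (i,k) - P (j,k) = (real (s i) - real (s j)) * expect_unif Om (\<lambda>G. inS k i j G / cS i j G)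
    - (\<Sum>l\<in>{l. (j,l) \<in> F \<and> (i,l) \<notin> F}. expect_unif Om (\<lambda>G. inS k i j G * of_bool ((i,l) \<in> G) / cS i j G))
    + (\<Sum>l\<in>{l. (i,l) \<in> F \<and> (j,l) \<notin> F}. expect_unif Om (\<lambda>G. inS k i j G * of_bool ((j,l) \<in> G) / cS i j G))"
proof -
  have c: "real (card {l. (a,l) \<in> G \<and> (b,l) \<in> F}) = (\<Sum>l\<in>{l. (b,l) \<in> F \<and> (a,l) \<notin> F}. of_bool ((a,l) \<in> G))"
    if "G \<in> Om" for a b G
  proof -
    have f: "finite {l. (b,l) \<in> F \<and> (a,l) \<notin> F}"
      by (rule finite_subset[OF _ finite_out[OF finite_F, of b]]) auto
    have "{l. (a,l) \<in> G \<and> (b,l) \<in> F} = {l \<in> {l. (b,l) \<in> F \<and> (a,l) \<notin> F}. (a,l) \<in> G}"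
      using Om_disj[OF that] by auto
    then show ?thesis using f by (simp add: of_bool_def sum.If_cases Int_def)
  qed
  have "P (i,k) - P (j,k) = expect_unif Om (\<lambda>G. (real (s i) - real (s j)) * (inS k i j G / cS i j G)
      - (\<Sum>l\<in>{l. (j,l) \<in> F \<and> (i,l) \<notin> F}. inS k i j G * of_bool ((i,l) \<in> G) / cS i j G)
      + (\<Sum>l\<in>{l. (i,l) \<in> F \<and> (j,l) \<notin> F}. inS k i j G * of_bool ((j,l) \<in> G) / cS i j G))"
    unfolding arc_prob_row_diff[OF ij k]
  proof (rule expect_unif_cong)
    fix G assume G: "G \<in> Om"
    have *: "x * (a - b - sum f A + sum g B) / d = (a - b) * (x / d) - (\<Sum>l\<in>A. x * f l / d) + (\<Sum>l\<in>B. x * g l / d)"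
      for x a b d :: real and f g :: "nat \<Rightarrow> real" and A B
      by (simp add: sum_distrib_left[symmetric] sum_divide_distrib[symmetric] algebra_simps add_divide_distrib diff_divide_distrib)
    show "inS k i j G * mdiff i j G / cS i j G = (real (s i) - real (s j)) * (inS k i j G / cS i j G)
      - (\<Sum>l\<in>{l. (j,l) \<in> F \<and> (i,l) \<notin> F}. inS k i j G * of_bool ((i,l) \<in> G) / cS i j G)
      + (\<Sum>l\<in>{l. (i,l) \<in> F \<and> (j,l) \<notin> F}. inS k i j G * of_bool ((j,l) \<in> G) / cS i j G)"
      unfolding mdiff_eq[OF G ij(2,3)] c[OF G] by (rule *)
  qed
  then show ?thesis by (simp only: expect_unif_add expect_unif_diff expect_unif_cmult expect_unif_sum)
qed

lemma card_forbidden_row: "b < n \<Longrightarrow> real (card {l. (b,l) \<in> F \<and> Z l}) \<le> L"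
  using card_forbidden_le[of b Z] by (simp add: conj_commute)

lemma s_diff: "i < n \<Longrightarrow> j < n \<Longrightarrow> \<bar>real (s i) - real (s j)\<bar> \<le> 2 * L * r"
  using s_near[of i] s_near[of j] by linarith

text \<open>For constant \<open>q\<close> the ratio \<open>Qv / Mv\<close> is the reciprocal of the
  number of free columns, since \<open>lam\<close> cancels; this number is \<open>n\<close> up to
  \<open>2 * L\<close>.\<close>

lemma expect_inS_inv0:
  assumes L2: "(2 * L) ^ 20 \<le> real n" and ij: "i \<noteq> j" "i < n" "j < n" and k: "k \<in> free i j"
  shows "\<bar>expect_unif Om (\<lambda>G. inS k i j G / cS i j G) - 1 / real n\<bar> \<le> 9 * L ^ 8 / (real n * r)"
proof -
  let ?q = "\<lambda>e::nat\<times>nat. lam"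
  let ?c = "real (card (free i j))"
  have Lr: "100 * L \<le> r" using r_ge_const[of 1] by simp
  have rn: "r \<le> real n" unfolding n_eq using r_ge_100 by simp
  have c: "real n - 2 * L \<le> ?c" "?c \<le> real n" "real n / 2 \<le> ?c" "0 < ?c"
    using card_free_ge[OF ij(2,3)] card_free_le[of i j] Lr rn L_pos by auto
  have Q: "Qv ?q i j l = 2 * (lam * (1 - lam))" for l by (simp add: Qv_def algebra_simps)
  have M: "Mv ?q i j = ?c * (2 * (lam * (1 - lam)))" unfolding Mv_def Q by simp
  have V: "0 < 2 * (lam * (1 - lam))" using lam_bounds by simp
  have "real n / (2 * L) = real n / 2 * (1 / L)" by simp
  also have "\<dots> \<le> ?c * (2 * (lam * (1 - lam)))"
  proof (intro mult_mono)
    show "1 / L \<le> 2 * (lam * (1 - lam))" using lam_var V by linarith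
  qed (use c L_pos in auto)
  finally have Mge: "real n / (2 * L) \<le> Mv ?q i j" by (simp add: M)
  have QM: "Qv ?q i j k / Mv ?q i j = 1 / ?c" unfolding M Q using lam_bounds c(4) by simp
  have "\<bar>expect_unif Om (\<lambda>G. inS k i j G / cS i j G) - 1 / ?c\<bar> \<le> L ^ 5 * (8 * L ^ 3 / r) / real n"
    using expect_inS_inv[OF quasi0[OF L2] ij k Mge] unfolding QM .
  also have "\<dots> = 8 * L ^ 8 / (real n * r)" by (simp add: field_simps flip: power_add)
  finally have 1: "\<bar>expect_unif Om (\<lambda>G. inS k i j G / cS i j G) - 1 / ?c\<bar> \<le> 8 * L ^ 8 / (real n * r)" .
  have "1 / x - 1 / y = (y - x) / (x * y)" if "x > 0" "y > 0" for x y :: real using that by (simp add: field_simps)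
  then have "1 / ?c - 1 / real n = (real n - ?c) / (?c * real n)" using c(4) n_pos of_nat_0_less_iff by blast
  also have "\<dots> \<le> (2 * L) / (real n / 2 * real n)" using c n_pos L_pos by (intro frac_le) auto
  also have "\<dots> = 4 * L * (1 / (real n * real n))" by simp
  also have "\<dots> \<le> L ^ 8 * (1 / (real n * r))"
  proof (rule mult_mono)
    have "4 * L \<le> L ^ 2" using L_ge by (simp add: power2_eq_square)
    also have "\<dots> \<le> L ^ 8" using L_ge by (intro power_increasing) auto
    finally show "4 * L \<le> L ^ 8" .
    show "1 / (real n * real n) \<le> 1 / (real n * r)" using rn r_pos n_pos by (intro divide_left_mono) auto
  qed (use L_pos r_pos in auto)
  finally have "1 / ?c - 1 / real n \<le> L ^ 8 / (real n * r)" by simp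
  moreover have "1 / real n \<le> 1 / ?c" using c n_pos by (intro divide_left_mono) auto
  moreover have "0 \<le> L ^ 8 / (real n * r)" using L_pos r_pos by simp
  moreover have "\<bar>x - w\<bar> \<le> a + b" if "\<bar>x - y\<bar> \<le> a" "y - w \<le> b" "w \<le> y" "0 \<le> b" for x y w a b :: real
    using that by linarith
  ultimately have "\<bar>expect_unif Om (\<lambda>G. inS k i j G / cS i j G) - 1 / real n\<bar> \<le> 8 * L ^ 8 / (real n * r) + L ^ 8 / (real n * r)"
    using 1 by blast
  then show ?thesis by (simp add: add_divide_distrib[symmetric])
qed

lemma inS_inv_nonneg: "0 \<le> expect_unif Om (\<lambda>G. inS k i j G / cS i j G)"
  by (rule expect_unif_nonneg) auto

lemma inS_inv_weighted_le:
  "0 \<le> expect_unif Om (\<lambda>G. inS k i j G * of_bool (e \<in> G) / cS i j G)"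
  "expect_unif Om (\<lambda>G. inS k i j G * of_bool (e \<in> G) / cS i j G) \<le> expect_unif Om (\<lambda>G. inS k i j G / cS i j G)"
  by (auto intro!: expect_unif_nonneg expect_unif_mono)

text \<open>Arcs opposite forbidden cells lie in at most \<open>L\<close> columns per row and
  contribute at most 2/n each, so at the precision \<open>L^10 / n\<close> it is enough to bound
  them.\<close>

lemma row_diff_approx1:
  assumes L2: "(2 * L) ^ 20 \<le> real n" and ij: "i \<noteq> j" "i < n" "j < n" and k: "k < n" "(i,k) \<notin> F" "(j,k) \<notin> F"
  shows "\<bar>P (i,k) - P (j,k) - (real (s i) - real (s j)) / real n\<bar> \<le> L ^ 10 / real n"
proof -
  let ?e = "expect_unif Om (\<lambda>G. inS k i j G / cS i j G)"
  let ?A = "\<Sum>l\<in>{l. (j,l) \<in> F \<and> (i,l) \<notin> F}. expect_unif Om (\<lambda>G. inS k i j G * of_bool ((i,l) \<in> G) / cS i j G)"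
  let ?B = "\<Sum>l\<in>{l. (i,l) \<in> F \<and> (j,l) \<notin> F}. expect_unif Om (\<lambda>G. inS k i j G * of_bool ((j,l) \<in> G) / cS i j G)"
  have e: "\<bar>?e - 1 / real n\<bar> \<le> 9 * L ^ 8 / (real n * r)"
    using k by (intro expect_inS_inv0[OF L2 ij]) (auto simp: free_def)
  have "9 * L ^ 8 / (real n * r) \<le> 1 / real n"
  proof -
    have "100 * L ^ 8 \<le> r" by (rule r_ge_const) simp
    moreover have "0 \<le> L ^ 8" using L_pos by simp
    ultimately have "9 * L ^ 8 \<le> r" by linarith
    then have "9 * L ^ 8 / (real n * r) \<le> r / (real n * r)" using r_pos by (intro divide_right_mono) auto
    then show ?thesis using r_pos by simp
  qed
  then have e2: "?e \<le> 2 / real n" using e by (simp add: field_simps)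
  have bnd: "0 \<le> (\<Sum>l\<in>{l. (b,l) \<in> F \<and> Z l}. expect_unif Om (\<lambda>G. inS k i j G * of_bool ((a,l) \<in> G) / cS i j G))"
     "(\<Sum>l\<in>{l. (b,l) \<in> F \<and> Z l}. expect_unif Om (\<lambda>G. inS k i j G * of_bool ((a,l) \<in> G) / cS i j G)) \<le> L * ?e"
    if "b < n" for a b Z
  proof -
    show "0 \<le> (\<Sum>l\<in>{l. (b,l) \<in> F \<and> Z l}. expect_unif Om (\<lambda>G. inS k i j G * of_bool ((a,l) \<in> G) / cS i j G))"
      by (intro sum_nonneg inS_inv_weighted_le)
    have "(\<Sum>l\<in>{l. (b,l) \<in> F \<and> Z l}. expect_unif Om (\<lambda>G. inS k i j G * of_bool ((a,l) \<in> G) / cS i j G))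
       \<le> real (card {l. (b,l) \<in> F \<and> Z l}) * ?e"
      by (intro sum_bounded_above inS_inv_weighted_le)
    also have "\<dots> \<le> L * ?e" using card_forbidden_row[OF that] inS_inv_nonneg by (intro mult_right_mono) auto
    finally show "(\<Sum>l\<in>{l. (b,l) \<in> F \<and> Z l}. expect_unif Om (\<lambda>G. inS k i j G * of_bool ((a,l) \<in> G) / cS i j G)) \<le> L * ?e" .
  qed
  have AB: "\<bar>?B - ?A\<bar> \<le> L * ?e"
    using bnd[OF ij(2), where Z = "\<lambda>l. (j,l) \<notin> F" and a = j] bnd[OF ij(3), where Z = "\<lambda>l. (i,l) \<notin> F" and a = i] by linarith
  have "L * ?e \<le> L * (2 / real n)" using e2 L_pos by (intro mult_left_mono) auto
  moreover have "\<bar>(real (s i) - real (s j)) * (?e - 1 / real n)\<bar> \<le> 2 * L * r * (9 * L ^ 8 / (real n * r))"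
    unfolding abs_mult using s_diff[OF ij(2,3)] e L_pos r_pos by (intro mult_mono) auto
  moreover have "2 * L * r * (9 * L ^ 8 / (real n * r)) = 18 * L ^ 9 / real n"
    using r_pos by (simp add: field_simps power_numeral_reduce)
  moreover have "P (i,k) - P (j,k) - (real (s i) - real (s j)) / real n = (real (s i) - real (s j)) * (?e - 1 / real n) + (?B - ?A)"
    unfolding row_diff_split[OF ij k] by (simp add: algebra_simps diff_divide_distrib)
  ultimately have "\<bar>P (i,k) - P (j,k) - (real (s i) - real (s j)) / real n\<bar> \<le> 18 * L ^ 9 / real n + L * (2 / real n)"
    using AB by linarith
  also have "\<dots> = (18 * L ^ 9 + 2 * L) / real n" by (simp add: add_divide_distrib)
  also have "\<dots> \<le> L ^ 10 / real n"
  proof (rule divide_right_mono)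
    have "L \<le> L ^ 9" using power_increasing[of 1 9 L] L_ge by simp
    then have "18 * L ^ 9 + 2 * L \<le> 20 * L ^ 9" by linarith
    also have "\<dots> \<le> L * L ^ 9" using L_ge by (intro mult_right_mono) auto
    finally show "18 * L ^ 9 + 2 * L \<le> L ^ 10" by (simp add: power_numeral_reduce)
  qed simp
  finally show ?thesis .
qed

text \<open>The additive model with the right margins: it sums to \<open>s i\<close> along a row and
  to \<open>t k\<close> along a column.\<close>

definition q1 :: "nat \<times> nat \<Rightarrow> real" where
  "q1 e = (real (s (fst e)) + real (t (snd e))) / real n - T / real n ^ 2"

lemma P_approx1:
  assumes L2: "(2 * L) ^ 20 \<le> real n" and ik: "i < n" "k < n" "(i,k) \<notin> F"
  shows "\<bar>P (i,k) - q1 (i,k)\<bar> \<le> 2 * L ^ 10 / real n"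
proof -
  define a where "a j = (real (s i) - real (s j)) / real n" for j
  have n0: "0 < real n" using n_pos by simp
  have "\<bar>real n * P (i,k) - real (t k) - real (indeg F k) * P (i,k) - (\<Sum>j<n. a j)\<bar> \<le> real n * (L ^ 10 / real n) + L * (2 * L / r)"
  proof (rule P_from_row_diffs[OF ik])
    show "\<bar>P (i,k) - P (j,k) - a j\<bar> \<le> L ^ 10 / real n" if "j < n" "j \<noteq> i" "(j,k) \<notin> F" for j
      unfolding a_def using row_diff_approx1[OF L2 _ ik(1) that(1) ik(2,3) that(3)] that by auto
    show "\<bar>a j\<bar> \<le> 2 * L / r" if "j < n" for j
    proof -
      have "\<bar>a j\<bar> \<le> (2 * L * r) / real n" unfolding a_def abs_divide using s_diff[OF ik(1) that] by (simp add: divide_right_mono)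
      also have "\<dots> = 2 * L / r" using r_pos by (simp add: n_eq)
      finally show ?thesis .
    qed
  qed (use L_pos in \<open>auto simp: a_def\<close>)
  moreover have "(\<Sum>j<n. a j) = real (s i) - T / real n"
    unfolding a_def by (use n0 in \<open>simp add: sum_divide_distrib[symmetric] sum_subtractf diff_divide_distrib\<close>)
  moreover have "L * (2 * L / r) \<le> 1"
  proof -
    have "100 * L ^ 2 \<le> r" by (rule r_ge_const) simp
    then have "2 * L ^ 2 \<le> r" using zero_le_power2[of L] by linarith
    then show ?thesis using r_pos by (simp add: divide_le_eq power2_eq_square)
  qed
  moreover have "0 \<le> real (indeg F k) * P (i,k)" using P_nonneg by simp
  moreover have "real (indeg F k) * P (i,k) \<le> L * 1" using F_in[OF ik(2)] P_le1 P_nonneg L_pos by (intro mult_mono) auto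
  moreover have "real n * (L ^ 10 / real n) = L ^ 10" using n0 by simp
  moreover have "L + 1 \<le> L ^ 10"
  proof -
    have "L + 1 \<le> 100 * L" using L_ge by linarith
    also have "\<dots> \<le> L ^ 2" using L_ge by (simp add: power2_eq_square)
    also have "\<dots> \<le> L ^ 10" using L_ge by (intro power_increasing) auto
    finally show ?thesis .
  qed
  ultimately have "\<bar>real n * P (i,k) - (real (s i) + real (t k) - T / real n)\<bar> \<le> 2 * L ^ 10" by linarith
  moreover have "real n * P (i,k) - (real (s i) + real (t k) - T / real n) = real n * (P (i,k) - q1 (i,k))"
    unfolding q1_def using n0 by (simp add: field_simps power2_eq_square)
  ultimately have "real n * \<bar>P (i,k) - q1 (i,k)\<bar> \<le> 2 * L ^ 10" by (simp add: abs_mult)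
  then show ?thesis using n0 by (simp add: le_divide_eq mult.commute)
qed

abbreviation "sg i \<equiv> real (s i) - lam * real n"
abbreviation "ta k \<equiv> real (t k) - lam * real n"
text \<open>Drift of the mean degree away from \<open>lam * n\<close>. It vanishes when
  \<open>lam\<close> is the exact density and becomes non-zero when arcs are removed by
  conditioning.\<close>

definition "om = (T - lam * real n ^ 2) / real n"

lemma om_bound: "\<bar>om\<bar> \<le> L"
  unfolding om_def abs_divide using sum_near n_pos by (simp add: divide_le_eq)

lemma q1_eq: "q1 (i,k) = lam + (sg i + ta k - om) / real n"
  unfolding q1_def om_def using n_pos by (simp add: field_simps power2_eq_square)

lemma q1_near: "i < n \<Longrightarrow> k < n \<Longrightarrow> \<bar>q1 (i,k) - lam\<bar> \<le> 3 * L / r"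
proof -
  assume ik: "i < n" "k < n"
  have "\<bar>sg i + ta k - om\<bar> \<le> 3 * L * r" using s_near[OF ik(1)] t_near[OF ik(2)] om_bound L_le_Lr by linarith
  then have "\<bar>sg i + ta k - om\<bar> / real n \<le> 3 * L * r / real n" by (intro divide_right_mono) auto
  also have "\<dots> = 3 * L / r" using r_pos by (simp add: n_eq)
  finally show ?thesis unfolding q1_eq by simp
qed

lemma q1_bounds: "i < n \<Longrightarrow> k < n \<Longrightarrow> 0 \<le> q1 (i,k) \<and> q1 (i,k) \<le> 1"
proof -
  assume ik: "i < n" "k < n"
  have "100 * L ^ 2 \<le> r" by (rule r_ge_const) simp
  then have "3 * L ^ 2 \<le> r" using zero_le_power2[of L] by linarith
  then have "3 * L / r \<le> 1 / L" using r_pos L_pos by (simp add: field_simps power2_eq_square)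
  then show ?thesis using q1_near[OF ik] lam_bounds by linarith
qed

text \<open>The second approximation is applied to the conditioned instance, whose own
  \<open>q1\<close> differs from the original one by at most 6/n through the lowered degrees and 3/n
  through the lowered total. Hence a single \<open>q1\<close> serves all conditionings on at most
  three arcs.\<close>

lemma quasi1:
  assumes L4: "(4 * L) ^ 20 \<le> real n"
  shows "quasi q1 (L ^ 12 / real n)"
  unfolding quasi_def
proof (intro conjI allI impI ballI)
  have n0: "0 < real n" using n_pos by simp
  have "1 \<le> L ^ 12" using L_ge by (simp add: one_le_power)
  then show "1 / real n \<le> L ^ 12 / real n" by (intro divide_right_mono) auto
  show "0 \<le> q1 e" "q1 e \<le> 1" if "e \<in> {..<n} \<times> {..<n} - F" for e using q1_bounds that by auto
  fix E e assume E: "E \<subseteq> {..<n} \<times> {..<n} - F" "card E \<le> 3" and e: "e \<in> {..<n} \<times> {..<n} - F" "e \<notin> E"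
  have fE: "finite E" by (rule finite_subset[OF E(1)]) simp
  have "(2 * L) ^ 20 \<le> (4 * L) ^ 20" using L_pos by (intro power_mono) auto
  then have L2: "(2 * L) ^ 20 \<le> real n" using L4 by linarith
  have dE: "\<And>v. real (outdeg E v) \<le> L \<and> real (indeg E v) \<le> L" by (rule small_deg[OF fE E(2)])
  note le = conditioned(2)[OF L2 E(1) dE]
  show "\<bar>arc_prob Om (insert e E) - q1 e * arc_prob Om E\<bar> \<le> L ^ 12 / real n"
  proof (rule arc_prob_insert_approx[OF L2 E(1) _ e])
    show "real (outdeg E v) \<le> L \<and> real (indeg E v) \<le> L" for v by (rule dE)
    show "0 \<le> L ^ 12 / real n" using L_pos by simp
    assume c: "near_regular_ne n (2 * L) lam (\<lambda>v. s v - outdeg E v) (\<lambda>v. t v - indeg E v) (F \<union> E)"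
    obtain i k where ik: "e = (i,k)" by (cases e)
    then have ik': "i < n" "k < n" "(i,k) \<notin> F \<union> E" using e by auto
    let ?q = "near_regular_ne.q1 n (\<lambda>v. s v - outdeg E v) (\<lambda>v. t v - indeg E v) (i,k)"
    have 1: "\<bar>arc_prob (biadj n (\<lambda>v. s v - outdeg E v) (\<lambda>v. t v - indeg E v) (F \<union> E)) {e} - ?q\<bar> \<le> 2 * (2 * L) ^ 10 / real n"
      unfolding ik using L4 by (intro near_regular_ne.P_approx1[OF c _ ik']) simp
    have "(\<Sum>v<n. s v - outdeg E v) = (\<Sum>v<n. s v) - (\<Sum>v<n. outdeg E v)"
      using le by (intro sum_subtractf_nat) auto
    moreover have "(\<Sum>v<n. outdeg E v) = card E" using E(1) by (intro sum_outdeg) auto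
    moreover have "(\<Sum>v<n. outdeg E v) \<le> (\<Sum>v<n. s v)" using le by (intro sum_mono) auto
    ultimately have T': "real (\<Sum>v<n. s v - outdeg E v) = T - real (card E)" by (simp add: of_nat_diff)
    have "?q - q1 (i,k) = - (real (outdeg E i) + real (indeg E k)) / real n + real (card E) / real n ^ 2"
      unfolding near_regular_ne.q1_def[OF c] q1_def fst_conv snd_conv T'
      using le[OF ik'(1)] le[OF ik'(2)] by (simp add: of_nat_diff diff_divide_distrib add_divide_distrib)
    moreover have "(real (outdeg E i) + real (indeg E k)) / real n \<le> 6 / real n"
      using small_deg[OF fE E(2)] n0 by (intro divide_right_mono) (auto simp: add_mono[of _ 3 _ 3, simplified])
    moreover have "real (card E) / real n ^ 2 \<le> 3 / real n"
    proof -
      have "real (card E) / real n ^ 2 \<le> 3 * (1 / real n ^ 2)" using E(2) by (simp add: divide_right_mono)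
      then show ?thesis using inv_n3(3) by linarith
    qed
    moreover have "0 \<le> (real (outdeg E i) + real (indeg E k)) / real n" "0 \<le> real (card E) / real n ^ 2" by simp_all
    ultimately have 2: "\<bar>?q - q1 (i,k)\<bar> \<le> 9 / real n" by linarith
    have "\<bar>arc_prob (biadj n (\<lambda>v. s v - outdeg E v) (\<lambda>v. t v - indeg E v) (F \<union> E)) {e} - q1 e\<bar>
       \<le> 2 * (2 * L) ^ 10 / real n + 9 / real n" using 1 2 unfolding ik by linarith
    also have "\<dots> = (2048 * L ^ 10 + 9) / real n" by (simp add: power_mult_distrib add_divide_distrib)
    also have "\<dots> \<le> L ^ 12 / real n"
    proof (rule divide_right_mono)
      have "1 \<le> L ^ 10" using L_ge by (simp add: one_le_power)
      then have "2048 * L ^ 10 + 9 \<le> 100 * 100 * L ^ 10" by linarith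
      also have "\<dots> \<le> L * L * L ^ 10" using L_ge by (intro mult_right_mono mult_mono) auto
      finally show "2048 * L ^ 10 + 9 \<le> L ^ 12" by (simp add: power_numeral_reduce)
    qed simp
    finally show "\<bar>arc_prob (biadj n (\<lambda>v. s v - outdeg E v) (\<lambda>v. t v - indeg E v) (F \<union> E)) {e} - q1 e\<bar> \<le> L ^ 12 / real n" .
  qed
qed

end

section \<open>Arc probabilities, third approximation\<close>

context near_regular_ne
begin

abbreviation "V \<equiv> 2 * (lam * (1 - lam))"
text \<open>The logarithmic derivative of u*(1 - u) at \<open>lam\<close>: the relative change of
  the probability that two cells of a column differ when the density of the column moves.\<close>

abbreviation "cc \<equiv> (1 - 2 * lam) / (lam * (1 - lam))"

lemma V_bounds: "2 / L \<le> V" "0 < V" "V \<le> 1"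
proof -
  show "2 / L \<le> V" using lam_var by simp
  show "0 < V" using lam_bounds by simp
  have "0 \<le> (2 * lam - 1)\<^sup>2" by simp
  then show "V \<le> 1" by (simp add: power2_eq_square algebra_simps)
qed

lemma abs_1_2lam: "\<bar>1 - 2 * lam\<bar> \<le> 1" using lam_bounds by auto

lemma cc_bound: "\<bar>cc\<bar> \<le> L"
proof -
  have "\<bar>cc\<bar> = \<bar>1 - 2 * lam\<bar> / (lam * (1 - lam))" using lam_bounds by (simp add: abs_divide abs_mult)
  also have "\<dots> \<le> 1 / (1 / L)" using abs_1_2lam lam_var L_pos by (intro frac_le) auto
  finally show ?thesis by simp
qed

lemma Qv_q1: "Qv q1 i j l = V + (1 - 2 * lam) * ((q1 (i,l) - lam) + (q1 (j,l) - lam)) - 2 * ((q1 (i,l) - lam) * (q1 (j,l) - lam))"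
  by (simp add: Qv_def algebra_simps)

lemma q1_prod: "i < n \<Longrightarrow> j < n \<Longrightarrow> l < n \<Longrightarrow> \<bar>(q1 (i,l) - lam) * (q1 (j,l) - lam)\<bar> \<le> 9 * L\<^sup>2 / real n"
proof -
  assume "i < n" "j < n" "l < n"
  then have "\<bar>q1 (i,l) - lam\<bar> * \<bar>q1 (j,l) - lam\<bar> \<le> (3 * L / r) * (3 * L / r)"
    using L_pos r_pos by (intro mult_mono q1_near) auto
  also have "\<dots> = 9 * L\<^sup>2 / real n" by (simp add: n_eq power2_eq_square)
  finally show ?thesis by (simp add: abs_mult)
qed

lemma Qv_q1_bounds:
  assumes "i < n" "j < n" "l < n"
  shows "0 \<le> Qv q1 i j l" "Qv q1 i j l \<le> 1"
proof -
  let ?a = "q1 (i,l)" and ?b = "q1 (j,l)"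
  have b: "0 \<le> ?a" "?a \<le> 1" "0 \<le> ?b" "?b \<le> 1" using q1_bounds assms by auto
  have "Qv q1 i j l = ?a * (1 - ?b) + ?b * (1 - ?a)" by (simp add: Qv_def algebra_simps)
  moreover have "1 - Qv q1 i j l = ?a * ?b + (1 - ?a) * (1 - ?b)" by (simp add: Qv_def algebra_simps)
  moreover have "0 \<le> ?a * (1 - ?b) + ?b * (1 - ?a)" "0 \<le> ?a * ?b + (1 - ?a) * (1 - ?b)"
    using b by (intro add_nonneg_nonneg mult_nonneg_nonneg; simp)+
  ultimately have "0 \<le> Qv q1 i j l" "0 \<le> 1 - Qv q1 i j l" by simp_all
  then show "0 \<le> Qv q1 i j l" "Qv q1 i j l \<le> 1" by simp_all
qed

lemma Qv_q1_near:
  assumes ijl: "i < n" "j < n" "l < n"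
  shows "\<bar>Qv q1 i j l - V\<bar> \<le> 7 * L / r"
proof -
  have "\<bar>(1 - 2 * lam) * ((q1 (i,l) - lam) + (q1 (j,l) - lam))\<bar> \<le> 1 * (6 * L / r)"
    unfolding abs_mult
  proof (intro mult_mono abs_1_2lam)
    have "\<bar>(q1 (i,l) - lam) + (q1 (j,l) - lam)\<bar> \<le> 3 * L / r + 3 * L / r"
      using q1_near[OF ijl(1,3)] q1_near[OF ijl(2,3)] by linarith
    then show "\<bar>(q1 (i,l) - lam) + (q1 (j,l) - lam)\<bar> \<le> 6 * L / r" by (simp add: add_divide_distrib[symmetric])
  qed auto
  moreover have "2 * (9 * L\<^sup>2 / real n) \<le> L / r"
  proof -
    have "18 * L \<le> r" using r_ge_const[of 1] L_pos by simp
    then have "L * (18 * L) \<le> L * r" using L_pos by (intro mult_left_mono) auto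
    then show ?thesis using r_pos by (simp add: n_eq field_simps power2_eq_square)
  qed
  ultimately have "\<bar>Qv q1 i j l - V\<bar> \<le> 6 * L / r + L / r" unfolding Qv_q1 using q1_prod[OF ijl] by linarith
  then show ?thesis by (simp add: add_divide_distrib[symmetric])
qed

lemma Mv_q1_near:
  assumes ij: "i < n" "j < n"
  shows "\<bar>Mv q1 i j - real n * V\<bar> \<le> 8 * L * r"
proof -
  let ?c = "real (card (free i j))"
  have c: "real n - 2 * L \<le> ?c" "?c \<le> real n" using card_free_ge[OF ij] card_free_le by auto
  have "Mv q1 i j - ?c * V = (\<Sum>l\<in>free i j. Qv q1 i j l - V)" by (simp add: Mv_def sum_subtractf)
  then have "\<bar>Mv q1 i j - ?c * V\<bar> \<le> (\<Sum>l\<in>free i j. \<bar>Qv q1 i j l - V\<bar>)" by (simp only: sum_abs)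
  also have "\<dots> \<le> (\<Sum>l\<in>free i j. 7 * L / r)" using ij by (intro sum_mono Qv_q1_near) (auto simp: free_def)
  also have "\<dots> = ?c * (7 * L / r)" by simp
  also have "\<dots> \<le> real n * (7 * L / r)" using c L_pos r_pos by (intro mult_right_mono) auto
  also have "\<dots> = 7 * L * r" using r_pos by (simp add: n_eq)
  finally have 1: "\<bar>Mv q1 i j - ?c * V\<bar> \<le> 7 * L * r" .
  have "?c * V \<le> real n * V" using c V_bounds(2) by (intro mult_right_mono) auto
  then have "\<bar>?c * V - real n * V\<bar> = real n * V - ?c * V" by linarith
  also have "\<dots> = (real n - ?c) * V" by (rule left_diff_distrib[symmetric])
  also have "\<dots> \<le> 2 * L * 1" using c V_bounds L_pos by (intro mult_mono) auto
  finally have 2: "\<bar>?c * V - real n * V\<bar> \<le> 2 * L" by simp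
  have "2 * L \<le> L * r" using r_ge_100 L_pos by (simp add: mult.commute)
  then show ?thesis using 1 2 by linarith
qed

lemma Mv_q1_ge:
  assumes ij: "i < n" "j < n"
  shows "real n / L \<le> Mv q1 i j"
proof -
  have "100 * L ^ 2 \<le> r" by (rule r_ge_const) simp
  then have "8 * L ^ 2 \<le> r" using zero_le_power2[of L] by linarith
  then have "r * (8 * L ^ 2) \<le> r * r" using r_pos by (intro mult_left_mono) auto
  then have "8 * L * r \<le> real n / L" using L_pos by (simp add: n_eq field_simps power2_eq_square)
  moreover have "real n * (2 / L) \<le> real n * V" by (intro mult_left_mono V_bounds) auto
  ultimately show ?thesis using Mv_q1_near[OF ij] by (simp add: field_simps)
qed

lemma sum_ta: "(\<Sum>l<n. ta l) = real n * om"
proof -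
  have "(\<Sum>l<n. ta l) = real (\<Sum>l<n. t l) - lam * real n ^ 2" by (simp add: sum_subtractf power2_eq_square)
  then show ?thesis using n_pos by (simp add: om_def sum_st)
qed

text \<open>Column \<open>k\<close> is compared with the average column. The deviations of rows
  \<open>i\<close> and \<open>j\<close> enter all columns equally and cancel, so to first order only
  the deviation of \<open>t k\<close> survives; products of deviations are O(L^2 / n) in each
  column.\<close>

lemma nQ_minus_M:
  assumes ijk: "i < n" "j < n" "k < n"
  shows "\<bar>real n * Qv q1 i j k - Mv q1 i j - 2 * (1 - 2 * lam) * ta k\<bar> \<le> 40 * L\<^sup>2"
proof -
  have n0: "0 < real n" using n_pos by simp
  let ?y = "\<lambda>l. (q1 (i,l) - lam) * (q1 (j,l) - lam)"
  have df: "Qv q1 i j k - Qv q1 i j l = 2 * (1 - 2 * lam) / real n * (ta k - ta l) - 2 * (?y k - ?y l)" for l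
  proof -
    have gen: "v + m * a - 2 * y - (v + m * b - 2 * z) = m * (a - b) - 2 * (y - z)" for v m a b y z :: real
      by (simp add: algebra_simps)
    have "(q1 (i,k) - lam) + (q1 (j,k) - lam) - ((q1 (i,l) - lam) + (q1 (j,l) - lam)) = 2 / real n * (ta k - ta l)"
      unfolding q1_eq using n0 by (simp add: field_simps)
    moreover have "Qv q1 i j k - Qv q1 i j l = (1 - 2 * lam) *
       ((q1 (i,k) - lam) + (q1 (j,k) - lam) - ((q1 (i,l) - lam) + (q1 (j,l) - lam))) - 2 * (?y k - ?y l)"
      unfolding Qv_q1 by (rule gen)
    moreover have "m * (2 / N * d) = 2 * m / N * d" for m N d :: real by simp
    ultimately show ?thesis by metis
  qed
  have "real n * Qv q1 i j k - (\<Sum>l<n. Qv q1 i j l) = (\<Sum>l<n. Qv q1 i j k - Qv q1 i j l)" by (simp add: sum_subtractf)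
  also have "\<dots> = 2 * (1 - 2 * lam) / real n * (\<Sum>l<n. ta k - ta l) - 2 * (\<Sum>l<n. ?y k - ?y l)"
    unfolding df sum_subtractf[of "\<lambda>l. 2 * (1 - 2 * lam) / real n * (ta k - ta l)"] sum_distrib_left ..
  also have "(\<Sum>l<n. ta k - ta l) = real n * (ta k - om)"
    using sum_ta by (simp only: sum_subtractf sum_constant card_lessThan) (simp add: algebra_simps)
  also have "2 * (1 - 2 * lam) / real n * (real n * (ta k - om)) = 2 * (1 - 2 * lam) * (ta k - om)" using n0 by simp
  finally have 1: "real n * Qv q1 i j k - (\<Sum>l<n. Qv q1 i j l) = 2 * (1 - 2 * lam) * (ta k - om) - 2 * (\<Sum>l<n. ?y k - ?y l)" .
  have "\<bar>\<Sum>l<n. ?y k - ?y l\<bar> \<le> (\<Sum>l<n. \<bar>?y k - ?y l\<bar>)" by (rule sum_abs)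
  also have "\<dots> \<le> (\<Sum>l<n. 18 * L\<^sup>2 / real n)"
  proof (rule sum_mono)
    fix l assume "l \<in> {..<n}"
    then have "\<bar>?y k - ?y l\<bar> \<le> 9 * L\<^sup>2 / real n + 9 * L\<^sup>2 / real n" using q1_prod[OF ijk] q1_prod[OF ijk(1,2), of l] by auto
    then show "\<bar>?y k - ?y l\<bar> \<le> 18 * L\<^sup>2 / real n" by simp
  qed
  also have "\<dots> = 18 * L\<^sup>2" using n0 by simp
  finally have 2: "\<bar>\<Sum>l<n. ?y k - ?y l\<bar> \<le> 18 * L\<^sup>2" .
  have sub: "free i j \<subseteq> {..<n}" by (auto simp: free_def)
  have "(\<Sum>l<n. Qv q1 i j l) - Mv q1 i j = (\<Sum>l\<in>{..<n} - free i j. Qv q1 i j l)"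
    unfolding Mv_def using sub by (simp add: sum_diff)
  moreover have "(\<Sum>l\<in>{..<n} - free i j. Qv q1 i j l) \<le> real (card ({..<n} - free i j)) * 1"
    using Qv_q1_bounds[OF ijk(1,2)] by (intro sum_bounded_above) auto
  moreover have "0 \<le> (\<Sum>l\<in>{..<n} - free i j. Qv q1 i j l)" using Qv_q1_bounds[OF ijk(1,2)] by (intro sum_nonneg) auto
  moreover have "real (card ({..<n} - free i j)) \<le> 2 * L"
    using card_Diff_subset[OF finite_free sub] card_free_ge[OF ijk(1,2)] card_free_le[of i j] by (simp add: of_nat_diff)
  moreover have "\<bar>2 * (1 - 2 * lam) * om\<bar> \<le> 2 * L"
  proof -
    have "\<bar>1 - 2 * lam\<bar> * \<bar>om\<bar> \<le> 1 * L" using abs_1_2lam om_bound by (intro mult_mono) auto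
    then have "\<bar>(1 - 2 * lam) * om\<bar> \<le> L" by (simp only: abs_mult mult_1)
    then show ?thesis by linarith
  qed
  ultimately have "\<bar>real n * Qv q1 i j k - Mv q1 i j - 2 * (1 - 2 * lam) * ta k\<bar> \<le> 2 * L + 36 * L\<^sup>2 + 2 * L"
    using 1 2 by (simp add: right_diff_distrib)
  moreover have "L \<le> L\<^sup>2" using power_increasing[of 1 2 L] L_ge by simp
  ultimately show ?thesis by linarith
qed

text \<open>This is \<open>nQ_minus_M\<close> divided by \<open>n * M\<close>, with \<open>M\<close>
  then replaced by \<open>n * V\<close>. The change of the denominator and the numerator are both of
  order \<open>r\<close>, so the replacement costs r^2/n^3 = 1/n^2, up to powers of
  \<open>L\<close>.\<close>

lemma ratio_q1:
  assumes ijk: "i < n" "j < n" "k < n"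
  shows "\<bar>Qv q1 i j k / Mv q1 i j - 1 / real n - cc * ta k / real n ^ 2\<bar> \<le> L ^ 5 / real n ^ 2"
proof -
  define N M W D D0 where "N = real n" and "M = Mv q1 i j" and "W = N * V"
    and "D = N * Qv q1 i j k - M" and "D0 = 2 * (1 - 2 * lam) * ta k"
  have N0: "0 < N" using n_pos by (simp add: N_def)
  have iM: "1 / M \<le> L / N" and M0: "0 < M"
  proof -
    have "0 < N / L" using N0 L_pos by simp
    then show "0 < M" using Mv_q1_ge[OF ijk(1,2)] by (simp add: M_def N_def)
    then have "1 / M \<le> 1 / (N / L)" using Mv_q1_ge[OF ijk(1,2)] \<open>0 < N / L\<close>
      by (intro divide_left_mono mult_pos_pos) (auto simp: M_def N_def)
    then show "1 / M \<le> L / N" by simp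
  qed
  have W0: "0 < W" using N0 V_bounds by (simp add: W_def)
  have iW: "1 / W \<le> L / N"
  proof -
    have "N * (1 / L) \<le> W" unfolding W_def using V_bounds(2) lam_var N0 by (intro mult_left_mono) auto
    then have "1 / W \<le> 1 / (N * (1 / L))" using N0 L_pos W0 by (intro divide_left_mono mult_pos_pos) auto
    then show ?thesis by simp
  qed
  have "Qv q1 i j k / M - 1 / N = D / (N * M)" unfolding D_def using N0 M0 by (simp add: field_simps)
  moreover have "cc * ta k / N ^ 2 = D0 / (N * W)" unfolding D0_def W_def using N0 lam_bounds by (simp add: field_simps power2_eq_square)
  moreover have "D / (N * M) - D0 / (N * W) = (D - D0) * (1 / M) * (1 / N) + D0 * (W - M) * (1 / M) * (1 / W) * (1 / N)"
    using N0 M0 W0 by (simp add: field_simps)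
  ultimately have eq: "Qv q1 i j k / M - 1 / N - cc * ta k / N ^ 2
      = (D - D0) * (1 / M) * (1 / N) + D0 * (W - M) * (1 / M) * (1 / W) * (1 / N)" by simp
  have b1: "\<bar>(D - D0) * (1 / M) * (1 / N)\<bar> \<le> 40 * L\<^sup>2 * (L / N) * (1 / N)"
    unfolding abs_mult using nQ_minus_M[OF ijk] iM M0 N0 L_pos by (intro mult_mono) (auto simp: D_def D0_def M_def N_def)
  have D0: "\<bar>D0\<bar> \<le> 2 * L * r"
  proof -
    have "\<bar>1 - 2 * lam\<bar> * \<bar>ta k\<bar> \<le> 1 * (L * r)" using abs_1_2lam t_near[OF ijk(3)] by (intro mult_mono) auto
    then have "\<bar>(1 - 2 * lam) * ta k\<bar> \<le> L * r" by (simp only: abs_mult mult_1)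
    moreover have "D0 = 2 * ((1 - 2 * lam) * ta k)" unfolding D0_def by (rule mult.assoc)
    ultimately show ?thesis by linarith
  qed
  have WM: "\<bar>W - M\<bar> \<le> 8 * L * r" using Mv_q1_near[OF ijk(1,2)] by (simp add: W_def M_def N_def abs_minus_commute)
  have b2: "\<bar>D0 * (W - M) * (1 / M) * (1 / W) * (1 / N)\<bar> \<le> (2 * L * r) * (8 * L * r) * (L / N) * (L / N) * (1 / N)"
    unfolding abs_mult using D0 WM iM iW M0 W0 N0 L_pos r_pos by (intro mult_mono) auto
  have "40 * L\<^sup>2 * (L / N) * (1 / N) + (2 * L * r) * (8 * L * r) * (L / N) * (L / N) * (1 / N) = (40 * L ^ 3 + 16 * L ^ 4) / N ^ 2"
    using r_pos by (simp add: N_def n_eq field_simps power_numeral_reduce)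
  also have "\<dots> \<le> L ^ 5 / N ^ 2"
  proof (rule divide_right_mono)
    have "L ^ 3 \<le> L ^ 4" using power_increasing[of 3 4 L] L_ge by simp
    then have "40 * L ^ 3 + 16 * L ^ 4 \<le> 100 * L ^ 4" using zero_le_power[of L 4] L_pos by linarith
    also have "\<dots> \<le> L * L ^ 4" using L_ge by (intro mult_right_mono) auto
    finally show "40 * L ^ 3 + 16 * L ^ 4 \<le> L ^ 5" by (simp add: power_numeral_reduce)
  qed simp
  finally show ?thesis using eq b1 b2 unfolding M_def N_def by linarith
qed

lemma ratio_q1_crude:
  assumes ijk: "i < n" "j < n" "k < n"
  shows "\<bar>Qv q1 i j k / Mv q1 i j - 1 / real n\<bar> \<le> 2 * L\<^sup>2 * r / real n ^ 2"
proof -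
  have "\<bar>cc * ta k\<bar> \<le> L * (L * r)" unfolding abs_mult[of cc] using cc_bound t_near[OF ijk(3)] L_pos by (intro mult_mono) auto
  then have "\<bar>cc * ta k / real n ^ 2\<bar> \<le> L\<^sup>2 * r / real n ^ 2"
    using divide_right_mono[of "\<bar>cc * ta k\<bar>" "L * (L * r)" "real n ^ 2"]
    by (simp only: abs_divide abs_power2 zero_le_power2) (simp add: power2_eq_square mult.assoc)
  moreover have "L ^ 5 / real n ^ 2 \<le> L\<^sup>2 * r / real n ^ 2"
  proof (rule divide_right_mono)
    have "L\<^sup>2 * L ^ 3 \<le> L\<^sup>2 * r" using r_ge_pow[of 3] by (intro mult_left_mono) auto
    then show "L ^ 5 \<le> L\<^sup>2 * r" by (simp add: power_numeral_reduce)
  qed simp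
  moreover have "L\<^sup>2 * r / real n ^ 2 + L\<^sup>2 * r / real n ^ 2 = 2 * L\<^sup>2 * r / real n ^ 2" by simp
  ultimately show ?thesis using ratio_q1[OF ijk] by linarith
qed

context
  assumes L4: "(4 * L) ^ 20 \<le> real n"
begin

lemma Mv_q1_ge2: "i < n \<Longrightarrow> j < n \<Longrightarrow> real n / (2 * L) \<le> Mv q1 i j"
proof -
  assume "i < n" "j < n"
  moreover have "real n / (2 * L) \<le> real n / L" using L_pos by (simp add: field_simps)
  ultimately show ?thesis using Mv_q1_ge[of i j] by linarith
qed

lemma expect_inS_inv1:
  assumes ij: "i \<noteq> j" "i < n" "j < n" and k: "k \<in> free i j"
  shows "\<bar>expect_unif Om (\<lambda>G. inS k i j G / cS i j G) - (1 / real n + cc * ta k / real n ^ 2)\<bar> \<le> 2 * L ^ 17 / real n ^ 2"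
proof -
  have kn: "k < n" using k by (simp add: free_def)
  have "\<bar>expect_unif Om (\<lambda>G. inS k i j G / cS i j G) - Qv q1 i j k / Mv q1 i j\<bar> \<le> L ^ 5 * (L ^ 12 / real n) / real n"
    by (rule expect_inS_inv[OF quasi1[OF L4] ij k Mv_q1_ge2[OF ij(2,3)]])
  also have "\<dots> = L ^ 17 / real n ^ 2" by (simp add: power2_eq_square flip: power_add)
  finally have 1: "\<bar>expect_unif Om (\<lambda>G. inS k i j G / cS i j G) - Qv q1 i j k / Mv q1 i j\<bar> \<le> L ^ 17 / real n ^ 2" .
  have "L ^ 5 / real n ^ 2 \<le> L ^ 17 / real n ^ 2"
    using power_increasing[of 5 17 L] L_ge by (intro divide_right_mono) auto
  moreover have "2 * L ^ 17 / real n ^ 2 = L ^ 17 / real n ^ 2 + L ^ 17 / real n ^ 2" by simp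
  ultimately show ?thesis using 1 ratio_q1[OF ij(2,3) kn] by linarith
qed

text \<open>Column \<open>l\<close> is not free for the pair, so the arc \<open>(a,l)\<close> takes
  no part in \<open>sdiff\<close> and is nearly independent of it. Its probability enters only
  through \<open>P_approx0\<close>, as the whole term is of order 1/n.\<close>

lemma expect_inS_arc_inv1:
  assumes ij: "i \<noteq> j" "i < n" "j < n" and k: "k \<in> free i j"
    and a: "a < n" "l < n" "(a,l) \<notin> F" "l \<notin> free i j"
  shows "\<bar>expect_unif Om (\<lambda>G. inS k i j G * of_bool ((a,l) \<in> G) / cS i j G) - lam / real n\<bar> \<le> 2 * L ^ 16 * r / real n ^ 2"
proof -
  let ?E = "expect_unif Om (\<lambda>G. inS k i j G * of_bool ((a,l) \<in> G))"
  let ?M = "Mv q1 i j" and ?Q = "Qv q1 i j k"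
  have kn: "k < n" and kl: "k \<noteq> l" using k a by (auto simp: free_def)
  have N0: "0 < real n" using n_pos by simp
  have 1: "\<bar>expect_unif Om (\<lambda>G. inS k i j G * of_bool ((a,l) \<in> G) / cS i j G) - ?E / ?M\<bar> \<le> L ^ 16 * r / real n ^ 2"
  proof -
    have "\<bar>expect_unif Om (\<lambda>G. inS k i j G * of_bool ((a,l) \<in> G) / cS i j G) - ?E / ?M\<bar> \<le> L ^ 4 * (L ^ 12 / real n) * r / real n"
      by (rule expect_inS_inv_weighted[OF quasi1[OF L4] ij k Mv_q1_ge2[OF ij(2,3)]]) auto
    also have "\<dots> = L ^ 16 * r / real n ^ 2" by (simp add: power2_eq_square power_add[symmetric])
    finally show ?thesis .
  qed
  have "\<bar>expect_unif Om (\<lambda>G. of_bool ((a,l) \<in> G) * inS k i j G) - ?Q * P (a,l)\<bar> \<le> 6 * (L ^ 12 / real n)"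
    using a kl by (intro expect_inS_arc[OF quasi1[OF L4] ij k]) auto
  then have 2: "\<bar>?E - ?Q * P (a,l)\<bar> \<le> 6 * (L ^ 12 / real n)" by (simp only: mult.commute)
  have "\<bar>?Q * (P (a,l) - lam)\<bar> \<le> 1 * (L ^ 3 / r)"
    unfolding abs_mult using Qv_q1_bounds[OF ij(2,3) kn] P_approx0[OF a(1,2,3)] by (intro mult_mono) auto
  then have 3: "\<bar>?Q * P (a,l) - ?Q * lam\<bar> \<le> L ^ 3 / r" by (simp add: right_diff_distrib)
  have "L ^ 12 / real n \<le> L ^ 3 / r"
  proof -
    have "L ^ 12 = L ^ 3 * L ^ 9" by (simp flip: power_add)
    also have "\<dots> \<le> L ^ 3 * r" using r_ge_pow[of 9] L_pos by (intro mult_left_mono) auto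
    finally have "L ^ 12 / real n \<le> L ^ 3 * r / real n" by (intro divide_right_mono) auto
    then show ?thesis using r_pos by (simp add: n_eq)
  qed
  then have 4: "\<bar>?E - ?Q * lam\<bar> \<le> 7 * (L ^ 3 / r)" using 2 3 by linarith
  have M0: "0 < ?M" and iM: "1 / ?M \<le> L / real n"
  proof -
    have p: "0 < real n / L" using N0 L_pos by simp
    then show "0 < ?M" using Mv_q1_ge[OF ij(2,3)] by linarith
    then have "1 / ?M \<le> 1 / (real n / L)" using Mv_q1_ge[OF ij(2,3)] p by (intro divide_left_mono mult_pos_pos) auto
    then show "1 / ?M \<le> L / real n" by simp
  qed
  have 5: "\<bar>?E / ?M - lam * (?Q / ?M)\<bar> \<le> 7 * L ^ 4 * r / real n ^ 2"
  proof -
    have "?E / ?M - lam * (?Q / ?M) = (?E - ?Q * lam) * (1 / ?M)" by (simp add: diff_divide_distrib mult.commute)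
    also have "\<bar>\<dots>\<bar> \<le> 7 * (L ^ 3 / r) * (L / real n)"
      unfolding abs_mult[of "?E - ?Q * lam"] using 4 iM M0 L_pos r_pos by (intro mult_mono) auto
    also have "\<dots> = 7 * L ^ 4 * r / real n ^ 2" using r_pos by (simp add: n_eq field_simps power_numeral_reduce)
    finally show ?thesis .
  qed
  have "\<bar>lam * (?Q / ?M - 1 / real n)\<bar> \<le> 1 * (2 * L\<^sup>2 * r / real n ^ 2)"
    unfolding abs_mult[of lam] using lam_bounds ratio_q1_crude[OF ij(2,3) kn] by (intro mult_mono) auto
  then have 6: "\<bar>lam * (?Q / ?M) - lam / real n\<bar> \<le> 2 * L\<^sup>2 * r / real n ^ 2" by (simp add: right_diff_distrib)
  have "L ^ 16 * r / real n ^ 2 + 7 * L ^ 4 * r / real n ^ 2 + 2 * L\<^sup>2 * r / real n ^ 2 = (L ^ 16 + 7 * L ^ 4 + 2 * L\<^sup>2) * (r / real n ^ 2)"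
    by (simp add: algebra_simps)
  also have "\<dots> \<le> (2 * L ^ 16) * (r / real n ^ 2)"
  proof (rule mult_right_mono)
    have "L\<^sup>2 \<le> L ^ 4" using power_increasing[of 2 4 L] L_ge by simp
    then have "7 * L ^ 4 + 2 * L\<^sup>2 \<le> 100 * L ^ 4" using zero_le_power[of L 4] L_pos by linarith
    also have "\<dots> \<le> L * L ^ 4" using L_ge by (intro mult_right_mono) auto
    also have "\<dots> = L ^ 5" by (simp add: power_numeral_reduce)
    also have "\<dots> \<le> L ^ 16" using L_ge by (intro power_increasing) auto
    finally show "L ^ 16 + 7 * L ^ 4 + 2 * L\<^sup>2 \<le> 2 * L ^ 16" by linarith
  qed (use r_pos in simp)
  finally have 7: "L ^ 16 * r / real n ^ 2 + 7 * L ^ 4 * r / real n ^ 2 + 2 * L\<^sup>2 * r / real n ^ 2 \<le> 2 * L ^ 16 * r / real n ^ 2" by simp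
  have "\<bar>x - w\<bar> \<le> d" if "\<bar>x - y\<bar> \<le> a" "\<bar>y - z\<bar> \<le> b" "\<bar>z - w\<bar> \<le> c" "a + b + c \<le> d" for x y z w a b c d :: real
    using that by linarith
  from this[OF 1 5 6 7] show ?thesis .
qed

text \<open>At this precision the arcs opposite forbidden cells are evaluated: each contributes
  \<open>lam / n\<close> in the mean. Columns forbidden in both rows cancel from the two counts,
  which leaves the difference of the out-degrees of \<open>F\<close>.\<close>

lemma row_diff_approx2:
  assumes ij: "i \<noteq> j" "i < n" "j < n" and k: "k < n" "(i,k) \<notin> F" "(j,k) \<notin> F"
  shows "\<bar>P (i,k) - P (j,k) - ((real (s i) - real (s j)) * (1 / real n + cc * ta k / real n ^ 2)
     + lam * (real (outdeg F i) - real (outdeg F j)) / real n)\<bar> \<le> 5 * L ^ 18 * r / real n ^ 2"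
proof -
  let ?e = "expect_unif Om (\<lambda>G. inS k i j G / cS i j G)"
  let ?x = "\<lambda>a l. expect_unif Om (\<lambda>G. inS k i j G * of_bool ((a,l) \<in> G) / cS i j G)"
  let ?J = "{l. (j,l) \<in> F \<and> (i,l) \<notin> F}" and ?I = "{l. (i,l) \<in> F \<and> (j,l) \<notin> F}"
  let ?d = "2 * L ^ 16 * r / real n ^ 2"
  have kf: "k \<in> free i j" using k by (auto simp: free_def)
  have d0: "0 \<le> ?d" using L_pos r_pos by simp
  have sm: "\<bar>(\<Sum>l\<in>{l. (b,l) \<in> F \<and> (a,l) \<notin> F}. ?x a l) - real (card {l. (b,l) \<in> F \<and> (a,l) \<notin> F}) * (lam / real n)\<bar> \<le> L * ?d"
    if ab: "a < n" "b < n" "{a,b} = {i,j}" for a b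
  proof -
    let ?B = "{l. (b,l) \<in> F \<and> (a,l) \<notin> F}"
    have "\<bar>(\<Sum>l\<in>?B. ?x a l) - real (card ?B) * (lam / real n)\<bar> = \<bar>\<Sum>l\<in>?B. ?x a l - lam / real n\<bar>" by (simp add: sum_subtractf)
    also have "\<dots> \<le> (\<Sum>l\<in>?B. \<bar>?x a l - lam / real n\<bar>)" by (rule sum_abs)
    also have "\<dots> \<le> (\<Sum>l\<in>?B. ?d)"
    proof (rule sum_mono)
      fix l assume l: "l \<in> ?B"
      then have "l < n" using F_sub by auto
      moreover have "l \<notin> free i j" using l ab(3) by (auto simp: free_def doubleton_eq_iff)
      ultimately show "\<bar>?x a l - lam / real n\<bar> \<le> ?d" using l ab by (intro expect_inS_arc_inv1[OF ij kf]) auto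
    qed
    also have "\<dots> = real (card ?B) * ?d" by simp
    also have "\<dots> \<le> L * ?d" using card_forbidden_row[OF ab(2)] d0 by (intro mult_right_mono) auto
    finally show ?thesis .
  qed
  have cd: "real (card ?I) - real (card ?J) = real (outdeg F i) - real (outdeg F j)"
  proof -
    have "outdeg F a = card {l. (a,l) \<in> F \<and> (b,l) \<notin> F} + card {l. (a,l) \<in> F \<and> (b,l) \<in> F}" for a b
    proof -
      have f: "finite {l. (a,l) \<in> F \<and> Z l}" for Z by (rule finite_subset[OF _ finite_out[OF finite_F, of a]]) auto
      have "{l. (a,l) \<in> F} = {l. (a,l) \<in> F \<and> (b,l) \<notin> F} \<union> {l. (a,l) \<in> F \<and> (b,l) \<in> F}" by auto
      then have "card {l. (a,l) \<in> F} = card ({l. (a,l) \<in> F \<and> (b,l) \<notin> F} \<union> {l. (a,l) \<in> F \<and> (b,l) \<in> F})" by (rule arg_cong)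
      also have "\<dots> = card {l. (a,l) \<in> F \<and> (b,l) \<notin> F} + card {l. (a,l) \<in> F \<and> (b,l) \<in> F}"
        by (rule card_Un_disjoint[OF f f]) auto
      finally show ?thesis by (simp add: outdeg_def)
    qed
    note * = this
    have "{l. (j,l) \<in> F \<and> (i,l) \<in> F} = {l. (i,l) \<in> F \<and> (j,l) \<in> F}" by auto
    then show ?thesis using *[of i j] *[of j i] by simp
  qed
  have e: "\<bar>(real (s i) - real (s j)) * (?e - (1 / real n + cc * ta k / real n ^ 2))\<bar> \<le> 2 * L * r * (2 * L ^ 17 / real n ^ 2)"
    unfolding abs_mult[of "real (s i) - real (s j)"]
    using s_diff[OF ij(2,3)] expect_inS_inv1[OF ij kf] L_pos r_pos by (intro mult_mono) auto
  have A: "\<bar>(\<Sum>l\<in>?J. ?x i l) - real (card ?J) * (lam / real n)\<bar> \<le> L * ?d" using ij by (intro sm) auto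
  have B: "\<bar>(\<Sum>l\<in>?I. ?x j l) - real (card ?I) * (lam / real n)\<bar> \<le> L * ?d" using ij by (intro sm) auto
  have cdl: "real (card ?I) * (lam / real n) - real (card ?J) * (lam / real n) = lam * (real (outdeg F i) - real (outdeg F j)) / real n"
    unfolding cd[symmetric] by (simp add: algebra_simps diff_divide_distrib)
  have gen: "\<bar>S * e - A + B - (S * e0 + w)\<bar> \<le> E1 + 2 * E2"
    if "\<bar>S * (e - e0)\<bar> \<le> E1" "\<bar>A - a\<bar> \<le> E2" "\<bar>B - b\<bar> \<le> E2" "b - a = w" for S e e0 A B a b w E1 E2 :: real
    using that by (simp add: right_diff_distrib)
  have "\<bar>P (i,k) - P (j,k) - ((real (s i) - real (s j)) * (1 / real n + cc * ta k / real n ^ 2)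
     + lam * (real (outdeg F i) - real (outdeg F j)) / real n)\<bar> \<le> 2 * L * r * (2 * L ^ 17 / real n ^ 2) + 2 * (L * ?d)"
    unfolding row_diff_split[OF ij k] by (rule gen[OF e A B cdl])
  also have "\<dots> = (4 * L ^ 18 + 4 * L ^ 17) * (r / real n ^ 2)"
    using n_pos by (simp add: field_simps power_numeral_reduce)
  also have "\<dots> \<le> (5 * L ^ 18) * (r / real n ^ 2)"
  proof (rule mult_right_mono)
    have "4 * L ^ 17 \<le> L * L ^ 17" using L_ge by (intro mult_right_mono) auto
    then show "4 * L ^ 18 + 4 * L ^ 17 \<le> 5 * L ^ 18" by (simp add: power_numeral_reduce)
  qed (use r_pos in simp)
  finally show ?thesis by simp
qed

end

text \<open>Two terms are added to the additive model. One is the interaction of row and column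
  deviations. The other compensates for forbidden cells: the mass \<open>lam\<close> that each would
  have carried is spread over its row and its column, and \<open>card F / n\<close> corrects the
  total.\<close>

definition q2 :: "nat \<times> nat \<Rightarrow> real" where
  "q2 e = (case e of (i,k) \<Rightarrow> lam + (sg i + ta k - om) / real n + cc * sg i * ta k / real n ^ 2
     + lam * (real (outdeg F i) + real (indeg F k) - real (card F) / real n) / real n)"

lemma P_approx2:
  assumes L4: "(4 * L) ^ 20 \<le> real n" and ik: "i < n" "k < n" "(i,k) \<notin> F"
  shows "\<bar>P (i,k) - q2 (i,k)\<bar> \<le> L ^ 19 / (real n * r)"
proof -
  define h where "h = 1 / real n + cc * ta k / real n ^ 2"
  define a where "a j = (real (s i) - real (s j)) * h + lam * (real (outdeg F i) - real (outdeg F j)) / real n" for j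
  have n0: "0 < real n" using n_pos by simp
  have ct: "\<bar>cc * ta k\<bar> \<le> L * (L * r)" unfolding abs_mult[of cc] using cc_bound t_near[OF ik(2)] L_pos by (intro mult_mono) auto
  have hb: "\<bar>h\<bar> \<le> 2 / real n"
  proof -
    have "L * L \<le> r" using r_ge_pow[of 2] by (simp add: power2_eq_square)
    then have "L * L * r \<le> real n" unfolding n_eq using r_pos by (intro mult_right_mono) auto
    then have "\<bar>cc * ta k\<bar> \<le> real n" using ct by (simp add: mult.assoc)
    then have "\<bar>cc * ta k / real n ^ 2\<bar> \<le> real n / real n ^ 2" 
      using divide_right_mono[of "\<bar>cc * ta k\<bar>" "real n" "real n ^ 2"] by (simp only: abs_divide abs_power2 zero_le_power2)
    then have "\<bar>cc * ta k / real n ^ 2\<bar> \<le> 1 / real n" using n0 by (simp add: power2_eq_square)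
    moreover have "0 \<le> 1 / real n" by simp
    ultimately have "\<bar>h\<bar> \<le> 1 / real n + 1 / real n" unfolding h_def by linarith
    then show ?thesis by simp
  qed
  have "\<bar>real n * P (i,k) - real (t k) - real (indeg F k) * P (i,k) - (\<Sum>j<n. a j)\<bar> \<le> real n * (5 * L ^ 18 * r / real n ^ 2) + L * (5 * L / r)"
  proof (rule P_from_row_diffs[OF ik])
    show "\<bar>P (i,k) - P (j,k) - a j\<bar> \<le> 5 * L ^ 18 * r / real n ^ 2" if "j < n" "j \<noteq> i" "(j,k) \<notin> F" for j
      unfolding a_def h_def using row_diff_approx2[OF L4 _ ik(1) that(1) ik(2,3) that(3)] that by auto
    show "\<bar>a j\<bar> \<le> 5 * L / r" if "j < n" for j
    proof -
      have "\<bar>(real (s i) - real (s j)) * h\<bar> \<le> (2 * L * r) * (2 / real n)"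
        unfolding abs_mult using s_diff[OF ik(1) that] hb L_pos r_pos by (intro mult_mono) auto
      also have "\<dots> = 4 * L / r" using r_pos by (simp add: n_eq)
      finally have 1: "\<bar>(real (s i) - real (s j)) * h\<bar> \<le> 4 * L / r" .
      have "\<bar>real (outdeg F i) - real (outdeg F j)\<bar> \<le> L" using F_out[OF ik(1)] F_out[OF that] by linarith
      then have "lam * \<bar>real (outdeg F i) - real (outdeg F j)\<bar> \<le> 1 * L" using lam_bounds by (intro mult_mono) auto
      then have "\<bar>lam * (real (outdeg F i) - real (outdeg F j)) / real n\<bar> \<le> L / real n"
        using lam_bounds by (simp add: abs_mult abs_divide divide_right_mono)
      also have "\<dots> \<le> L / r"
      proof (rule divide_left_mono)
        show "r \<le> real n" unfolding n_eq using r_ge_100 by simp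
      qed (use L_pos r_pos n0 in auto)
      finally have 2: "\<bar>lam * (real (outdeg F i) - real (outdeg F j)) / real n\<bar> \<le> L / r" .
      have "5 * L / r = 4 * L / r + L / r" by (simp add: add_divide_distrib[symmetric])
      then show ?thesis unfolding a_def using 1 2 by linarith
    qed
  qed (use L_pos r_pos in \<open>auto simp: a_def\<close>)
  moreover have "real n * (5 * L ^ 18 * r / real n ^ 2) = 5 * L ^ 18 / r" using r_pos by (simp add: n_eq power2_eq_square)
  moreover have "L * (5 * L / r) = 5 * L\<^sup>2 / r" by (simp add: power2_eq_square)
  ultimately have 1: "\<bar>real n * P (i,k) - real (t k) - real (indeg F k) * P (i,k) - (\<Sum>j<n. a j)\<bar> \<le> 5 * L ^ 18 / r + 5 * L\<^sup>2 / r" by (simp only:)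
  have sa: "(\<Sum>j<n. a j) = real n * (sg i - om) * h + lam * (real (outdeg F i) - real (card F) / real n)"
  proof -
    have A1: "(\<Sum>j<n. real (s i) - real (s j)) = real n * (sg i - om)"
      using n0 by (simp add: sum_subtractf om_def field_simps power2_eq_square)
    have A2: "(\<Sum>j<n. real (outdeg F i) - real (outdeg F j)) = real n * real (outdeg F i) - real (card F)"
      using sum_outdeg[OF F_sub] by (simp add: sum_subtractf flip: of_nat_sum)
    have A3: "(\<Sum>j<n. a j) = (\<Sum>j<n. real (s i) - real (s j)) * h + lam * (\<Sum>j<n. real (outdeg F i) - real (outdeg F j)) / real n"
      unfolding a_def by (simp only: sum.distrib sum_distrib_left sum_distrib_right sum_divide_distrib)
    have "lam * (real n * x - y) / real n = lam * (x - y / real n)" for x y using n0 by (simp add: field_simps)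
    then show ?thesis unfolding A3 A1 A2 by simp
  qed
  \<comment> \<open>\<open>P_from_row_diffs\<close> leaves \<open>P (i,k)\<close> itself multiplied
    by the number of forbidden cells of the column; there the first approximation by
    \<open>lam\<close> is accurate enough.\<close>
  have "real n * (P (i,k) - q2 (i,k)) = (real n * P (i,k) - real (t k) - real (indeg F k) * P (i,k) - (\<Sum>j<n. a j))
      + real (indeg F k) * (P (i,k) - lam) - cc * ta k * om / real n"
  proof -
    have "N * (p - (l + (S + ta' - w) / N + c * S * ta' / N ^ 2 + l * (f + g - e / N) / N))
      = (N * p - tk - g * p - (N * (S - w) * (1 / N + c * ta' / N ^ 2) + l * (f - e / N))) + g * (p - l) - c * ta' * w / N"
      if "N > 0" "tk = l * N + ta'" for N p l S ta' w c f g e tk :: real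
      using that by (simp add: field_simps power2_eq_square)
    note gen = this
    show ?thesis unfolding sa h_def q2_def prod.case by (rule gen[OF n0]) simp
  qed
  moreover have "\<bar>real (indeg F k) * (P (i,k) - lam)\<bar> \<le> L * (L ^ 3 / r)"
    unfolding abs_mult using F_in[OF ik(2)] P_approx0[OF ik] L_pos by (intro mult_mono) auto
  moreover have "\<bar>cc * ta k * om / real n\<bar> \<le> L ^ 3 / r"
  proof -
    have "\<bar>cc * ta k\<bar> * \<bar>om\<bar> \<le> (L * (L * r)) * L" using ct om_bound L_pos r_pos by (intro mult_mono) auto
    then have "\<bar>cc * ta k * om / real n\<bar> \<le> (L * (L * r)) * L / real n"
      using divide_right_mono[of "\<bar>cc * ta k\<bar> * \<bar>om\<bar>" "L * (L * r) * L" "real n"]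
      by (simp only: abs_divide abs_mult[of "cc * ta k"] abs_of_nat of_nat_0_le_iff)
    also have "\<dots> = L ^ 3 / r" using r_pos by (simp add: n_eq power3_eq_cube)
    finally show ?thesis .
  qed
  ultimately have "\<bar>real n * (P (i,k) - q2 (i,k))\<bar> \<le> 5 * L ^ 18 / r + 5 * L\<^sup>2 / r + L * (L ^ 3 / r) + L ^ 3 / r"
    using 1 by linarith
  also have "\<dots> = (5 * L ^ 18 + 5 * L\<^sup>2 + L ^ 4 + L ^ 3) / r" by (simp add: add_divide_distrib power_numeral_reduce)
  also have "\<dots> \<le> L ^ 19 / r"
  proof (rule divide_right_mono)
    have "L\<^sup>2 \<le> L ^ 18" "L ^ 3 \<le> L ^ 18" "L ^ 4 \<le> L ^ 18" using L_ge by (intro power_increasing; simp)+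
    then have "5 * L ^ 18 + 5 * L\<^sup>2 + L ^ 4 + L ^ 3 \<le> 12 * L ^ 18" by linarith
    also have "\<dots> \<le> L * L ^ 18" using L_ge by (intro mult_right_mono) auto
    finally show "5 * L ^ 18 + 5 * L\<^sup>2 + L ^ 4 + L ^ 3 \<le> L ^ 19" by (simp add: power_numeral_reduce)
  qed (use r_pos in simp)
  finally have "real n * \<bar>P (i,k) - q2 (i,k)\<bar> \<le> L ^ 19 / r" by (simp add: abs_mult)
  then show ?thesis using n0 r_pos by (simp add: field_simps)
qed

end

section \<open>Existence\<close>

text \<open>The values of \<open>f\<close> are some c and c + 1; the units go to the elements of
  value c first.\<close>

lemma balanced_increment:
  fixes f :: "'a \<Rightarrow> nat"
  assumes A: "finite A" and bal: "\<And>i j. i \<in> A \<Longrightarrow> j \<in> A \<Longrightarrow> f i \<le> f j + 1" and u: "u \<le> card A"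
  shows "\<exists>R\<subseteq>A. card R = u \<and> (\<forall>i\<in>A. \<forall>j\<in>A. f i + of_bool (i \<in> R) \<le> f j + of_bool (j \<in> R) + 1)"
proof (cases "A = {}")
  case True
  then show ?thesis using u by auto
next
  case False
  define c where "c = Min (f ` A)"
  define B where "B = {i\<in>A. f i = c}"
  have "c \<in> f ` A" unfolding c_def using A False by (intro Min_in) auto
  then obtain i0 where i0: "i0 \<in> A" "f i0 = c" by auto
  have lo: "c \<le> f i" if "i \<in> A" for i unfolding c_def using A that by simp
  have hi: "f i \<le> c + 1" if "i \<in> A" for i using bal[OF that i0(1)] i0 by simp
  have fB: "finite B" "B \<subseteq> A" using A by (auto simp: B_def)
  have two: "f i = c \<or> f i = c + 1" if "i \<in> A" for i using lo[OF that] hi[OF that] by linarith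
  show ?thesis
  proof (cases "u \<le> card B")
    case True
    then obtain R where R: "R \<subseteq> B" "card R = u" by (meson obtain_subset_with_card_n)
    moreover have "f i + of_bool (i \<in> R) \<le> f j + of_bool (j \<in> R) + 1" if "i \<in> A" "j \<in> A" for i j
      using R two[OF that(1)] lo[OF that(2)] by (auto simp: B_def)
    ultimately show ?thesis using fB by blast
  next
    case False
    then obtain R where R: "B \<subseteq> R" "R \<subseteq> A" "card R = u" using u fB A exists_subset_between[of B u A] by auto
    moreover have "f i + of_bool (i \<in> R) \<le> f j + of_bool (j \<in> R) + 1" if "i \<in> A" "j \<in> A" for i j
    proof -
      have "j \<in> R \<or> f j = c + 1" using two[OF that(2)] R(1) that(2) by (auto simp: B_def)
      then have "c + 1 \<le> f j + of_bool (j \<in> R)" using lo[OF that(2)] by auto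
      moreover have "f i + of_bool (i \<in> R) \<le> c + 2" using hi[OF that(1)] by auto
      ultimately show ?thesis by linarith
    qed
    ultimately show ?thesis by blast
  qed
qed

text \<open>Columns are filled one at a time, each in the rows with fewest ones so far. The result
  has the right column sums and serves as the start of a walk towards the prescribed row
  sums.\<close>

lemma balanced_rows_exist:
  fixes t :: "nat \<Rightarrow> nat"
  assumes t: "\<And>k. k < m \<Longrightarrow> t k \<le> n"
  shows "\<exists>G \<subseteq> {..<n} \<times> {..<m}. (\<forall>k<m. indeg G k = t k) \<and> (\<forall>i<n. \<forall>j<n. outdeg G i \<le> outdeg G j + 1)"
  using t
proof (induction m)
  case 0
  then show ?case by (intro exI[of _ "{}"]) (auto simp: outdeg_def)
next
  case (Suc m)
  then obtain G where G: "G \<subseteq> {..<n} \<times> {..<m}" "\<And>k. k < m \<Longrightarrow> indeg G k = t k"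
    "\<And>i j. i < n \<Longrightarrow> j < n \<Longrightarrow> outdeg G i \<le> outdeg G j + 1" by (meson less_Suc_eq)
  have fG: "finite G" by (rule finite_subset[OF G(1)]) simp
  obtain R where R: "R \<subseteq> {..<n}" "card R = t m"
    "\<forall>i\<in>{..<n}. \<forall>j\<in>{..<n}. outdeg G i + of_bool (i \<in> R) \<le> outdeg G j + of_bool (j \<in> R) + 1"
    using balanced_increment[of "{..<n}" "outdeg G" "t m"] G(3) Suc.prems[of m] by auto
  have fR: "finite R" using R(1) finite_subset by blast
  let ?E = "R \<times> {m}"
  have dj: "?E \<inter> G = {}" using G(1) by auto
  have o: "outdeg ?E i = of_bool (i \<in> R)" for i
    by (cases "i \<in> R") (auto simp: outdeg_def)
  have i: "indeg ?E k = (if k = m then card R else 0)" for k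
    by (cases "k = m") (auto simp: indeg_def)
  have Gm: "indeg G m = 0" using G(1) by (auto simp: indeg_def intro!: card_eq_0_iff[THEN iffD2])
  show ?case
  proof (intro exI[of _ "G \<union> ?E"] conjI allI impI)
    show "G \<union> ?E \<subseteq> {..<n} \<times> {..<Suc m}" using G(1) R(1) by auto
    show "indeg (G \<union> ?E) k = t k" if "k < Suc m" for k
      using that indeg_Un[OF dj fG] fR i G(2)[of k] Gm R(2) by (cases "k = m") auto
    show "outdeg (G \<union> ?E) a \<le> outdeg (G \<union> ?E) b + 1" if "a < n" "b < n" for a b
      using that outdeg_Un[OF dj fG] fR o R(3) by auto
  qed
qed

lemma biadj_cong: "(\<And>v. v < n \<Longrightarrow> s v = s' v) \<Longrightarrow> biadj n s t F = biadj n s' t F"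
  unfolding biadj_def by auto

section \<open>Walking between sequences of row sums\<close>

context near_regular
begin

lemma change_F:
  assumes "F' \<subseteq> {..<n} \<times> {..<n}" "\<And>v. v < n \<Longrightarrow> outdeg F' v \<le> 1 \<and> indeg F' v \<le> 1"
  shows "near_regular n L lam s t F'"
proof
  show "real (outdeg F' v) \<le> L" "real (indeg F' v) \<le> L" if "v < n" for v
    using assms(2)[OF that] L_ge by linarith+
qed (fact L_ge L_pow n_large lam_var s_near t_near sum_st sum_near assms(1))+

lemma big_gap: "4 * (L * r) \<le> real n / (16 * L)" "4 * (L * r) \<le> real n / L"
proof -
  have "100 * L ^ 2 \<le> r" by (rule r_ge_const) simp
  then have "r * (100 * L ^ 2) \<le> r * r" using r_pos by (intro mult_left_mono) auto
  then have *: "100 * (L * r) \<le> real n / L" using L_pos by (simp add: n_eq field_simps power2_eq_square)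
  have "0 \<le> L * r" using L_pos r_pos by simp
  then show "4 * (L * r) \<le> real n / L" using * by linarith
  have "real n / (16 * L) = real n / L / 16" by simp
  then show "4 * (L * r) \<le> real n / (16 * L)" using * \<open>0 \<le> L * r\<close> by linarith
qed

end

context near_regular_ne
begin

text \<open>By the tail bound some matrix has the two rows differing in at least
  \<open>n / (16 * L)\<close> columns, while the two one-sided counts differ by at most
  \<open>3 * L * r\<close>; so neither side can be empty.\<close>

lemma exists_movable:
  assumes ij: "i \<noteq> j" "i < n" "j < n"
  shows "\<exists>G\<in>Om. excl n F i j G \<noteq> {}"
proof -
  have n1: "1 < real n ^ 3"
  proof -
    have "r * 1 < r * r" using r_ge_100 by (intro mult_strict_left_mono) auto
    then have "1 < real n" unfolding n_eq using r_ge_100 by linarith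
    then show ?thesis by simp
  qed
  have "\<not> (\<forall>G\<in>Om. cS i j G < real n / (16 * L))"
  proof
    assume "\<forall>G\<in>Om. cS i j G < real n / (16 * L)"
    then have "expect_unif Om (bad i j) = expect_unif Om (\<lambda>G. 1)" by (intro expect_unif_cong) auto
    then have "expect_unif Om (bad i j) = 1" using Om_ne by (simp add: expect_unif_const)
    moreover have "1 / real n ^ 3 < 1" using n1 divide_less_eq_1_pos[of "real n ^ 3" 1] by linarith
    ultimately show False using expect_bad[OF ij] by linarith
  qed
  then obtain G where G: "G \<in> Om" "real n / (16 * L) \<le> cS i j G" by force
  have "excl n F i j G \<noteq> {}"
  proof
    assume "excl n F i j G = {}"
    then have "cS i j G = - mdiff i j G" by (simp add: card_sdiff)
    then have "cS i j G \<le> 3 * L * r" using mdiff_bounds(2)[OF G(1) ij(2,3)] by linarith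
    moreover have "0 < L * r" using L_pos r_pos by simp
    ultimately show False using G(2) big_gap(1) by linarith
  qed
  then show ?thesis using G(1) by blast
qed

text \<open>An arc moved within its column from row \<open>i\<close> to row \<open>j\<close> leaves
  the column sums alone; \<open>exists_movable\<close> provides the column.\<close>

lemma move_unit:
  assumes ij: "i \<noteq> j" "i < n" "j < n"
  shows "biadj n (s(i := s i - 1, j := s j + 1)) t F \<noteq> {}"
proof -
  obtain G k where G: "G \<in> Om" and k: "k \<in> excl n F i j G" using exists_movable[OF ij] by auto
  have fG: "finite G" using G by (rule biadj_finite_graph)
  have kd: "k < n" "(j,k) \<notin> F" "(i,k) \<in> G" "(j,k) \<notin> G" using k by (auto simp: excl_def)
  define G' where "G' = (G - {(i,k)}) \<union> {(j,k)}"
  have dj: "{(j,k)} \<inter> (G - {(i,k)}) = {}" using kd by auto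
  have o1: "outdeg {(a,k)} v = of_bool (v = a)" for a v by (cases "v = a") (auto simp: outdeg_def)
  have i1: "indeg {(a,k)} v = of_bool (v = k)" for a v by (cases "v = k") (auto simp: indeg_def)
  have sub: "{(i,k)} \<subseteq> G" using kd by auto
  have "outdeg G' v = outdeg G v - of_bool (v = i) + of_bool (v = j)" for v
    unfolding G'_def using outdeg_Un[OF dj] outdeg_Diff[OF sub fG] fG o1 by simp
  moreover have "indeg G' v = indeg G v - of_bool (v = k) + of_bool (v = k)" for v
    unfolding G'_def using indeg_Un[OF dj] indeg_Diff[OF sub fG] fG i1 by simp
  moreover have "1 \<le> indeg G k"
  proof -
    have "indeg G k > 0" unfolding indeg_def card_gt_0_iff using kd finite_in[OF fG] by auto
    then show ?thesis by simp
  qed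
  ultimately have "G' \<in> biadj n (s(i := s i - 1, j := s j + 1)) t F"
    using G kd ij unfolding biadj_def G'_def by (auto split: if_splits)
  then show ?thesis by blast
qed

end

text \<open>\<open>m\<close> is the total excess of \<open>s0\<close> over \<open>s1\<close>. As the
  sums agree, there is a row in excess together with one in deficit, and moving a unit from the
  first to the second keeps every entry between the two sequences. The intermediate instances thus
  satisfy the same bounds, and \<open>move_unit\<close> applies throughout.\<close>

lemma walk_nonempty:
  assumes "near_regular n L lam s0 t F" "biadj n s0 t F \<noteq> {}" "near_regular n L lam s1 t F"
    "(\<Sum>v<n. s0 v - s1 v) = m"
  shows "biadj n s1 t F \<noteq> {}"
  using assms
proof (induction m arbitrary: s0)
  case 0
  interpret a: near_regular n L lam s0 t F by fact
  interpret b: near_regular n L lam s1 t F by fact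
  have le: "s0 v \<le> s1 v" if "v < n" for v using 0(4) that by simp
  have "s0 v = s1 v" if "v < n" for v
  proof (rule ccontr)
    assume "s0 v \<noteq> s1 v"
    then have "s0 v < s1 v" using le[OF that] by simp
    then have "(\<Sum>v<n. s0 v) < (\<Sum>v<n. s1 v)" using le that by (intro sum_strict_mono_ex1) auto
    then show False using a.sum_st b.sum_st by simp
  qed
  then show ?case using 0(2) biadj_cong[of n s0 s1 t F] by auto
next
  case (Suc m)
  interpret a: near_regular n L lam s0 t F by fact
  interpret b: near_regular n L lam s1 t F by fact
  interpret c: near_regular_ne n L lam s0 t F by unfold_locales (rule Suc.prems(2))
  obtain i where i: "i < n" "s1 i < s0 i"
  proof -
    have "\<exists>i\<in>{..<n}. s0 i - s1 i \<noteq> 0"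
    proof (rule ccontr)
      assume "\<not> (\<exists>i\<in>{..<n}. s0 i - s1 i \<noteq> 0)"
      then have "(\<Sum>v<n. s0 v - s1 v) = 0" by (intro sum.neutral) blast
      then show False using Suc.prems(4) by linarith
    qed
    then show ?thesis using that by auto
  qed
  obtain j where j: "j < n" "s0 j < s1 j"
  proof -
    have "\<exists>j<n. s0 j < s1 j"
    proof (rule ccontr)
      assume "\<not> (\<exists>j<n. s0 j < s1 j)"
      then have "\<forall>v\<in>{..<n}. s1 v \<le> s0 v" by (meson lessThan_iff not_less)
      then have "(\<Sum>v<n. s1 v) < (\<Sum>v<n. s0 v)" using i by (intro sum_strict_mono_ex1) auto
      then show False using a.sum_st b.sum_st by simp
    qed
    then show ?thesis using that by auto
  qed
  have ij: "i \<noteq> j" using i j by auto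
  define s2 where "s2 = s0(i := s0 i - 1, j := s0 j + 1)"
  have sum2: "(\<Sum>v<n. s2 v) = (\<Sum>v<n. s0 v)"
  proof -
    have "int (\<Sum>v<n. s2 v) = (\<Sum>v<n. int (s0 v) - of_bool (v = i) + of_bool (v = j))"
      unfolding of_nat_sum using i ij by (intro sum.cong) (auto simp: s2_def of_nat_diff)
    also have "\<dots> = int (\<Sum>v<n. s0 v)" using i j by (simp add: sum.distrib sum_subtractf of_bool_def)
    finally show ?thesis by linarith
  qed
  have n2: "near_regular n L lam s2 t F"
  proof
    show "\<bar>real (s2 v) - lam * real n\<bar> \<le> L * rt n" if "v < n" for v
    proof -
      have "min (s0 v) (s1 v) \<le> s2 v" "s2 v \<le> max (s0 v) (s1 v)" using i j ij by (auto simp: s2_def)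
      then have "min (real (s0 v)) (real (s1 v)) \<le> real (s2 v)" "real (s2 v) \<le> max (real (s0 v)) (real (s1 v))"
        by (simp_all add: min_def max_def split: if_splits)
      then show ?thesis using a.s_near[OF that] b.s_near[OF that] by (auto simp: min_def max_def split: if_splits)
    qed
    show "(\<Sum>v<n. s2 v) = (\<Sum>v<n. t v)" unfolding sum2 by (rule a.sum_st)
    show "\<bar>real (\<Sum>v<n. s2 v) - lam * (real n)\<^sup>2\<bar> \<le> L * real n" unfolding sum2 by (rule a.sum_near)
  qed (use a.L_ge a.L_pow a.n_large a.lam_var a.t_near a.F_sub a.F_out a.F_in in auto)
  have "(\<Sum>v<n. s2 v - s1 v) + 1 = (\<Sum>v<n. (s2 v - s1 v) + of_bool (v = i))" using i by (simp add: sum.distrib of_bool_def)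
  also have "\<dots> = (\<Sum>v<n. s0 v - s1 v)" using i j ij by (intro sum.cong) (auto simp: s2_def)
  finally have "(\<Sum>v<n. s2 v - s1 v) = m" using Suc.prems(4) by simp
  moreover have "biadj n s2 t F \<noteq> {}" unfolding s2_def by (rule c.move_unit[OF ij i(1) j(1)])
  ultimately show ?case using Suc.IH[OF n2] Suc.prems(3) by blast
qed

context near_regular
begin

text \<open>In the balanced matrix every row sum is within 1 of the mean, hence within
  \<open>L + 1\<close> of \<open>lam * n\<close>, so it is a legitimate start of the walk.\<close>

lemma nonempty_no_forbidden: "biadj n s t {} \<noteq> {}"
proof -
  have t_le: "t k \<le> n" if "k < n" for k
  proof -
    have "1 / L * real n \<le> (1 - lam) * real n" by (intro mult_right_mono lam_bounds) auto
    moreover have "0 \<le> L * r" using L_pos r_pos by simp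
    ultimately have "real (t k) \<le> real n" using t_near[OF that] big_gap(2) by (simp add: algebra_simps)
    then show ?thesis by simp
  qed
  obtain G where G: "G \<subseteq> {..<n} \<times> {..<n}" "\<And>k. k < n \<Longrightarrow> indeg G k = t k"
    "\<And>i j. i < n \<Longrightarrow> j < n \<Longrightarrow> outdeg G i \<le> outdeg G j + 1"
    using balanced_rows_exist[of n t n] t_le by meson
  have ne: "biadj n (outdeg G) t {} \<noteq> {}" using G by (auto simp: biadj_def)
  have sums: "(\<Sum>v<n. outdeg G v) = (\<Sum>v<n. t v)"
    using sum_outdeg[OF G(1)] sum_indeg[OF G(1)] G(2) by simp
  have e: "near_regular n L lam s t {}" by (rule change_F) (auto simp: outdeg_def indeg_def)
  have "near_regular n L lam (outdeg G) t {}"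
  proof
    show "\<bar>real (outdeg G v) - lam * real n\<bar> \<le> L * r" if v: "v < n" for v
    proof -
      have n0: "0 < real n" using n_pos by simp
      let ?S = "real (\<Sum>v<n. outdeg G v)"
      have "?S \<le> (\<Sum>u<n. real (outdeg G v) + 1)" unfolding of_nat_sum
      proof (rule sum_mono)
        fix u assume "u \<in> {..<n}"
        then have "real (outdeg G u) \<le> real (outdeg G v + 1)" using G(3)[of u v] v by (intro of_nat_mono) auto
        then show "real (outdeg G u) \<le> real (outdeg G v) + 1" by simp
      qed
      then have 1: "?S \<le> real n * (real (outdeg G v) + 1)" by simp
      have "(\<Sum>u<n. real (outdeg G v) - 1) \<le> ?S" unfolding of_nat_sum
      proof (rule sum_mono)
        fix u assume "u \<in> {..<n}"
        then have "real (outdeg G v) \<le> real (outdeg G u + 1)" using G(3)[of v u] v by (intro of_nat_mono) auto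
        then show "real (outdeg G v) - 1 \<le> real (outdeg G u)" by simp
      qed
      then have 2: "real n * (real (outdeg G v) - 1) \<le> ?S" by simp
      have 3: "\<bar>?S - lam * real n ^ 2\<bar> \<le> L * real n" unfolding sums sum_st[symmetric] by (rule sum_near)
      have "real n * (real (outdeg G v) - lam * real n) \<le> real n * (L + 1)" "- (real n * (L + 1)) \<le> real n * (real (outdeg G v) - lam * real n)"
        using 1 2 3 by (simp_all add: algebra_simps power2_eq_square abs_le_iff)
      then have "real n * \<bar>real (outdeg G v) - lam * real n\<bar> \<le> real n * (L + 1)"
        by (metis abs_le_iff abs_mult abs_of_nat minus_le_iff)
      then have "\<bar>real (outdeg G v) - lam * real n\<bar> \<le> L + 1" using n0 mult_le_cancel_left_pos by blast
      also have "\<dots> \<le> L * 2" using L_ge by simp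
      also have "\<dots> \<le> L * r" using L_pos r_ge_100 by (intro mult_left_mono) auto
      finally show ?thesis .
    qed
    show "(\<Sum>v<n. outdeg G v) = (\<Sum>v<n. t v)" by (rule sums)
    show "\<bar>real (\<Sum>v<n. outdeg G v) - lam * (real n)\<^sup>2\<bar> \<le> L * real n" unfolding sums sum_st[symmetric] by (rule sum_near)
  qed (use L_ge L_pow n_large lam_var t_near in \<open>auto simp: outdeg_def indeg_def\<close>)
  from walk_nonempty[OF this ne e refl] show ?thesis .
qed

lemma Id_on_deg: "outdeg (Id_on A) v = of_bool (v \<in> A)" "indeg (Id_on A) v = of_bool (v \<in> A)"
proof -
  have "{w. (v,w) \<in> Id_on A} = (if v \<in> A then {v} else {})" "{w. (w,v) \<in> Id_on A} = (if v \<in> A then {v} else {})" by auto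
  then show "outdeg (Id_on A) v = of_bool (v \<in> A)" "indeg (Id_on A) v = of_bool (v \<in> A)"
    unfolding outdeg_def indeg_def by auto
qed

text \<open>The diagonal cells are forbidden one after another. The first approximation puts the
  probability of the next loop below 1, so some matrix omits it.\<close>

lemma nonempty_loopless: "biadj n s t (Id_on {..<n}) \<noteq> {}"
proof -
  have "m \<le> n \<Longrightarrow> biadj n s t (Id_on {..<m}) \<noteq> {}" for m
  proof (induction m)
    case 0
    then show ?case using nonempty_no_forbidden by simp
  next
    case (Suc m)
    let ?F = "Id_on {..<m}"
    have "near_regular n L lam s t ?F" using Suc.prems by (intro change_F) (auto simp: Id_on_deg)
    then interpret a: near_regular_ne n L lam s t ?F
      using Suc by (intro near_regular_ne.intro) (auto simp: near_regular_ne_axioms_def)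
    have "L ^ 3 / r < 1 / L"
    proof -
      have "L ^ 4 < 100 * L ^ 4" using L_pos by simp
      also have "\<dots> \<le> r" by (rule r_ge_const) simp
      finally show ?thesis using r_pos L_pos by (simp add: field_simps power_numeral_reduce)
    qed
    moreover have "\<bar>a.P (m,m) - lam\<bar> \<le> L ^ 3 / r" using Suc.prems by (intro a.P_approx0) auto
    ultimately have lt: "a.P (m,m) < 1" using lam_bounds by linarith
    have "\<exists>G\<in>biadj n s t ?F. (m,m) \<notin> G"
    proof (rule ccontr)
      assume "\<not> (\<exists>G\<in>biadj n s t ?F. (m,m) \<notin> G)"
      then have "a.P (m,m) = expect_unif (biadj n s t ?F) (\<lambda>G. 1)"
        unfolding arc_prob_single by (intro expect_unif_cong) auto
      then show False using lt a.Om_ne by (simp add: expect_unif_const)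
    qed
    then obtain G where "G \<in> biadj n s t ?F" "(m,m) \<notin> G" by blast
    moreover have "Id_on {..<Suc m} = insert (m,m) ?F" by (auto simp: lessThan_Suc)
    ultimately have "G \<in> biadj n s t (Id_on {..<Suc m})" by (auto simp: biadj_def)
    then show ?case by blast
  qed
  then show ?thesis by simp
qed

end

section \<open>Probability of a given copy\<close>

text \<open>The difference has derivative u^2/(1 + u), at most 2*z^2 between 0 and \<open>z\<close>,
  and the mean value theorem gives the cubic bound.\<close>

lemma ln_one_plus_cubic:
  fixes z :: real
  assumes z: "\<bar>z\<bar> \<le> 1 / 2"
  shows "\<bar>ln (1 + z) - (z - z\<^sup>2 / 2)\<bar> \<le> 2 * \<bar>z\<bar> ^ 3"
proof -
  let ?f = "\<lambda>u::real. ln (1 + u) - (u - u\<^sup>2 / 2)"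
  let ?g = "\<lambda>u::real. u\<^sup>2 / (1 + u)"
  have d: "(?f has_real_derivative ?g u) (at u)" if "\<bar>u\<bar> \<le> 1 / 2" for u
  proof -
    have "u > - 1" using that by linarith
    then show ?thesis by (auto intro!: derivative_eq_intros simp: field_simps power2_eq_square)
  qed
  have g: "\<bar>?g u\<bar> \<le> 2 * z\<^sup>2" if "\<bar>u\<bar> \<le> \<bar>z\<bar>" for u
  proof -
    have "1 / 2 \<le> 1 + u" using that z by linarith
    then have "u\<^sup>2 / (1 + u) \<le> z\<^sup>2 / (1 / 2)" using that by (intro frac_le) (auto simp: abs_le_square_iff)
    moreover have "0 \<le> u\<^sup>2 / (1 + u)" using \<open>1 / 2 \<le> 1 + u\<close> by simp
    ultimately have "\<bar>?g u\<bar> = ?g u" "?g u \<le> 2 * z\<^sup>2" by (simp_all only: abs_of_nonneg) simp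
    then show ?thesis by linarith
  qed
  have "\<exists>u. \<bar>u\<bar> \<le> \<bar>z\<bar> \<and> ?f z = z * ?g u"
  proof (cases "z = 0")
    case True
    then show ?thesis by (intro exI[of _ 0]) simp
  next
    case False
    show ?thesis
    proof (cases "z > 0")
      case True
      have "\<exists>u>0. u < z \<and> ?f z - ?f 0 = (z - 0) * ?g u"
        using True z d by (intro MVT2) auto
      then show ?thesis using True by force
    next
      case F: False
      then have zn: "z < 0" using False by simp
      have "\<exists>u>z. u < 0 \<and> ?f 0 - ?f z = (0 - z) * ?g u"
        using zn z d by (intro MVT2) auto
      then obtain u where u: "z < u" "u < 0" "?f 0 - ?f z = (0 - z) * ?g u" by blast
      have "b = z * g" if "a - b = (0 - z) * g" "a = 0" for a b g :: real using that by simp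
      from this[OF u(3)] have "?f z = z * ?g u" by simp
      then show ?thesis using u(1,2) by (intro exI[of _ u]) auto
    qed
  qed
  then obtain u where u: "\<bar>u\<bar> \<le> \<bar>z\<bar>" "?f z = z * ?g u" by blast
  have "\<bar>z * ?g u\<bar> \<le> \<bar>z\<bar> * (2 * z\<^sup>2)" unfolding abs_mult[of z] by (intro mult_left_mono g u) auto
  also have "\<dots> = 2 * \<bar>z\<bar> ^ 3"
  proof -
    have zz: "z\<^sup>2 = \<bar>z\<bar> * \<bar>z\<bar>" by (simp add: power2_eq_square)
    have "a * (2 * (a * a)) = 2 * a ^ 3" for a :: real by (simp add: power3_eq_cube)
    then show ?thesis unfolding zz .
  qed
  finally show ?thesis unfolding u(2) .
qed

lemma sum_over_arcs_fst:
  fixes f :: "nat \<Rightarrow> real"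
  assumes "H \<subseteq> {..<n} \<times> {..<n}"
  shows "(\<Sum>(i,k)\<in>H. f i) = (\<Sum>v<n. real (outdeg H v) * f v)"
proof -
  have fH: "finite H" by (rule finite_subset[OF assms]) simp
  have "(\<Sum>(i,k)\<in>H. f i) = (\<Sum>(i,k)\<in>(SIGMA v:{..<n}. {w. (v,w) \<in> H}). f i)"
    using assms by (intro sum.cong) auto
  also have "\<dots> = (\<Sum>v<n. \<Sum>w\<in>{w. (v,w) \<in> H}. f v)"
    using fH by (subst sum.Sigma) (auto simp: finite_out)
  finally show ?thesis by (simp add: outdeg_def)
qed

lemma sum_over_arcs_snd:
  fixes f :: "nat \<Rightarrow> real"
  assumes "H \<subseteq> {..<n} \<times> {..<n}"
  shows "(\<Sum>(i,k)\<in>H. f k) = (\<Sum>v<n. real (indeg H v) * f v)"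
proof -
  have "(\<Sum>(i,k)\<in>H. f k) = (\<Sum>(i,k)\<in>H\<inverse>. f i)"
    by (rule sum.reindex_bij_witness[where i = prod.swap and j = prod.swap]) auto
  also have "\<dots> = (\<Sum>v<n. real (outdeg (H\<inverse>) v) * f v)"
    using assms by (intro sum_over_arcs_fst) auto
  finally show ?thesis by (simp add: indeg_converse)
qed

context near_regular_ne
begin

text \<open>Second-order expansion of the logarithm of \<open>q2 / lam\<close> when the diagonal is
  forbidden and \<open>om\<close> is 0. The leading 1/n is the effect of the missing loops: 1 for
  the row, 1 for the column, minus n/n for the total.\<close>

definition arc_gain :: "nat \<Rightarrow> nat \<Rightarrow> real" where
  "arc_gain i k = 1 / real n + (sg i + ta k) / (lam * real n) + cc * sg i * ta k / (lam * real n ^ 2)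
     - (sg i + ta k)\<^sup>2 / (2 * lam\<^sup>2 * real n ^ 2)"

text \<open>Let h, h' be the degrees of \<open>E\<close> at the ends of the new arc and m its size.
  Conditioning on \<open>E\<close> lowers the margins, which reduces the probability by about (h +
  h' - m/n)/n, and forbids cells, which raises it by \<open>lam\<close> times that amount; the
  factor \<open>1 - lam\<close> is the balance.\<close>

lemma arc_step:
  assumes FI: "F = Id_on {..<n}" and T: "T = lam * real n ^ 2" and L8: "(8 * L) ^ 20 \<le> real n"
    and E: "E \<subseteq> arcs_on n" and ik: "(i,k) \<in> arcs_on n" "(i,k) \<notin> E"
    and deg: "\<And>v. v < n \<Longrightarrow> real (outdeg E v) \<le> L \<and> real (indeg E v) \<le> L"
    and pos: "0 < arc_prob Om E"
  shows "0 < arc_prob Om (insert (i,k) E) \<and>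
    \<bar>ln (arc_prob Om (insert (i,k) E)) - ln (arc_prob Om E) - ln lam - (arc_gain i k
       - (1 - lam) / (lam * real n) * (real (outdeg E i) + real (indeg E k) - real (card E) / real n))\<bar>
    \<le> L ^ 25 / (real n * r)"
proof -
  have sub: "arcs_on n = {..<n} \<times> {..<n} - F" unfolding FI arcs_on_def by auto
  have E': "E \<subseteq> {..<n} \<times> {..<n} - F" using E sub by simp
  have fE: "finite E" by (rule finite_subset[OF E']) simp
  have in_n: "i < n" "k < n" "(i,k) \<notin> F" using ik(1) sub by auto
  have n0: "0 < real n" using n_pos by simp
  have "(2 * L) ^ 20 \<le> (8 * L) ^ 20" using L_pos by (intro power_mono) auto
  then have L2: "(2 * L) ^ 20 \<le> real n" using L8 by linarith
  have cond1: "near_regular n (2 * L) lam (\<lambda>v. s v - outdeg E v) (\<lambda>v. t v - indeg E v) (F \<union> E)"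
    by (rule conditioned(1)[OF L2 E']) (rule deg)
  have cond2: "outdeg E v \<le> s v \<and> indeg E v \<le> t v" if "v < n" for v
    by (rule conditioned(2)[OF L2 E' _ that]) (rule deg)
  let ?s = "\<lambda>v. s v - outdeg E v" and ?t = "\<lambda>v. t v - indeg E v"
  let ?S = "biadj n ?s ?t (F \<union> E)"
  have "?S \<noteq> {}" using arc_prob_eq_0[OF E' cond2] pos by auto
  then interpret c: near_regular_ne n "2 * L" lam ?s ?t "F \<union> E"
    using cond1 by (intro near_regular_ne.intro) (auto simp: near_regular_ne_axioms_def)
  define h h' m where "h = real (outdeg E i)" and "h' = real (indeg E k)" and "m = real (card E)"
  define p where "p = arc_prob ?S {(i,k)}"
  have ins: "arc_prob Om (insert (i,k) E) = arc_prob Om E * p"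
    unfolding p_def by (rule arc_prob_insert[OF E' ik(2) cond2])
  have hb: "0 \<le> h" "h \<le> L" "0 \<le> h'" "h' \<le> L" using deg[OF in_n(1)] deg[OF in_n(2)] by (auto simp: h_def h'_def)
  have mb: "0 \<le> m" "m \<le> real n * L"
  proof -
    have "real (\<Sum>v<n. outdeg E v) \<le> (\<Sum>v<n. L)" unfolding of_nat_sum by (rule sum_mono) (use deg in auto)
    moreover have "(\<Sum>v<n. outdeg E v) = card E" using E' by (intro sum_outdeg) auto
    ultimately show "m \<le> real n * L" by (simp add: m_def)
  qed (simp add: m_def)
  have dF: "outdeg F v = of_bool (v < n)" "indeg F v = of_bool (v < n)" for v unfolding FI Id_on_deg by simp_all
  have cF: "card F = n" using sum_outdeg[OF F_sub] dF by simp
  have dj: "E \<inter> F = {}" using E' by auto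
  have T': "real (\<Sum>v<n. s v - outdeg E v) = T - m"
  proof -
    have "(\<Sum>v<n. s v - outdeg E v) = (\<Sum>v<n. s v) - (\<Sum>v<n. outdeg E v)"
      using cond2 by (intro sum_subtractf_nat) auto
    moreover have "(\<Sum>v<n. outdeg E v) = card E" using E' by (intro sum_outdeg) auto
    moreover have "(\<Sum>v<n. outdeg E v) \<le> (\<Sum>v<n. s v)" using cond2 by (intro sum_mono) auto
    ultimately show ?thesis by (simp add: of_nat_diff m_def)
  qed
  have om': "c.om = - m / real n" unfolding c.om_def T' T by simp
  have sg': "c.sg i = sg i - h" using cond2[OF in_n(1)] by (simp add: of_nat_diff h_def)
  have ta': "c.ta k = ta k - h'" using cond2[OF in_n(2)] by (simp add: of_nat_diff h'_def)
  have oF: "real (outdeg (F \<union> E) i) = 1 + h" using outdeg_Un[OF dj finite_F fE] dF in_n by (simp add: h_def)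
  have iF: "real (indeg (F \<union> E) k) = 1 + h'" using indeg_Un[OF dj finite_F fE] dF in_n by (simp add: h'_def)
  have caF: "real (card (F \<union> E)) = real n + m" using card_Un_disjoint[OF finite_F fE] dj cF by (simp add: m_def Int_commute)
  have "\<bar>p - c.q2 (i,k)\<bar> \<le> (2 * L) ^ 19 / (real n * r)"
    unfolding p_def using L8 ik in_n by (intro c.P_approx2) auto
  moreover have "c.q2 (i,k) = lam + (sg i - h + (ta k - h') + m / real n) / real n + cc * (sg i - h) * (ta k - h') / real n ^ 2
     + lam * ((1 + h) + (1 + h') - (real n + m) / real n) / real n"
    unfolding c.q2_def prod.case om' sg' ta' oF iF caF by simp
  ultimately have P1: "\<bar>p - (lam + (sg i - h + (ta k - h') + m / real n) / real n + cc * (sg i - h) * (ta k - h') / real n ^ 2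
     + lam * ((1 + h) + (1 + h') - (real n + m) / real n) / real n)\<bar> \<le> (2 * L) ^ 19 / (real n * r)" by simp
  \<comment> \<open>The relative change \<open>z\<close> of the probability is split into
    \<open>y\<close>, of order 1/r, and \<open>w\<close>, of order 1/n. Up to powers of
    \<open>L\<close> over n*r, the logarithm is then y + w - y^2/2.\<close>
  define y where "y = (sg i + ta k) / (lam * real n)"
  define w where "w = cc * sg i * ta k / (lam * real n ^ 2) + 1 / real n - (1 - lam) / (lam * real n) * (h + h' - m / real n)"
  define z where "z = p / lam - 1"
  define \<eta> where "\<eta> = 1 / (real n * r)"
  have \<eta>0: "0 < \<eta>" using n0 r_pos by (simp add: \<eta>_def)
  have lam0: "0 < lam" by (rule lam_bounds)
  have ilam: "1 / lam \<le> L"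
  proof -
    have "1 / lam \<le> 1 / (1 / L)" using lam_bounds L_pos by (intro divide_left_mono mult_pos_pos) auto
    then show ?thesis by simp
  qed
  have sgb: "\<bar>sg i\<bar> \<le> L * r" and tab: "\<bar>ta k\<bar> \<le> L * r" using s_near[OF in_n(1)] t_near[OF in_n(2)] by auto
  have z_eq: "z - (y + w) = (1 / lam) * ((p - (lam + (sg i - h + (ta k - h') + m / real n) / real n + cc * (sg i - h) * (ta k - h') / real n ^ 2
     + lam * ((1 + h) + (1 + h') - (real n + m) / real n) / real n)) + cc * (h * h' - h * ta k - h' * sg i) / real n ^ 2)"
  proof -
    have "p / l - 1 - ((S + U) / (l * N) + (c * S * U / (l * N ^ 2) + 1 / N - (1 - l) / (l * N) * (h + h' - m / N)))
      = (1 / l) * ((p - (l + (S - h + (U - h') + m / N) / N + c * (S - h) * (U - h') / N ^ 2 + l * ((1 + h) + (1 + h') - (N + m) / N) / N))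
         + c * (h * h' - h * U - h' * S) / N ^ 2)"
      if "l > 0" "N > 0" for p l S U N c h h' m :: real
      using that by (simp add: field_simps power2_eq_square)
    from this[OF lam0 n0] show ?thesis unfolding z_def y_def w_def .
  qed
  \<comment> \<open>In the interaction term the lowered deviations are replaced by the original
    ones; each product left over has at most one factor of order \<open>r\<close>, and r/n^2 =
    1/(n*r).\<close>
  have corr: "\<bar>cc * (h * h' - h * ta k - h' * sg i) / real n ^ 2\<bar> \<le> 3 * L ^ 3 * \<eta>"
  proof -
    have "h * h' \<le> L * (L * r)"
    proof (rule mult_mono)
      show "h' \<le> L * r" using hb L_le_Lr by linarith
    qed (use hb L_pos in auto)
    moreover have "0 \<le> h * h'" using hb by simp
    moreover have "\<bar>h * ta k\<bar> \<le> L * (L * r)" unfolding abs_mult using hb tab L_pos by (intro mult_mono) auto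
    moreover have "\<bar>h' * sg i\<bar> \<le> L * (L * r)" unfolding abs_mult using hb sgb L_pos by (intro mult_mono) auto
    ultimately have "\<bar>h * h' - h * ta k - h' * sg i\<bar> \<le> 3 * (L * (L * r))" by linarith
    then have "\<bar>cc\<bar> * \<bar>h * h' - h * ta k - h' * sg i\<bar> \<le> L * (3 * (L * (L * r)))"
      using cc_bound L_pos by (intro mult_mono) auto
    then have "\<bar>cc * (h * h' - h * ta k - h' * sg i)\<bar> / real n ^ 2 \<le> L * (3 * (L * (L * r))) / real n ^ 2"
      unfolding abs_mult[of cc] by (intro divide_right_mono) auto
    also have "\<dots> = 3 * L ^ 3 * \<eta>" using r_pos by (simp add: \<eta>_def n_eq power2_eq_square power3_eq_cube mult_ac)
    finally show ?thesis by (simp only: abs_divide abs_power2)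
  qed
  have zerr: "\<bar>z - (y + w)\<bar> \<le> L ^ 24 * \<eta>"
  proof -
    let ?d = "p - (lam + (sg i - h + (ta k - h') + m / real n) / real n + cc * (sg i - h) * (ta k - h') / real n ^ 2
     + lam * ((1 + h) + (1 + h') - (real n + m) / real n) / real n)"
    have P1': "\<bar>?d\<bar> \<le> (2 * L) ^ 19 * \<eta>" using P1 by (simp add: \<eta>_def)
    have "\<bar>?d + cc * (h * h' - h * ta k - h' * sg i) / real n ^ 2\<bar> \<le> (2 * L) ^ 19 * \<eta> + 3 * L ^ 3 * \<eta>"
      by (rule order_trans[OF abs_triangle_ineq add_mono[OF P1' corr]])
    then have "\<bar>z - (y + w)\<bar> \<le> L * ((2 * L) ^ 19 * \<eta> + 3 * L ^ 3 * \<eta>)"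
      unfolding z_eq abs_mult[of "1 / lam"] using ilam lam0 L_pos by (intro mult_mono) auto
    also have "\<dots> = (524288 * L ^ 20 + 3 * L ^ 4) * \<eta>" by (simp add: power_mult_distrib algebra_simps power_numeral_reduce)
    also have "\<dots> \<le> L ^ 24 * \<eta>"
    proof (rule mult_right_mono)
      have "L ^ 4 \<le> L ^ 20" using L_ge by (intro power_increasing) auto
      moreover have "0 \<le> L ^ 20" using L_pos by simp
      ultimately have "524288 * L ^ 20 + 3 * L ^ 4 \<le> 100000000 * L ^ 20" by linarith
      also have "\<dots> \<le> L ^ 4 * L ^ 20"
        using L_ge L_pos power_mono[of 100 L 4] by (intro mult_right_mono) auto
      finally show "524288 * L ^ 20 + 3 * L ^ 4 \<le> L ^ 24" by (simp flip: power_add)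
    qed (use \<eta>0 in simp)
    finally show ?thesis .
  qed
  have yb: "\<bar>y\<bar> \<le> 2 * L\<^sup>2 / r"
  proof -
    have "\<bar>sg i + ta k\<bar> \<le> 2 * (L * r)" using sgb tab by linarith
    then have "\<bar>sg i + ta k\<bar> * (1 / lam) \<le> 2 * (L * r) * L" using ilam lam0 L_pos r_pos by (intro mult_mono) auto
    then have "\<bar>sg i + ta k\<bar> * (1 / lam) / real n \<le> 2 * (L * r) * L / real n" by (intro divide_right_mono) auto
    also have "\<dots> = 2 * L\<^sup>2 / r" using r_pos by (simp add: n_eq power2_eq_square)
    finally show ?thesis unfolding y_def using lam0 n0 by (simp add: abs_divide abs_mult)
  qed
  have wb: "\<bar>w\<bar> \<le> 2 * L ^ 4 / real n"
  proof -
    have "\<bar>cc * sg i * ta k\<bar> \<le> L * (L * r) * (L * r)"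
      unfolding abs_mult using cc_bound[unfolded abs_mult] sgb tab L_pos r_pos by (intro mult_mono) (auto simp: abs_divide abs_mult)
    then have "\<bar>cc * sg i * ta k\<bar> * (1 / lam) \<le> L * (L * r) * (L * r) * L" using ilam lam0 L_pos r_pos by (intro mult_mono) auto
    then have "\<bar>cc * sg i * ta k\<bar> * (1 / lam) / real n ^ 2 \<le> L * (L * r) * (L * r) * L / real n ^ 2" by (intro divide_right_mono) auto
    also have "\<dots> = L ^ 4 / real n" using r_pos by (simp add: n_eq power2_eq_square power_numeral_reduce)
    also have "\<bar>cc * sg i * ta k\<bar> * (1 / lam) / real n ^ 2 = \<bar>cc * sg i * ta k / (lam * real n ^ 2)\<bar>"
    proof -
      have "\<bar>a\<bar> * (1 / l) / N = \<bar>a / (l * N)\<bar>" if "l > 0" "N \<ge> 0" for a l N :: real using that by (simp add: abs_divide abs_mult)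
      note gen = this
      show ?thesis by (rule gen[OF lam0]) simp
    qed
    finally have 1: "\<bar>cc * sg i * ta k / (lam * real n ^ 2)\<bar> \<le> L ^ 4 / real n" .
    have "m / real n \<le> L" using mb n0 by (simp add: divide_le_eq mult.commute)
    moreover have "0 \<le> m / real n" using mb by simp
    ultimately have "\<bar>h + h' - m / real n\<bar> \<le> 2 * L" using hb by linarith
    moreover have "\<bar>(1 - lam) / (lam * real n)\<bar> \<le> L / real n"
    proof -
      have "(1 - lam) * (1 / lam) \<le> 1 * L" using lam_bounds ilam by (intro mult_mono) auto
      then have "(1 - lam) * (1 / lam) / real n \<le> L / real n" by (intro divide_right_mono) auto
      then show ?thesis using lam_bounds by simp
    qed
    ultimately have "\<bar>(1 - lam) / (lam * real n) * (h + h' - m / real n)\<bar> \<le> L / real n * (2 * L)"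
      unfolding abs_mult[of "(1 - lam) / (lam * real n)"] using L_pos by (intro mult_mono) auto
    moreover have "L / real n * (2 * L) = 2 * L\<^sup>2 / real n" by (simp add: power2_eq_square)
    ultimately have 2: "\<bar>(1 - lam) / (lam * real n) * (h + h' - m / real n)\<bar> \<le> 2 * L\<^sup>2 / real n" by (simp only:)
    have 4: "0 \<le> 1 / real n" by simp
    have "\<bar>w\<bar> \<le> L ^ 4 / real n + 1 / real n + 2 * L\<^sup>2 / real n" unfolding w_def using 1 2 4 by linarith
    also have "\<dots> = (L ^ 4 + 1 + 2 * L\<^sup>2) / real n" by (simp add: add_divide_distrib)
    also have "\<dots> \<le> 2 * L ^ 4 / real n"
    proof (rule divide_right_mono)
      have "1 \<le> L\<^sup>2" using L_ge by simp
      then have "1 + 2 * L\<^sup>2 \<le> 100\<^sup>2 * L\<^sup>2" by simp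
      also have "\<dots> \<le> L\<^sup>2 * L\<^sup>2" using L_ge by (intro mult_right_mono power_mono) auto
      finally show "L ^ 4 + 1 + 2 * L\<^sup>2 \<le> 2 * L ^ 4" by (simp flip: power_add)
    qed simp
    finally show ?thesis .
  qed
  have ZY: "\<bar>z - y\<bar> \<le> L ^ 15 / real n"
  proof -
    have "L ^ 24 * \<eta> \<le> L ^ 14 / real n"
    proof -
      have "L ^ 24 = L ^ 14 * L ^ 10" by (simp flip: power_add)
      also have "\<dots> \<le> L ^ 14 * r" using r_ge_pow[of 10] L_pos by (intro mult_left_mono) auto
      finally have "L ^ 24 * \<eta> \<le> L ^ 14 * r * \<eta>" using \<eta>0 by (intro mult_right_mono) auto
      then show ?thesis using r_pos by (simp add: \<eta>_def)
    qed
    then have "\<bar>z - y\<bar> \<le> 2 * L ^ 4 / real n + L ^ 14 / real n" using zerr wb by linarith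
    also have "\<dots> = (2 * L ^ 4 + L ^ 14) / real n" by (simp add: add_divide_distrib)
    also have "\<dots> \<le> L ^ 15 / real n"
    proof (rule divide_right_mono)
      have "L ^ 4 \<le> L ^ 14" using L_ge by (intro power_increasing) auto
      then have "2 * L ^ 4 + L ^ 14 \<le> 3 * L ^ 14" by simp
      also have "\<dots> \<le> L * L ^ 14" using L_ge by (intro mult_right_mono) auto
      finally show "2 * L ^ 4 + L ^ 14 \<le> L ^ 15" by (simp add: power_numeral_reduce)
    qed simp
    finally show ?thesis .
  qed
  have Z: "\<bar>z\<bar> \<le> L ^ 6 / r"
  proof -
    have "L ^ 15 / real n \<le> L ^ 5 / r"
    proof -
      have "L ^ 15 = L ^ 5 * L ^ 10" by (simp flip: power_add)
      also have "\<dots> \<le> L ^ 5 * r" using r_ge_pow[of 10] L_pos by (intro mult_left_mono) auto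
      finally have "L ^ 15 / real n \<le> L ^ 5 * r / real n" by (intro divide_right_mono) auto
      then show ?thesis using r_pos by (simp add: n_eq)
    qed
    then have "\<bar>z\<bar> \<le> 2 * L\<^sup>2 / r + L ^ 5 / r" using ZY yb by linarith
    also have "\<dots> = (2 * L\<^sup>2 + L ^ 5) / r" by (simp add: add_divide_distrib)
    also have "\<dots> \<le> L ^ 6 / r"
    proof (rule divide_right_mono)
      have "L\<^sup>2 \<le> L ^ 5" using L_ge by (intro power_increasing) auto
      then have "2 * L\<^sup>2 + L ^ 5 \<le> 3 * L ^ 5" by simp
      also have "\<dots> \<le> L * L ^ 5" using L_ge by (intro mult_right_mono) auto
      finally show "2 * L\<^sup>2 + L ^ 5 \<le> L ^ 6" by (simp add: power_numeral_reduce)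
    qed (use r_pos in simp)
    finally show ?thesis .
  qed
  have Zh: "\<bar>z\<bar> \<le> 1 / 2"
  proof -
    have "2 * L ^ 6 \<le> 100 * L ^ 6" using L_pos by simp
    also have "\<dots> \<le> r" by (rule r_ge_const) simp
    finally have "L ^ 6 / r \<le> 1 / 2" using r_pos by (simp add: field_simps)
    then show ?thesis using Z by linarith
  qed
  have z3: "2 * \<bar>z\<bar> ^ 3 \<le> 2 * L ^ 18 * \<eta>"
  proof -
    have "\<bar>z\<bar> ^ 3 \<le> (L ^ 6 / r) ^ 3" using Z by (intro power_mono) auto
    also have "\<dots> = L ^ 18 * \<eta>" by (simp add: power_divide \<eta>_def n_eq power3_eq_cube flip: power_mult power_add)
    finally show ?thesis by simp
  qed
  have zy2: "\<bar>z\<^sup>2 - y\<^sup>2\<bar> \<le> 2 * L ^ 21 * \<eta>"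
  proof -
    have "\<bar>z + y\<bar> \<le> 2 * L ^ 6 / r"
    proof -
      have "\<bar>y\<bar> \<le> L ^ 6 / r"
      proof -
        have "2 * L\<^sup>2 \<le> L * L\<^sup>2" using L_ge by (intro mult_right_mono) auto
        also have "\<dots> = L ^ 3" by (simp add: power_numeral_reduce)
        also have "\<dots> \<le> L ^ 6" using L_ge by (intro power_increasing) auto
        finally have "2 * L\<^sup>2 / r \<le> L ^ 6 / r" using r_pos by (intro divide_right_mono) auto
        then show ?thesis using yb by linarith
      qed
      then show ?thesis using Z by linarith
    qed
    then have "\<bar>z - y\<bar> * \<bar>z + y\<bar> \<le> (L ^ 15 / real n) * (2 * L ^ 6 / r)" using ZY L_pos by (intro mult_mono) auto
    also have "\<dots> = 2 * L ^ 21 * \<eta>" by (simp add: \<eta>_def flip: power_add)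
    finally show ?thesis by (simp add: abs_mult[symmetric] power2_eq_square algebra_simps)
  qed
  have "p = lam * (1 + z)" using lam0 by (simp add: z_def)
  moreover have z1: "0 < 1 + z" using Zh by linarith
  ultimately have p0: "0 < p" and lnp: "ln p = ln lam + ln (1 + z)" using lam0 by (simp_all add: ln_mult)
  have main: "\<bar>ln (1 + z) - (y + w - y\<^sup>2 / 2)\<bar> \<le> L ^ 25 * \<eta>"
  proof -
    have "\<bar>ln (1 + z) - (y + w - y\<^sup>2 / 2)\<bar> \<le> 2 * L ^ 18 * \<eta> + L ^ 24 * \<eta> + L ^ 21 * \<eta>"
      using ln_one_plus_cubic[OF Zh] z3 zerr zy2 by linarith
    also have "\<dots> = (2 * L ^ 18 + L ^ 24 + L ^ 21) * \<eta>" by (simp add: algebra_simps)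
    also have "\<dots> \<le> L ^ 25 * \<eta>"
    proof (rule mult_right_mono)
      have "L ^ 18 \<le> L ^ 24" "L ^ 21 \<le> L ^ 24" using L_ge by (intro power_increasing; simp)+
      then have "2 * L ^ 18 + L ^ 24 + L ^ 21 \<le> 4 * L ^ 24" by linarith
      also have "\<dots> \<le> L * L ^ 24" using L_ge by (intro mult_right_mono) auto
      finally show "2 * L ^ 18 + L ^ 24 + L ^ 21 \<le> L ^ 25" by (simp add: power_numeral_reduce)
    qed (use \<eta>0 in simp)
    finally show ?thesis .
  qed
  have gain: "y + w - y\<^sup>2 / 2 = arc_gain i k - (1 - lam) / (lam * real n) * (h + h' - m / real n)"
    unfolding y_def w_def arc_gain_def by (simp add: power_divide power_mult_distrib)
  have "ln (arc_prob Om (insert (i,k) E)) = ln (arc_prob Om E) + (ln lam + ln (1 + z))"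
    unfolding ins lnp[symmetric] using pos p0 by (simp add: ln_mult)
  then show ?thesis using main pos p0 unfolding gain h_def h'_def m_def \<eta>_def ins by (simp add: abs_minus_commute)
qed

text \<open>The increments of \<open>arc_step\<close> summed in closed form: an arc inserted at
  current degree d raises d*(d - 1)/2 by d, and similarly for the number of arcs. The total does not
  depend on the order of insertion.\<close>

definition chain_pot :: "(nat \<times> nat) set \<Rightarrow> real" where
  "chain_pot E = (\<Sum>(i,k)\<in>E. arc_gain i k) - (1 - lam) / (lam * real n) *
     ((\<Sum>v<n. real (outdeg E v) * (real (outdeg E v) - 1) / 2) + (\<Sum>v<n. real (indeg E v) * (real (indeg E v) - 1) / 2)
       - real (card E) * (real (card E) - 1) / (2 * real n))"

lemma arc_chain:
  assumes FI: "F = Id_on {..<n}" and T: "T = lam * real n ^ 2" and L8: "(8 * L) ^ 20 \<le> real n"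
    and H: "H \<subseteq> arcs_on n" and deg: "\<And>v. v < n \<Longrightarrow> real (outdeg H v) \<le> L \<and> real (indeg H v) \<le> L"
  shows "0 < arc_prob Om H \<and>
    \<bar>ln (arc_prob Om H) - real (card H) * ln lam - chain_pot H\<bar> \<le> real (card H) * (L ^ 25 / (real n * r))"
proof -
  have box: "arcs_on n \<subseteq> {..<n} \<times> {..<n}" by (auto simp: arcs_on_def)
  have fH: "finite H" by (rule finite_subset[OF subset_trans[OF H box]]) simp
  have "E \<subseteq> H \<Longrightarrow> 0 < arc_prob Om E \<and>
    \<bar>ln (arc_prob Om E) - real (card E) * ln lam - chain_pot E\<bar> \<le> real (card E) * (L ^ 25 / (real n * r))" if "finite E" for E
    using that
  proof (induction E rule: finite_induct)
    case empty
    then show ?case using Om_ne by (simp add: arc_prob_empty chain_pot_def outdeg_def indeg_def)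
  next
    case (insert e E)
    obtain i k where e: "e = (i,k)" by (cases e)
    have EH: "E \<subseteq> H" and eH: "(i,k) \<in> H" using insert.prems e by auto
    have ikn: "i < n" "k < n" using eH H box by auto
    have dE: "real (outdeg E v) \<le> L \<and> real (indeg E v) \<le> L" if "v < n" for v
    proof -
      have "outdeg E v \<le> outdeg H v" unfolding outdeg_def using EH fH by (intro card_mono) (auto simp: finite_out)
      moreover have "indeg E v \<le> indeg H v" unfolding indeg_def using EH fH by (intro card_mono) (auto simp: finite_in)
      ultimately show ?thesis using deg[OF that] by linarith
    qed
    have IH: "0 < arc_prob Om E" "\<bar>ln (arc_prob Om E) - real (card E) * ln lam - chain_pot E\<bar> \<le> real (card E) * (L ^ 25 / (real n * r))"
      using insert.IH[OF EH] by auto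
    have st: "0 < arc_prob Om (insert (i,k) E) \<and>
      \<bar>ln (arc_prob Om (insert (i,k) E)) - ln (arc_prob Om E) - ln lam - (arc_gain i k
       - (1 - lam) / (lam * real n) * (real (outdeg E i) + real (indeg E k) - real (card E) / real n))\<bar>
      \<le> L ^ 25 / (real n * r)"
      using EH H eH insert.hyps e dE IH(1) by (intro arc_step[OF FI T L8]) auto
    have dj: "{(i,k)} \<inter> E = {}" using insert.hyps e by auto
    have o: "outdeg (insert (i,k) E) v = outdeg E v + of_bool (v = i)" for v
    proof -
      have "outdeg {(i,k)} v = of_bool (v = i)" by (cases "v = i") (auto simp: outdeg_def)
      then show ?thesis using outdeg_Un[OF dj] insert.hyps by simp
    qed
    have ii: "indeg (insert (i,k) E) v = indeg E v + of_bool (v = k)" for v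
    proof -
      have "indeg {(i,k)} v = of_bool (v = k)" by (cases "v = k") (auto simp: indeg_def)
      then show ?thesis using indeg_Un[OF dj] insert.hyps by simp
    qed
    have so: "(\<Sum>v<n. real (outdeg (insert (i,k) E) v) * (real (outdeg (insert (i,k) E) v) - 1) / 2)
       = (\<Sum>v<n. real (outdeg E v) * (real (outdeg E v) - 1) / 2) + real (outdeg E i)"
    proof -
      have "(\<Sum>v<n. real (outdeg (insert (i,k) E) v) * (real (outdeg (insert (i,k) E) v) - 1) / 2)
        = (\<Sum>v<n. real (outdeg E v) * (real (outdeg E v) - 1) / 2 + (if v = i then real (outdeg E v) else 0))"
        unfolding o by (intro sum.cong) (auto simp: field_simps)
      then show ?thesis using ikn by (simp add: sum.distrib)
    qed
    have si: "(\<Sum>v<n. real (indeg (insert (i,k) E) v) * (real (indeg (insert (i,k) E) v) - 1) / 2)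
       = (\<Sum>v<n. real (indeg E v) * (real (indeg E v) - 1) / 2) + real (indeg E k)"
    proof -
      have "(\<Sum>v<n. real (indeg (insert (i,k) E) v) * (real (indeg (insert (i,k) E) v) - 1) / 2)
        = (\<Sum>v<n. real (indeg E v) * (real (indeg E v) - 1) / 2 + (if v = k then real (indeg E v) else 0))"
        unfolding ii by (intro sum.cong) (auto simp: field_simps)
      then show ?thesis using ikn by (simp add: sum.distrib)
    qed
    have cd: "card (insert (i,k) E) = card E + 1" using insert.hyps e by simp
    have pot: "chain_pot (insert (i,k) E) = chain_pot E + (arc_gain i k
       - (1 - lam) / (lam * real n) * (real (outdeg E i) + real (indeg E k) - real (card E) / real n))"
    proof -
      have "a + g - c * ((x + h) + (y + h') - (m + 1) * (m + 1 - 1) / (2 * N)) =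
          (a - c * (x + y - m * (m - 1) / (2 * N))) + (g - c * (h + h' - m / N))" if "N > 0" for a g c x h y h' m N :: real
        using that by (simp add: field_simps)
      note gen = this
      have s: "(\<Sum>(i,k)\<in>insert (i,k) E. arc_gain i k) = (\<Sum>(i,k)\<in>E. arc_gain i k) + arc_gain i k"
        using insert.hyps e by simp
      have n0: "0 < real n" using n_pos by simp
      show ?thesis unfolding chain_pot_def so si s cd of_nat_add of_nat_1 by (rule gen[OF n0])
    qed
    have "\<bar>lnq - (m + 1) * l - (pot + d)\<bar> \<le> (m + 1) * \<epsilon>"
      if "\<bar>lnp - m * l - pot\<bar> \<le> m * \<epsilon>" "\<bar>lnq - lnp - l - d\<bar> \<le> \<epsilon>" for lnp lnq m l pot d \<epsilon> :: real
      using that by (simp add: algebra_simps)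
    from this[OF IH(2) conjunct2[OF st]] st show ?case
      unfolding e pot cd of_nat_add of_nat_1 by simp
  qed
  from this[OF fH subset_refl] show ?thesis .
qed

text \<open>The linear terms vanish because the deviations sum to 0. The degrees contribute x*(x -
  1) and the arc count takes away x^2/2, whence x*(x - 2)/2. Only the bilinear sum still depends on
  the position of \<open>H\<close>; its coefficient is \<open>cc / lam - 1 / lam^2\<close>, that is
  \<open>- 1 / (lam * (1 - lam))\<close>, over \<open>n^2\<close>.\<close>

lemma chain_pot_regular:
  assumes T: "T = lam * real n ^ 2" and H: "H \<subseteq> arcs_on n"
    and deg: "\<forall>v<n. outdeg H v = x \<and> indeg H v = x"
  shows "chain_pot H = real x - (1 - lam) * real x * (real x - 2) / (2 * lam)
     - ((\<Sum>v<n. (sg v)\<^sup>2) + (\<Sum>v<n. (ta v)\<^sup>2)) * real x / (2 * lam\<^sup>2 * real n ^ 2)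
     - (\<Sum>(i,k)\<in>H. sg i * ta k) / (lam * (1 - lam) * real n ^ 2) - (1 - lam) * real x / (2 * lam * real n)"
proof -
  have box: "H \<subseteq> {..<n} \<times> {..<n}" using H by (auto simp: arcs_on_def)
  have n0: "0 < real n" using n_pos by simp
  have l0: "0 < lam" "0 < 1 - lam" using lam_bounds by auto
  have cH: "card H = n * x" using sum_outdeg[OF box] deg by simp
  have fst: "(\<Sum>(i,k)\<in>H. f i) = real x * (\<Sum>v<n. f v)" for f :: "nat \<Rightarrow> real"
    unfolding sum_over_arcs_fst[OF box] sum_distrib_left by (intro sum.cong) (auto simp: deg)
  have snd: "(\<Sum>(i,k)\<in>H. f k) = real x * (\<Sum>v<n. f v)" for f :: "nat \<Rightarrow> real"
    unfolding sum_over_arcs_snd[OF box] sum_distrib_left by (intro sum.cong) (auto simp: deg)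
  define W where "W = (\<Sum>(i,k)\<in>H. sg i * ta k)"
  define R where "R = (\<Sum>v<n. (sg v)\<^sup>2)"
  define C where "C = (\<Sum>v<n. (ta v)\<^sup>2)"
  have sg0: "(\<Sum>v<n. sg v) = 0" using T by (simp add: sum_subtractf power2_eq_square)
  have ta0: "(\<Sum>v<n. ta v) = 0" using T sum_st by (simp add: sum_ta om_def)
  let ?a = "1 / (lam * real n)" and ?b = "cc / (lam * real n ^ 2)" and ?c = "1 / (2 * lam\<^sup>2 * real n ^ 2)"
  have "arc_gain i k = 1 / real n + (?a * sg i + ?a * ta k) + ?b * (sg i * ta k)
      - (?c * (sg i)\<^sup>2 + ?c * (ta k)\<^sup>2 + 2 * ?c * (sg i * ta k))" for i k
  proof -
    have "u + (S + U) / d + c * S * U / d2 - (S + U)\<^sup>2 / d3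
       = u + (1 / d * S + 1 / d * U) + c / d2 * (S * U) - (1 / d3 * S\<^sup>2 + 1 / d3 * U\<^sup>2 + 2 * (1 / d3) * (S * U))" for u S U d c d2 d3 :: real
      by (simp add: power2_sum add_divide_distrib algebra_simps)
    then show ?thesis unfolding arc_gain_def .
  qed
  then have "(\<Sum>(i,k)\<in>H. arc_gain i k) = (\<Sum>(i,k)\<in>H. 1 / real n + (?a * sg i + ?a * ta k) + ?b * (sg i * ta k)
      - (?c * (sg i)\<^sup>2 + ?c * (ta k)\<^sup>2 + 2 * ?c * (sg i * ta k)))" by simp
  also have "\<dots> = (\<Sum>(i,k)\<in>H. 1 / real n) + ((\<Sum>(i,k)\<in>H. ?a * sg i) + (\<Sum>(i,k)\<in>H. ?a * ta k)) + (\<Sum>(i,k)\<in>H. ?b * (sg i * ta k))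
      - ((\<Sum>(i,k)\<in>H. ?c * (sg i)\<^sup>2) + (\<Sum>(i,k)\<in>H. ?c * (ta k)\<^sup>2) + (\<Sum>(i,k)\<in>H. 2 * ?c * (sg i * ta k)))"
    by (simp only: sum.distrib sum_subtractf split_def)
  also have "(\<Sum>(i,k)\<in>H. 1 / real n) = real x" using n0 by (simp add: cH split_def)
  also have "(\<Sum>(i,k)\<in>H. ?a * sg i) = 0" unfolding fst sum_distrib_left[symmetric] sg0 by simp
  also have "(\<Sum>(i,k)\<in>H. ?a * ta k) = 0" unfolding snd sum_distrib_left[symmetric] ta0 by simp
  also have "(\<Sum>(i,k)\<in>H. ?b * (sg i * ta k)) = ?b * W" unfolding W_def sum_distrib_left by (simp only: split_def)
  also have "(\<Sum>(i,k)\<in>H. ?c * (sg i)\<^sup>2) = ?c * (real x * R)" unfolding fst sum_distrib_left[symmetric] R_def by simp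
  also have "(\<Sum>(i,k)\<in>H. ?c * (ta k)\<^sup>2) = ?c * (real x * C)" unfolding snd sum_distrib_left[symmetric] C_def by simp
  also have "(\<Sum>(i,k)\<in>H. 2 * ?c * (sg i * ta k)) = 2 * ?c * W" unfolding W_def sum_distrib_left by (simp only: split_def)
  finally have g: "(\<Sum>(i,k)\<in>H. arc_gain i k) = real x + (0 + 0) + ?b * W - (?c * (real x * R) + ?c * (real x * C) + 2 * ?c * W)" .
  have so: "(\<Sum>v<n. real (outdeg H v) * (real (outdeg H v) - 1) / 2) = real n * (real x * (real x - 1) / 2)"
    using deg by simp
  have si: "(\<Sum>v<n. real (indeg H v) * (real (indeg H v) - 1) / 2) = real n * (real x * (real x - 1) / 2)"
    using deg by simp
  have bc: "?b * W - 2 * ?c * W = - W / (lam * (1 - lam) * real n ^ 2)"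
  proof -
    have "(m - l) / (l * m) / (l * N) * W - 2 * (1 / (2 * l\<^sup>2 * N)) * W = - W / (l * m * N)"
      if "l > 0" "m > 0" "N > 0" for l m N W :: real
      using that by (simp add: field_simps power2_eq_square)
    note gen = this
    have "1 - 2 * lam = (1 - lam) - lam" by simp
    then show ?thesis using n0 l0 by (simp only:) (intro gen, auto)
  qed
  have c2: "(1 - lam) / (lam * real n) * (real n * (real x * (real x - 1) / 2) + real n * (real x * (real x - 1) / 2)
       - real (n * x) * (real (n * x) - 1) / (2 * real n))
     = (1 - lam) * real x * (real x - 2) / (2 * lam) + (1 - lam) * real x / (2 * lam * real n)"
    using n0 l0 by (simp add: field_simps)
  have c3: "?c * (real x * R) + ?c * (real x * C) = (R + C) * real x / (2 * lam\<^sup>2 * real n ^ 2)"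
    by (simp add: add_divide_distrib algebra_simps)
  show ?thesis
    unfolding chain_pot_def g so si cH c2 R_def[symmetric] C_def[symmetric] W_def[symmetric]
    using bc c3 by linarith
qed

text \<open>There are \<open>n * x\<close> insertions with error \<open>L^25 / (n * r)\<close> each.
  The summand \<open>real x\<close> stems from the missing loops and is later used to turn
  \<open>lam\<close> into \<open>lam * n / (n - 1)\<close>.\<close>

lemma copy_prob:
  assumes FI: "F = Id_on {..<n}" and T: "T = lam * real n ^ 2" and L8: "(8 * L) ^ 20 \<le> real n"
    and H: "H \<subseteq> arcs_on n" and deg: "\<forall>v<n. outdeg H v = x \<and> indeg H v = x" and x: "real x \<le> L"
  shows "\<exists>\<delta>. \<bar>\<delta>\<bar> \<le> 2 * L ^ 26 / r \<and> arc_prob Om H = lam ^ (n * x) *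
     exp (real x - (1 - lam) * real x * (real x - 2) / (2 * lam)
     - ((\<Sum>v<n. (sg v)\<^sup>2) + (\<Sum>v<n. (ta v)\<^sup>2)) * real x / (2 * lam\<^sup>2 * real n ^ 2)
     - (\<Sum>(i,k)\<in>H. sg i * ta k) / (lam * (1 - lam) * real n ^ 2) + \<delta>)"
proof -
  have box: "H \<subseteq> {..<n} \<times> {..<n}" using H by (auto simp: arcs_on_def)
  have cH: "card H = n * x" using sum_outdeg[OF box] deg by simp
  have n0: "0 < real n" using n_pos by simp
  have ch: "0 < arc_prob Om H" "\<bar>ln (arc_prob Om H) - real (card H) * ln lam - chain_pot H\<bar> \<le> real (card H) * (L ^ 25 / (real n * r))"
    using arc_chain[OF FI T L8 H] deg x by auto
  define B where "B = real x - (1 - lam) * real x * (real x - 2) / (2 * lam)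
     - ((\<Sum>v<n. (sg v)\<^sup>2) + (\<Sum>v<n. (ta v)\<^sup>2)) * real x / (2 * lam\<^sup>2 * real n ^ 2)
     - (\<Sum>(i,k)\<in>H. sg i * ta k) / (lam * (1 - lam) * real n ^ 2)"
  define \<delta> where "\<delta> = ln (arc_prob Om H) - real (n * x) * ln lam - B"
  have cp: "chain_pot H = B - (1 - lam) * real x / (2 * lam * real n)"
    unfolding B_def by (rule chain_pot_regular[OF T H deg])
  have "real (card H) * (L ^ 25 / (real n * r)) \<le> real n * L * (L ^ 25 / (real n * r))"
    unfolding cH of_nat_mult using x L_pos r_pos by (intro mult_right_mono mult_left_mono) auto
  also have "\<dots> = L ^ 26 / r" using n0 by (simp add: power_numeral_reduce)
  finally have 1: "\<bar>\<delta> + (1 - lam) * real x / (2 * lam * real n)\<bar> \<le> L ^ 26 / r"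
    using ch(2) unfolding \<delta>_def cp cH by simp
  have ilam: "1 / lam \<le> L"
  proof -
    have "1 / lam \<le> 1 / (1 / L)" using lam_bounds L_pos by (intro divide_left_mono mult_pos_pos) auto
    then show ?thesis by simp
  qed
  have "0 \<le> (1 - lam) * real x / (2 * lam * real n)" using lam_bounds by simp
  moreover have "(1 - lam) * real x / (2 * lam * real n) \<le> L ^ 26 / r"
  proof -
    have "(1 - lam) * real x * (1 / lam) \<le> 1 * L * L" using lam_bounds x ilam L_pos by (intro mult_mono) auto
    then have "(1 - lam) * real x * (1 / lam) / (2 * real n) \<le> 1 * L * L / (2 * real n)" by (intro divide_right_mono) auto
    also have "\<dots> \<le> L ^ 26 / r"
    proof (rule frac_le)
      show "1 * L * L \<le> L ^ 26" using power_increasing[of 2 26 L] L_ge by (simp add: power2_eq_square)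
      have "r \<le> real n" unfolding n_eq using r_ge_100 by simp
      then show "r \<le> 2 * real n" by simp
    qed (use L_pos r_pos in auto)
    finally show ?thesis by (simp add: mult.assoc)
  qed
  moreover have "2 * L ^ 26 / r = L ^ 26 / r + L ^ 26 / r" by simp
  ultimately have "\<bar>\<delta>\<bar> \<le> 2 * L ^ 26 / r" using 1 by linarith
  moreover have "arc_prob Om H = lam ^ (n * x) * exp (B + \<delta>)"
  proof -
    have "lam ^ (n * x) = exp (real (n * x) * ln lam)" unfolding exp_of_nat_mult using lam_bounds by simp
    then have "lam ^ (n * x) * exp (B + \<delta>) = exp (real (n * x) * ln lam + (B + \<delta>))" by (simp only: exp_add)
    also have "real (n * x) * ln lam + (B + \<delta>) = ln (arc_prob Om H)" unfolding \<delta>_def by simp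
    finally have "lam ^ (n * x) * exp (B + \<delta>) = exp (ln (arc_prob Om H))" .
    then show ?thesis using ch(1) by simp
  qed
  ultimately show ?thesis unfolding B_def by blast
qed

end

section \<open>Averaging over copies\<close>

definition relabel :: "(nat \<Rightarrow> nat) \<Rightarrow> (nat \<times> nat) set \<Rightarrow> (nat \<times> nat) set" where
  "relabel \<sigma> H = (\<lambda>(u, v). (\<sigma> u, \<sigma> v)) ` H"

abbreviation swp :: "nat \<Rightarrow> nat \<Rightarrow> nat \<Rightarrow> nat" where
  "swp u v w \<equiv> if w = u then v else if w = v then u else w"

lemma inj_swp: "inj (swp u v)" by (rule inj_on_inverseI[where g = "swp u v"]) auto

lemma relabel_relabel: "relabel \<sigma> (relabel \<tau> H) = relabel (\<sigma> \<circ> \<tau>) H"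
  by (auto simp: relabel_def image_image split_def)

lemma relabel_swp_swp: "relabel (swp u v) (relabel (swp u v) H) = H"
proof -
  have "swp u v \<circ> swp u v = id" by auto
  then show ?thesis unfolding relabel_relabel by (simp add: relabel_def split_def)
qed

definition arc_sum :: "(nat \<Rightarrow> real) \<Rightarrow> (nat \<Rightarrow> real) \<Rightarrow> (nat \<times> nat) set \<Rightarrow> real" where
  "arc_sum a b H = (\<Sum>(i,k)\<in>H. a i * b k)"

lemma arc_sum_relabel: "inj \<sigma> \<Longrightarrow> arc_sum a b (relabel \<sigma> H) = (\<Sum>(i,k)\<in>H. a (\<sigma> i) * b (\<sigma> k))"
  unfolding arc_sum_def relabel_def
  by (subst sum.reindex) (auto simp: inj_on_def inj_def split_def)

text \<open>All ordered pairs are summed, including \<open>u = v\<close>. A transposition moving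
  neither \<open>i\<close> nor \<open>k\<close> changes nothing; those moving just one of them let a
  factor run over the other vertices, where the zero sums remove nearly everything. What remains is
  about \<open>- 4 * n\<close> times the term, plus terms without a factor \<open>n\<close>.\<close>

lemma sum_swp_pair:
  fixes a b :: "nat \<Rightarrow> real"
  assumes ik: "i < n" "k < n" "i \<noteq> k" and a0: "(\<Sum>v<n. a v) = 0" and b0: "(\<Sum>v<n. b v) = 0"
  shows "(\<Sum>u<n. \<Sum>v<n. a (swp u v i) * b (swp u v k)) - real n ^ 2 * (a i * b k)
     = 2 * (a k * b i) - 2 * (a k * b k) - 2 * (a i * b i) - (4 * real n - 2) * (a i * b k)"
proof -
  have split1: "(\<Sum>v<n. f v) = f i + f k + (\<Sum>v\<in>{..<n} - {i,k}. f v)" for f :: "nat \<Rightarrow> real"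
    using ik by (subst sum.subset_diff[of "{i,k}"]) auto
  have ra: "(\<Sum>v\<in>{..<n} - {i,k}. a v) = - a i - a k" using split1[of a] a0 by simp
  have rb: "(\<Sum>v\<in>{..<n} - {i,k}. b v) = - b i - b k" using split1[of b] b0 by simp
  have c: "real (card ({..<n} - {i,k})) = real n - 2"
  proof -
    have "card ({..<n} - {i,k}) = n - 2" using ik by (subst card_Diff_subset) auto
    moreover have "n \<ge> 2" using ik by linarith
    ultimately show ?thesis by (simp add: of_nat_diff)
  qed
  have gi: "(\<Sum>v<n. a (swp i v i) * b (swp i v k)) = a k * b i - a k * b k"
  proof -
    have "(\<Sum>v\<in>{..<n} - {i,k}. a (swp i v i) * b (swp i v k)) = (\<Sum>v\<in>{..<n} - {i,k}. a v * b k)"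
      using ik by (intro sum.cong) auto
    also have "\<dots> = (- a i - a k) * b k" unfolding ra[symmetric] sum_distrib_right ..
    finally show ?thesis unfolding split1[of "\<lambda>v. a (swp i v i) * b (swp i v k)"] using ik by (simp add: algebra_simps)
  qed
  have gk: "(\<Sum>v<n. a (swp k v i) * b (swp k v k)) = a k * b i - a i * b i"
  proof -
    have "(\<Sum>v\<in>{..<n} - {i,k}. a (swp k v i) * b (swp k v k)) = (\<Sum>v\<in>{..<n} - {i,k}. a i * b v)"
      using ik by (intro sum.cong) auto
    also have "\<dots> = a i * (- b i - b k)" unfolding rb[symmetric] sum_distrib_left ..
    finally show ?thesis unfolding split1[of "\<lambda>v. a (swp k v i) * b (swp k v k)"] using ik by (simp add: algebra_simps)
  qed
  have go: "(\<Sum>v<n. a (swp u v i) * b (swp u v k)) = a u * b k + a i * b u + (real n - 2) * (a i * b k)" if u: "u \<in> {..<n} - {i,k}" for u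
  proof -
    have "(\<Sum>v\<in>{..<n} - {i,k}. a (swp u v i) * b (swp u v k)) = (\<Sum>v\<in>{..<n} - {i,k}. a i * b k)"
      using ik u by (intro sum.cong) auto
    also have "\<dots> = (real n - 2) * (a i * b k)" by (simp add: c)
    finally show ?thesis unfolding split1[of "\<lambda>v. a (swp u v i) * b (swp u v k)"] using ik u by auto
  qed
  have "(\<Sum>u\<in>{..<n} - {i,k}. \<Sum>v<n. a (swp u v i) * b (swp u v k))
     = (\<Sum>u\<in>{..<n} - {i,k}. a u * b k + a i * b u + (real n - 2) * (a i * b k))"
    by (intro sum.cong go) auto
  also have "\<dots> = (- a i - a k) * b k + a i * (- b i - b k) + (real n - 2) * ((real n - 2) * (a i * b k))"
    unfolding sum.distrib sum_distrib_left[symmetric] sum_distrib_right[symmetric] ra rb by (simp add: c)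
  finally show ?thesis
    unfolding split1[of "\<lambda>u. \<Sum>v<n. a (swp u v i) * b (swp u v k)"] gi gk by (simp add: algebra_simps power2_eq_square)
qed

section \<open>Exponential moment of the bilinear statistic over a family closed under
  transpositions\<close>

context
  fixes n x :: nat and a b :: "nat \<Rightarrow> real" and A B :: real and I :: "(nat \<times> nat) set set"
  assumes n1: "1 \<le> n"
    and finI: "finite I"
    and I_arcs: "\<And>H. H \<in> I \<Longrightarrow> H \<subseteq> arcs_on n"
    and I_deg: "\<And>H v. H \<in> I \<Longrightarrow> v < n \<Longrightarrow> outdeg H v = x \<and> indeg H v = x"
    and I_closed: "\<And>H u v. H \<in> I \<Longrightarrow> u < n \<Longrightarrow> v < n \<Longrightarrow> relabel (swp u v) H \<in> I"
    and a0: "(\<Sum>v<n. a v) = 0" and b0: "(\<Sum>v<n. b v) = 0"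
    and aA: "\<And>v. v < n \<Longrightarrow> \<bar>a v\<bar> \<le> A" and bB: "\<And>v. v < n \<Longrightarrow> \<bar>b v\<bar> \<le> B"
begin

lemma AB_nonneg: "0 \<le> A" "0 \<le> B" using aA[of 0] bB[of 0] n1 by auto

lemma box: "H \<in> I \<Longrightarrow> H \<subseteq> {..<n} \<times> {..<n}" using I_arcs by (fastforce simp: arcs_on_def)

lemma sum_fst: "H \<in> I \<Longrightarrow> (\<Sum>(i,k)\<in>H. f i) = real x * (\<Sum>v<n. f v)" for f :: "nat \<Rightarrow> real"
  unfolding sum_over_arcs_fst[OF box] sum_distrib_left by (intro sum.cong) (auto simp: I_deg)

lemma sum_snd: "H \<in> I \<Longrightarrow> (\<Sum>(i,k)\<in>H. f k) = real x * (\<Sum>v<n. f v)" for f :: "nat \<Rightarrow> real"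
  unfolding sum_over_arcs_snd[OF box] sum_distrib_left by (intro sum.cong) (auto simp: I_deg)

lemma card_H: "H \<in> I \<Longrightarrow> card H = n * x"
  using sum_outdeg[OF box] I_deg by fastforce

lemma ab_le: "i < n \<Longrightarrow> k < n \<Longrightarrow> \<bar>a i * b k\<bar> \<le> A * B"
  unfolding abs_mult using aA bB AB_nonneg by (intro mult_mono) auto

text \<open>\<open>sum_swp_pair\<close> summed over the arcs: a random transposition contracts the
  statistic, with a remainder of at most 6*A*B for each of the n*x arcs.\<close>

lemma swap_total:
  assumes H: "H \<in> I"
  shows "\<bar>(4 * real n - 2) * arc_sum a b H + (\<Sum>u<n. \<Sum>v<n. arc_sum a b (relabel (swp u v) H) - arc_sum a b H)\<bar>
    \<le> 6 * real n * real x * (A * B)"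
proof -
  have "(\<Sum>u<n. \<Sum>v<n. arc_sum a b (relabel (swp u v) H)) = (\<Sum>(i,k)\<in>H. \<Sum>u<n. \<Sum>v<n. a (swp u v i) * b (swp u v k))"
    unfolding arc_sum_relabel[OF inj_swp] split_def
    by (subst (2) sum.swap, subst sum.swap) (simp only: sum.swap[of _ H])
  then have eq: "(4 * real n - 2) * arc_sum a b H + (\<Sum>u<n. \<Sum>v<n. arc_sum a b (relabel (swp u v) H) - arc_sum a b H)
    = (\<Sum>(i,k)\<in>H. (4 * real n - 2) * (a i * b k) + ((\<Sum>u<n. \<Sum>v<n. a (swp u v i) * b (swp u v k)) - real n ^ 2 * (a i * b k)))"
    by (simp add: sum_subtractf sum.distrib sum_distrib_left arc_sum_def split_def power2_eq_square mult.assoc)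
  also have "\<dots> = (\<Sum>(i,k)\<in>H. 2 * (a k * b i) - 2 * (a k * b k) - 2 * (a i * b i))"
  proof (rule sum.cong[OF refl], clarify)
    fix i k assume "(i,k) \<in> H"
    then have "i < n" "k < n" "i \<noteq> k" using I_arcs[OF H] by (auto simp: arcs_on_def)
    from sum_swp_pair[OF this a0 b0]
    show "(4 * real n - 2) * (a i * b k) + ((\<Sum>u<n. \<Sum>v<n. a (swp u v i) * b (swp u v k)) - real n ^ 2 * (a i * b k))
      = 2 * (a k * b i) - 2 * (a k * b k) - 2 * (a i * b i)" by simp
  qed
  finally have K: "(4 * real n - 2) * arc_sum a b H + (\<Sum>u<n. \<Sum>v<n. arc_sum a b (relabel (swp u v) H) - arc_sum a b H)
    = (\<Sum>(i,k)\<in>H. 2 * (a k * b i) - 2 * (a k * b k) - 2 * (a i * b i))" .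
  have "\<bar>\<Sum>(i,k)\<in>H. 2 * (a k * b i) - 2 * (a k * b k) - 2 * (a i * b i)\<bar>
      \<le> (\<Sum>(i,k)\<in>H. \<bar>2 * (a k * b i) - 2 * (a k * b k) - 2 * (a i * b i)\<bar>)"
    unfolding split_def by (rule sum_abs)
  also have "\<dots> \<le> (\<Sum>(i,k)\<in>H. 6 * (A * B))"
  proof (rule sum_mono, clarify)
    fix i k assume "(i,k) \<in> H"
    then have "i < n" "k < n" using box[OF H] by auto
    then show "\<bar>2 * (a k * b i) - 2 * (a k * b k) - 2 * (a i * b i)\<bar> \<le> 6 * (A * B)"
      using ab_le[of k i] ab_le[of k k] ab_le[of i i] by linarith
  qed
  also have "\<dots> = 6 * real n * real x * (A * B)" using card_H[OF H] by (simp add: split_def)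
  finally show ?thesis unfolding K .
qed

text \<open>Only arcs meeting \<open>u\<close> or \<open>v\<close> change, each by at most 2*A*B.
  The two vertices meet at most 4*x arcs, which gives 8.\<close>

lemma swap_diff_le:
  assumes H: "H \<in> I" and uv: "u < n" "v < n"
  shows "\<bar>arc_sum a b (relabel (swp u v) H) - arc_sum a b H\<bar> \<le> 8 * real x * (A * B)"
proof -
  have AB0: "0 \<le> A * B" using AB_nonneg by simp
  let ?h = "\<lambda>w. (of_bool (w = u) + of_bool (w = v)) * (2 * (A * B))"
  have K: "arc_sum a b (relabel (swp u v) H) - arc_sum a b H = (\<Sum>(i,k)\<in>H. a (swp u v i) * b (swp u v k) - a i * b k)"
    unfolding arc_sum_relabel[OF inj_swp] unfolding arc_sum_def split_def by (simp only: sum_subtractf)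
  have "\<bar>\<Sum>(i,k)\<in>H. a (swp u v i) * b (swp u v k) - a i * b k\<bar> \<le> (\<Sum>(i,k)\<in>H. \<bar>a (swp u v i) * b (swp u v k) - a i * b k\<bar>)"
    unfolding split_def by (rule sum_abs)
  also have "\<dots> \<le> (\<Sum>(i,k)\<in>H. ?h i + ?h k)"
  proof (rule sum_mono, clarify)
    fix i k assume "(i,k) \<in> H"
    then have ik: "i < n" "k < n" using box[OF H] by auto
    have "\<bar>a (swp u v i) * b (swp u v k)\<bar> \<le> A * B" using ik uv by (intro ab_le) auto
    then have "\<bar>a (swp u v i) * b (swp u v k) - a i * b k\<bar> \<le> 2 * (A * B)" using ab_le[OF ik] by linarith
    moreover have "0 \<le> ?h i" "0 \<le> ?h k" using AB0 by auto
    ultimately show "\<bar>a (swp u v i) * b (swp u v k) - a i * b k\<bar> \<le> ?h i + ?h k"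
      using AB0 by (cases "i = u \<or> i = v \<or> k = u \<or> k = v") auto
  qed
  also have "\<dots> = (\<Sum>(i,k)\<in>H. ?h i) + (\<Sum>(i,k)\<in>H. ?h k)" unfolding split_def by (rule sum.distrib)
  also have "\<dots> = real x * (\<Sum>w<n. ?h w) + real x * (\<Sum>w<n. ?h w)" unfolding sum_fst[OF H] sum_snd[OF H] ..
  also have "(\<Sum>w<n. ?h w) = 4 * (A * B)"
    unfolding sum_distrib_right[symmetric] sum.distrib using uv by (simp add: of_bool_def)
  finally show ?thesis unfolding K by (simp add: mult_ac)
qed

text \<open>The exchangeable-pair argument: transposing two labels permutes \<^term>\<open>I\<close>, and the total change over all
  transpositions is almost \<^term>\<open>- 4 * real n\<close> times the statistic, so its exponential moment hardly moves.\<close>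

lemma exp_moment_deriv:
  fixes \<theta> :: real
  assumes \<theta>: "0 \<le> \<theta>" "\<theta> \<le> 1"
  defines "Z \<equiv> (\<Sum>H\<in>I. exp (\<theta> * arc_sum a b H))"
  shows "\<bar>\<Sum>H\<in>I. arc_sum a b H * exp (\<theta> * arc_sum a b H)\<bar> \<le>
    (6 * real x * (A * B) + 64 * real n * (real x * (A * B))\<^sup>2) * Z"
proof -
  let ?W = "arc_sum a b" and ?e = "\<lambda>H. exp (\<theta> * arc_sum a b H)"
  let ?D = "8 * real x * (A * B)"
  have D0: "0 \<le> ?D" using AB_nonneg by simp
  have Z0: "0 \<le> Z" unfolding Z_def by (intro sum_nonneg) auto
  have pair: "\<bar>\<Sum>H\<in>I. (?W (relabel (swp u v) H) - ?W H) * ?e H\<bar> \<le> ?D\<^sup>2 * Z" if uv: "u < n" "v < n" for u v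
  proof -
    let ?t = "relabel (swp u v)"
    have bij: "bij_betw ?t I I"
      by (rule bij_betw_byWitness[where f' = ?t]) (use uv I_closed relabel_swp_swp in auto)
    have re: "(\<Sum>H\<in>I. f H) = (\<Sum>H\<in>I. f (?t H))" for f :: "_ \<Rightarrow> real"
      using sum.reindex_bij_betw[OF bij, of f] by simp
    define S where "S = (\<Sum>H\<in>I. (?W (?t H) - ?W H) * ?e H)"
    \<comment> \<open>The transposition is an involution of \<open>I\<close>, so the sum can be
      symmetrised: the change of the statistic is then multiplied by the change of the exponential,
      which is small too, and the bound becomes quadratic in \<open>?D\<close>.\<close>
    have "S = (\<Sum>H\<in>I. (?W H - ?W (?t H)) * ?e (?t H))"
      unfolding S_def using re[of "\<lambda>H. (?W (?t H) - ?W H) * ?e H"] by (simp add: relabel_swp_swp)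
    then have "2 * S = (\<Sum>H\<in>I. (?W (?t H) - ?W H) * ?e H) + (\<Sum>H\<in>I. (?W H - ?W (?t H)) * ?e (?t H))"
      unfolding S_def by simp
    also have "\<dots> = (\<Sum>H\<in>I. (?W (?t H) - ?W H) * (?e H - ?e (?t H)))"
      unfolding sum.distrib[symmetric] by (intro sum.cong) (auto simp: algebra_simps)
    finally have "2 * \<bar>S\<bar> = \<bar>\<Sum>H\<in>I. (?W (?t H) - ?W H) * (?e H - ?e (?t H))\<bar>" by (simp add: abs_mult flip: abs_mult)
    also have "\<dots> \<le> (\<Sum>H\<in>I. \<bar>(?W (?t H) - ?W H) * (?e H - ?e (?t H))\<bar>)" by (rule sum_abs)
    also have "\<dots> \<le> (\<Sum>H\<in>I. ?D\<^sup>2 * (?e H + ?e (?t H)))"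
    proof (rule sum_mono)
      fix H assume H: "H \<in> I"
      have lip: "\<bar>exp p - exp q\<bar> \<le> \<bar>p - q\<bar> * (exp p + exp q)" for p q :: real
      proof -
        have one: "exp q - exp p \<le> (q - p) * exp q" if "p \<le> q" for p q :: real
        proof -
          have "1 + (p - q) \<le> exp (p - q)" by (rule exp_ge_add_one_self)
          then have "exp q * (1 + (p - q)) \<le> exp q * exp (p - q)" by (intro mult_left_mono) auto
          then show ?thesis by (simp add: algebra_simps flip: exp_add)
        qed
        show ?thesis
        proof (cases "p \<le> q")
          case True
          then have "\<bar>exp p - exp q\<bar> \<le> (q - p) * exp q" using one[OF True] by simp
          also have "\<dots> \<le> (q - p) * (exp p + exp q)" using True by (intro mult_left_mono) auto
          finally show ?thesis using True by simp
        next
          case False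
          then have "\<bar>exp p - exp q\<bar> \<le> (p - q) * exp p" using one[of q p] by simp
          also have "\<dots> \<le> (p - q) * (exp p + exp q)" using False by (intro mult_left_mono) auto
          finally show ?thesis using False by simp
        qed
      qed
      have d: "\<bar>?W (?t H) - ?W H\<bar> \<le> ?D" by (rule swap_diff_le[OF H uv])
      have "\<bar>?e H - ?e (?t H)\<bar> \<le> \<bar>\<theta> * ?W H - \<theta> * ?W (?t H)\<bar> * (?e H + ?e (?t H))" by (rule lip)
      also have "\<bar>\<theta> * ?W H - \<theta> * ?W (?t H)\<bar> = \<theta> * \<bar>?W (?t H) - ?W H\<bar>"
        using \<theta> by (simp add: abs_mult abs_minus_commute flip: right_diff_distrib)
      also have "\<theta> * \<bar>?W (?t H) - ?W H\<bar> * (?e H + ?e (?t H)) \<le> 1 * ?D * (?e H + ?e (?t H))"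
        using \<theta> d by (intro mult_mono mult_right_mono) auto
      finally have "\<bar>?e H - ?e (?t H)\<bar> \<le> ?D * (?e H + ?e (?t H))" by simp
      then have "\<bar>?W (?t H) - ?W H\<bar> * \<bar>?e H - ?e (?t H)\<bar> \<le> ?D * (?D * (?e H + ?e (?t H)))"
        using d D0 by (intro mult_mono) auto
      then show "\<bar>(?W (?t H) - ?W H) * (?e H - ?e (?t H))\<bar> \<le> ?D\<^sup>2 * (?e H + ?e (?t H))"
        by (simp only: abs_mult power2_eq_square mult.assoc)
    qed
    also have "\<dots> = ?D\<^sup>2 * (Z + (\<Sum>H\<in>I. ?e (?t H)))" unfolding sum_distrib_left[symmetric] sum.distrib Z_def ..
    also have "(\<Sum>H\<in>I. ?e (?t H)) = Z" unfolding Z_def using re[of ?e] by simp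
    finally show ?thesis unfolding S_def by simp
  qed
  define Y where "Y = (\<Sum>H\<in>I. ?W H * ?e H)"
  have "(4 * real n - 2) * Y = (\<Sum>H\<in>I. ((4 * real n - 2) * ?W H + (\<Sum>u<n. \<Sum>v<n. ?W (relabel (swp u v) H) - ?W H)) * ?e H)
     - (\<Sum>H\<in>I. (\<Sum>u<n. \<Sum>v<n. ?W (relabel (swp u v) H) - ?W H) * ?e H)"
    unfolding Y_def sum_distrib_left sum_subtractf[symmetric] by (intro sum.cong) (auto simp: algebra_simps)
  also have "(\<Sum>H\<in>I. (\<Sum>u<n. \<Sum>v<n. ?W (relabel (swp u v) H) - ?W H) * ?e H)
     = (\<Sum>u<n. \<Sum>v<n. \<Sum>H\<in>I. (?W (relabel (swp u v) H) - ?W H) * ?e H)"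
    unfolding sum_distrib_right by (subst sum.swap, subst (2) sum.swap) (rule refl)
  finally have eq: "(4 * real n - 2) * Y = (\<Sum>H\<in>I. ((4 * real n - 2) * ?W H + (\<Sum>u<n. \<Sum>v<n. ?W (relabel (swp u v) H) - ?W H)) * ?e H)
     - (\<Sum>u<n. \<Sum>v<n. \<Sum>H\<in>I. (?W (relabel (swp u v) H) - ?W H) * ?e H)" .
  have b1: "\<bar>\<Sum>H\<in>I. ((4 * real n - 2) * ?W H + (\<Sum>u<n. \<Sum>v<n. ?W (relabel (swp u v) H) - ?W H)) * ?e H\<bar>
     \<le> (6 * real n * real x * (A * B)) * Z"
    unfolding Z_def sum_distrib_left
  proof (rule order_trans[OF sum_abs], rule sum_mono)
    fix H assume "H \<in> I"
    from swap_total[OF this]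
    show "\<bar>((4 * real n - 2) * ?W H + (\<Sum>u<n. \<Sum>v<n. ?W (relabel (swp u v) H) - ?W H)) * ?e H\<bar> \<le> (6 * real n * real x * (A * B)) * ?e H"
      unfolding abs_mult[of _ "?e H"] by (simp add: mult_right_mono)
  qed
  have b2: "\<bar>\<Sum>u<n. \<Sum>v<n. \<Sum>H\<in>I. (?W (relabel (swp u v) H) - ?W H) * ?e H\<bar> \<le> real n * (real n * (?D\<^sup>2 * Z))"
  proof -
    have "\<bar>\<Sum>u<n. \<Sum>v<n. \<Sum>H\<in>I. (?W (relabel (swp u v) H) - ?W H) * ?e H\<bar>
      \<le> (\<Sum>u<n. \<bar>\<Sum>v<n. \<Sum>H\<in>I. (?W (relabel (swp u v) H) - ?W H) * ?e H\<bar>)" by (rule sum_abs)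
    also have "\<dots> \<le> (\<Sum>u<n. \<Sum>v<n. \<bar>\<Sum>H\<in>I. (?W (relabel (swp u v) H) - ?W H) * ?e H\<bar>)" by (intro sum_mono sum_abs)
    also have "\<dots> \<le> (\<Sum>u<n. \<Sum>v<n. ?D\<^sup>2 * Z)" by (intro sum_mono pair) auto
    finally show ?thesis by simp
  qed
  have "real n * \<bar>Y\<bar> \<le> (4 * real n - 2) * \<bar>Y\<bar>" using n1 by (intro mult_right_mono) auto
  also have "\<dots> = \<bar>(4 * real n - 2) * Y\<bar>" using n1 by (simp add: abs_mult)
  also have "\<dots> \<le> (6 * real n * real x * (A * B)) * Z + real n * (real n * (?D\<^sup>2 * Z))"
    unfolding eq by (rule order_trans[OF abs_triangle_ineq4 add_mono[OF b1 b2]])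
  also have "\<dots> = real n * ((6 * real x * (A * B) + 64 * real n * (real x * (A * B))\<^sup>2) * Z)"
    by (simp add: algebra_simps power2_eq_square)
  finally have "\<bar>Y\<bar> \<le> (6 * real x * (A * B) + 64 * real n * (real x * (A * B))\<^sup>2) * Z"
    using n1 by (simp add: mult_le_cancel_left_pos)
  then show ?thesis unfolding Y_def .
qed

text \<open>Gronwall: the logarithmic derivative in \<theta> is at most \<open>m\<close> in absolute
  value, so the moment times \<open>exp (- m * \<theta>)\<close> decreases and the moment times
  \<open>exp (m * \<theta>)\<close> increases between 0 and 1.\<close>

lemma exp_moment:
  defines "m \<equiv> 6 * real x * (A * B) + 64 * real n * (real x * (A * B))\<^sup>2"
  shows "real (card I) * exp (- m) \<le> (\<Sum>H\<in>I. exp (arc_sum a b H))" "(\<Sum>H\<in>I. exp (arc_sum a b H)) \<le> real (card I) * exp m"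
proof -
  define Z where "Z \<theta> = (\<Sum>H\<in>I. exp (\<theta> * arc_sum a b H))" for \<theta> :: real
  define Z' where "Z' \<theta> = (\<Sum>H\<in>I. arc_sum a b H * exp (\<theta> * arc_sum a b H))" for \<theta> :: real
  have dZ: "(Z has_real_derivative Z' \<theta>) (at \<theta>)" for \<theta>
    unfolding Z_def Z'_def by (auto intro!: derivative_eq_intros sum.cong)
  have bd: "\<bar>Z' \<theta>\<bar> \<le> m * Z \<theta>" if "0 \<le> \<theta>" "\<theta> \<le> 1" for \<theta>
    unfolding Z_def Z'_def m_def by (rule exp_moment_deriv[OF that])
  have up: "Z 1 * exp (- m * 1) \<le> Z 0 * exp (- m * 0)"
  proof (rule DERIV_nonpos_imp_nonincreasing[of 0 1 "\<lambda>\<theta>. Z \<theta> * exp (- m * \<theta>)"])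
    fix \<theta> :: real assume \<theta>: "0 \<le> \<theta>" "\<theta> \<le> 1"
    have "((\<lambda>\<theta>. Z \<theta> * exp (- m * \<theta>)) has_real_derivative (Z' \<theta> - m * Z \<theta>) * exp (- m * \<theta>)) (at \<theta>)"
      by (auto intro!: derivative_eq_intros dZ simp: algebra_simps)
    moreover have "(Z' \<theta> - m * Z \<theta>) * exp (- m * \<theta>) \<le> 0" using bd[OF \<theta>] by (intro mult_nonpos_nonneg) auto
    ultimately show "\<exists>y. ((\<lambda>\<theta>. Z \<theta> * exp (- m * \<theta>)) has_real_derivative y) (at \<theta>) \<and> y \<le> 0" by blast
  qed simp
  have lo: "Z 0 * exp (m * 0) \<le> Z 1 * exp (m * 1)"
  proof (rule DERIV_nonneg_imp_nondecreasing[of 0 1 "\<lambda>\<theta>. Z \<theta> * exp (m * \<theta>)"])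
    fix \<theta> :: real assume \<theta>: "0 \<le> \<theta>" "\<theta> \<le> 1"
    have "((\<lambda>\<theta>. Z \<theta> * exp (m * \<theta>)) has_real_derivative (Z' \<theta> + m * Z \<theta>) * exp (m * \<theta>)) (at \<theta>)"
      by (auto intro!: derivative_eq_intros dZ simp: algebra_simps)
    moreover have "0 \<le> (Z' \<theta> + m * Z \<theta>) * exp (m * \<theta>)" using bd[OF \<theta>] by (intro mult_nonneg_nonneg) auto
    ultimately show "\<exists>y. ((\<lambda>\<theta>. Z \<theta> * exp (m * \<theta>)) has_real_derivative y) (at \<theta>) \<and> 0 \<le> y" by blast
  qed simp
  have Z0: "Z 0 = real (card I)" by (simp add: Z_def)
  have Z1: "Z 1 = (\<Sum>H\<in>I. exp (arc_sum a b H))" by (simp add: Z_def)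
  show "real (card I) * exp (- m) \<le> (\<Sum>H\<in>I. exp (arc_sum a b H))" "(\<Sum>H\<in>I. exp (arc_sum a b H)) \<le> real (card I) * exp m"
    using up lo unfolding Z0 Z1 by (simp_all add: exp_minus field_simps)
qed

end

section \<open>The copies of a regular digraph\<close>

lemma iso_copies_eq: "iso_copies n H = (\<lambda>\<sigma>. relabel \<sigma> H) ` {\<sigma>. bij_betw \<sigma> {..<n} {..<n}}"
  by (auto simp: iso_copies_def relabel_def)

lemma relabel_regular:
  assumes \<sigma>: "bij_betw \<sigma> {..<n} {..<n}" and H: "H \<subseteq> arcs_on n"
    and deg: "\<forall>v<n. outdeg H v = x \<and> indeg H v = x"
  shows "relabel \<sigma> H \<subseteq> arcs_on n" "\<And>v. v < n \<Longrightarrow> outdeg (relabel \<sigma> H) v = x \<and> indeg (relabel \<sigma> H) v = x"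
proof -
  have inj: "inj_on \<sigma> {..<n}" and img: "\<sigma> ` {..<n} = {..<n}" using \<sigma> by (auto simp: bij_betw_def)
  have Hb: "i < n \<and> k < n \<and> i \<noteq> k" if "(i,k) \<in> H" for i k using H that by (auto simp: arcs_on_def)
  show "relabel \<sigma> H \<subseteq> arcs_on n"
    using Hb inj img by (fastforce simp: relabel_def arcs_on_def inj_on_def)
  fix v assume "v < n"
  then obtain u where u: "u < n" "v = \<sigma> u" using img by (metis imageE lessThan_iff)
  have o: "{w. (v,w) \<in> relabel \<sigma> H} = \<sigma> ` {w. (u,w) \<in> H}"
  proof safe
    fix w assume "(v,w) \<in> relabel \<sigma> H"
    then obtain i k where ik: "(i,k) \<in> H" "v = \<sigma> i" "w = \<sigma> k" by (auto simp: relabel_def)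
    then have "i = u" using u Hb[OF ik(1)] inj by (auto simp: inj_on_def)
    then show "w \<in> \<sigma> ` {w. (u,w) \<in> H}" using ik by auto
  qed (auto simp: relabel_def u)
  have i: "{w. (w,v) \<in> relabel \<sigma> H} = \<sigma> ` {w. (w,u) \<in> H}"
  proof safe
    fix w assume "(w,v) \<in> relabel \<sigma> H"
    then obtain i k where ik: "(i,k) \<in> H" "w = \<sigma> i" "v = \<sigma> k" by (auto simp: relabel_def)
    then have "k = u" using u Hb[OF ik(1)] inj by (auto simp: inj_on_def)
    then show "w \<in> \<sigma> ` {w. (w,u) \<in> H}" using ik by auto
  qed (auto simp: relabel_def u)
  have "inj_on \<sigma> {w. (u,w) \<in> H}" "inj_on \<sigma> {w. (w,u) \<in> H}"
    by (rule inj_on_subset[OF inj]; use Hb in auto)+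
  then show "outdeg (relabel \<sigma> H) v = x \<and> indeg (relabel \<sigma> H) v = x"
    using deg u(1) unfolding outdeg_def indeg_def o i by (simp add: card_image)
qed

lemma bij_swp: "u < n \<Longrightarrow> v < n \<Longrightarrow> bij_betw (swp u v) {..<n} {..<n}"
  by (rule bij_betw_byWitness[where f' = "swp u v"]) auto

lemma iso_copies_regular:
  assumes H: "H \<subseteq> arcs_on n" and deg: "\<forall>v<n. outdeg H v = x \<and> indeg H v = x"
  shows "finite (iso_copies n H)" "iso_copies n H \<noteq> {}"
    "\<And>H'. H' \<in> iso_copies n H \<Longrightarrow> H' \<subseteq> arcs_on n"
    "\<And>H' v. H' \<in> iso_copies n H \<Longrightarrow> v < n \<Longrightarrow> outdeg H' v = x \<and> indeg H' v = x"
    "\<And>H' u v. H' \<in> iso_copies n H \<Longrightarrow> u < n \<Longrightarrow> v < n \<Longrightarrow> relabel (swp u v) H' \<in> iso_copies n H"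
proof -
  show arcs: "H' \<subseteq> arcs_on n" if "H' \<in> iso_copies n H" for H'
    using that relabel_regular(1)[OF _ H deg] unfolding iso_copies_eq by blast
  show "outdeg H' v = x \<and> indeg H' v = x" if "H' \<in> iso_copies n H" "v < n" for H' v
    using that relabel_regular(2)[OF _ H deg] unfolding iso_copies_eq by blast
  have "arcs_on n \<subseteq> {..<n} \<times> {..<n}" by (auto simp: arcs_on_def)
  then have "iso_copies n H \<subseteq> Pow ({..<n} \<times> {..<n})" using arcs by blast
  then show "finite (iso_copies n H)" by (rule finite_subset) simp
  have "bij_betw id {..<n} {..<n}" by simp
  then show "iso_copies n H \<noteq> {}" unfolding iso_copies_eq by blast
  show "relabel (swp u v) H' \<in> iso_copies n H" if h: "H' \<in> iso_copies n H" and uv: "u < n" "v < n" for H' u v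
  proof -
    obtain \<sigma> where "bij_betw \<sigma> {..<n} {..<n}" "H' = relabel \<sigma> H" using h unfolding iso_copies_eq by blast
    then have "relabel (swp u v) H' = relabel (swp u v \<circ> \<sigma>) H" "bij_betw (swp u v \<circ> \<sigma>) {..<n} {..<n}"
      using bij_betw_trans[OF _ bij_swp[OF uv]] by (auto simp: relabel_relabel)
    then show ?thesis unfolding iso_copies_eq by blast
  qed
qed

section \<open>Expected number of copies\<close>

text \<open>The expectation is the sum of the copy probabilities, which agree up to the exponential
  of the bilinear statistic, and the mean of that over all copies is exp(O(L^9/n)). Passing from
  \<open>lam\<close> to p multiplies the power by (n/(n - 1))^(n*x), that is exp(x) up to a factor
  exp(O(L/n)); this uses up the summand \<open>real x\<close> of \<open>copy_prob\<close>.\<close>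

lemma expected_copies:
  assumes nr: "near_regular n L lam s t (Id_on {..<n})" and T: "real (\<Sum>v<n. s v) = lam * real n ^ 2"
    and L8: "(8 * L) ^ 20 \<le> real n" and H: "H \<subseteq> arcs_on n"
    and deg: "\<forall>v<n. outdeg H v = x \<and> indeg H v = x" and x: "real x \<le> L"
  shows "\<exists>\<delta>. \<bar>\<delta>\<bar> \<le> L ^ 27 / rt n \<and>
    expect_unif (digraphs_deg n s t) (\<lambda>G. real (card {H' \<in> iso_copies n H. H' \<subseteq> G})) =
      (lam * real n / (real n - 1)) ^ (n * x) * real (card (iso_copies n H)) *
      exp (- (1 - lam) * real x * (real x - 2) / (2 * lam)
        - ((\<Sum>v<n. (real (s v) - lam * real n)\<^sup>2) + (\<Sum>v<n. (real (t v) - lam * real n)\<^sup>2)) * real x / (2 * lam\<^sup>2 * real n ^ 2) + \<delta>)"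
proof -
  interpret near_regular n L lam s t "Id_on {..<n}" by (rule nr)
  interpret near_regular_ne n L lam s t "Id_on {..<n}" by unfold_locales (rule nonempty_loopless)
  define I where "I = iso_copies n H"
  note iso = iso_copies_regular[OF H deg, folded I_def]
  \<comment> \<open>The coefficient of the bilinear sum is put into the row weights, so that the
    exponential moment is needed at parameter 1 only.\<close>
  define a where "a v = - sg v / (lam * (1 - lam) * real n ^ 2)" for v
  define Mn where "Mn = - (1 - lam) * real x * (real x - 2) / (2 * lam)
        - ((\<Sum>v<n. (sg v)\<^sup>2) + (\<Sum>v<n. (ta v)\<^sup>2)) * real x / (2 * lam\<^sup>2 * real n ^ 2)"
  define \<epsilon> where "\<epsilon> = 2 * L ^ 26 / r"
  have n0: "0 < real n" using n_pos by simp
  have rn: "r \<le> real n" unfolding n_eq using r_ge_100 by simp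
  have n2: "2 \<le> real n" using rn r_ge_100 by linarith
  have W: "arc_sum a ta H' = - ((\<Sum>(i,k)\<in>H'. sg i * ta k) / (lam * (1 - lam) * real n ^ 2))" for H'
  proof -
    have "arc_sum a ta H' = (\<Sum>(i,k)\<in>H'. - (1 / (lam * (1 - lam) * real n ^ 2)) * (sg i * ta k))"
    proof -
      have "- S / d * U = - (1 / d) * (S * U)" for S U d :: real by simp
      then show ?thesis unfolding arc_sum_def a_def by (simp only:)
    qed
    also have "\<dots> = - (1 / (lam * (1 - lam) * real n ^ 2)) * (\<Sum>(i,k)\<in>H'. sg i * ta k)"
      unfolding sum_distrib_left by (simp only: split_def)
    finally show ?thesis by simp
  qed
  have copy: "lam ^ (n * x) * exp (real x + Mn) * (exp (- \<epsilon>) * exp (arc_sum a ta H')) \<le> arc_prob Om H'"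
    "arc_prob Om H' \<le> lam ^ (n * x) * exp (real x + Mn) * (exp \<epsilon> * exp (arc_sum a ta H'))" if H': "H' \<in> I" for H'
  proof -
    have dg: "\<forall>v<n. outdeg H' v = x \<and> indeg H' v = x" using iso(4)[OF H'] by blast
    obtain \<delta> where \<delta>: "\<bar>\<delta>\<bar> \<le> \<epsilon>" and eq: "arc_prob Om H' = lam ^ (n * x) *
     exp (real x - (1 - lam) * real x * (real x - 2) / (2 * lam)
     - ((\<Sum>v<n. (sg v)\<^sup>2) + (\<Sum>v<n. (ta v)\<^sup>2)) * real x / (2 * lam\<^sup>2 * real n ^ 2)
     - (\<Sum>(i,k)\<in>H'. sg i * ta k) / (lam * (1 - lam) * real n ^ 2) + \<delta>)"
      using copy_prob[OF refl T L8 iso(3)[OF H'] dg x] unfolding \<epsilon>_def by blast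
    have "real x - (1 - lam) * real x * (real x - 2) / (2 * lam)
     - ((\<Sum>v<n. (sg v)\<^sup>2) + (\<Sum>v<n. (ta v)\<^sup>2)) * real x / (2 * lam\<^sup>2 * real n ^ 2)
     - (\<Sum>(i,k)\<in>H'. sg i * ta k) / (lam * (1 - lam) * real n ^ 2) + \<delta> = (real x + Mn) + (\<delta> + arc_sum a ta H')"
    proof -
      have neg: "- (1 - lam) * real x * (real x - 2) / (2 * lam) = - ((1 - lam) * real x * (real x - 2) / (2 * lam))"
        by (simp only: mult_minus_left minus_divide_left)
      show ?thesis unfolding W Mn_def neg by linarith
    qed
    then have eq2: "arc_prob Om H' = lam ^ (n * x) * exp (real x + Mn) * (exp \<delta> * exp (arc_sum a ta H'))"
      unfolding eq by (simp only: exp_add mult.assoc)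
    have l: "0 \<le> lam ^ (n * x) * exp (real x + Mn)" using lam_bounds by simp
    have e: "exp (- \<epsilon>) \<le> exp \<delta>" "exp \<delta> \<le> exp \<epsilon>" using \<delta> by auto
    show "lam ^ (n * x) * exp (real x + Mn) * (exp (- \<epsilon>) * exp (arc_sum a ta H')) \<le> arc_prob Om H'"
      "arc_prob Om H' \<le> lam ^ (n * x) * exp (real x + Mn) * (exp \<epsilon> * exp (arc_sum a ta H'))"
      unfolding eq2 using e l by (intro mult_left_mono mult_right_mono; simp)+
  qed
  define Ex where "Ex = expect_unif (digraphs_deg n s t) (\<lambda>G. real (card {H' \<in> I. H' \<subseteq> G}))"
  have Ex: "Ex = (\<Sum>H'\<in>I. arc_prob Om H')"
  proof -
    have "Ex = expect_unif Om (\<lambda>G. \<Sum>H'\<in>I. of_bool (H' \<subseteq> G))"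
      unfolding Ex_def digraphs_deg_eq_biadj using iso(1) by (intro expect_unif_cong) (simp add: of_bool_def sum.If_cases Int_def)
    then show ?thesis unfolding arc_prob_def by (simp only: expect_unif_sum)
  qed
  define c where "c = lam ^ (n * x) * exp (real x + Mn)"
  have c0: "0 < c" using lam_bounds by (simp add: c_def)
  define S where "S = (\<Sum>H'\<in>I. exp (arc_sum a ta H'))"
  have E1: "c * exp (- \<epsilon>) * S \<le> Ex" "Ex \<le> c * exp \<epsilon> * S"
    unfolding Ex S_def sum_distrib_left c_def using copy by (intro sum_mono; simp add: mult.assoc)+
  \<comment> \<open>The exponent of \<open>exp_moment\<close> for the bounds A = L^2*r/n^2 and B =
    L*r, whose product is \<open>L^3 / n\<close>.\<close>
  define m where "m = 6 * real x * (L * L * r / real n ^ 2 * (L * r)) + 64 * real n * (real x * (L * L * r / real n ^ 2 * (L * r)))\<^sup>2"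
  have mom: "real (card I) * exp (- m) \<le> S" "S \<le> real (card I) * exp m"
  proof -
    have a0: "(\<Sum>v<n. a v) = 0"
    proof -
      have "(\<Sum>v<n. sg v) = 0" using T by (simp add: sum_subtractf power2_eq_square)
      then show ?thesis unfolding a_def sum_divide_distrib[symmetric] sum_negf by simp
    qed
    have b0: "(\<Sum>v<n. ta v) = 0" using T sum_st by (simp add: sum_ta om_def)
    have aA: "\<bar>a v\<bar> \<le> L * L * r / real n ^ 2" if "v < n" for v
    proof -
      have "1 / (lam * (1 - lam)) \<le> 1 / (1 / L)" using lam_var lam_bounds L_pos by (intro divide_left_mono mult_pos_pos) auto
      then have "\<bar>sg v\<bar> * (1 / (lam * (1 - lam))) \<le> (L * r) * L" using s_near[OF that] lam_bounds L_pos r_pos by (intro mult_mono) auto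
      then have "\<bar>sg v\<bar> * (1 / (lam * (1 - lam))) / real n ^ 2 \<le> (L * r) * L / real n ^ 2" by (intro divide_right_mono) auto
      moreover have "\<bar>a v\<bar> = \<bar>sg v\<bar> * (1 / (lam * (1 - lam))) / real n ^ 2"
        unfolding a_def using lam_bounds by (simp add: abs_divide abs_mult abs_minus_commute)
      ultimately show ?thesis by (simp add: mult_ac)
    qed
    have n1: "1 \<le> n" using n_pos by simp
    show "real (card I) * exp (- m) \<le> S" unfolding S_def m_def
      by (rule exp_moment(1)[OF n1 iso(1)]) (fact iso a0 b0 aA t_near)+
    show "S \<le> real (card I) * exp m" unfolding S_def m_def
      by (rule exp_moment(2)[OF n1 iso(1)]) (fact iso a0 b0 aA t_near)+
  qed
  have mb: "0 \<le> m" "m \<le> L ^ 9 / real n"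
  proof -
    have ab: "L * L * r / real n ^ 2 * (L * r) = L ^ 3 / real n" using r_pos by (simp add: n_eq power2_eq_square power3_eq_cube)
    have xa: "real x * (L ^ 3 / real n) \<le> L ^ 4 / real n" "0 \<le> real x * (L ^ 3 / real n)"
    proof -
      have "real x * (L ^ 3 / real n) \<le> L * (L ^ 3 / real n)" using x L_pos by (intro mult_right_mono) auto
      then show "real x * (L ^ 3 / real n) \<le> L ^ 4 / real n" by (simp add: power_numeral_reduce)
    qed (use L_pos in simp)
    show "0 \<le> m" unfolding m_def using L_pos r_pos by simp
    have "(real x * (L ^ 3 / real n))\<^sup>2 \<le> (L ^ 4 / real n)\<^sup>2" using xa by (intro power_mono) auto
    also have "\<dots> = L ^ 8 / real n ^ 2" by (simp add: power_divide flip: power_mult)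
    finally have "64 * real n * (real x * (L ^ 3 / real n))\<^sup>2 \<le> 64 * real n * (L ^ 8 / real n ^ 2)" by (intro mult_left_mono) auto
    also have "\<dots> = 64 * L ^ 8 / real n" using n0 by (simp add: power2_eq_square)
    finally have "m \<le> 6 * (L ^ 4 / real n) + 64 * L ^ 8 / real n" unfolding m_def ab using xa by (simp add: mult.assoc)
    also have "\<dots> = (6 * L ^ 4 + 64 * L ^ 8) / real n" by (simp add: add_divide_distrib)
    also have "\<dots> \<le> L ^ 9 / real n"
    proof (rule divide_right_mono)
      have "L ^ 4 \<le> L ^ 8" using L_ge by (intro power_increasing) auto
      moreover have "0 \<le> L ^ 8" using L_pos by simp
      ultimately have "6 * L ^ 4 + 64 * L ^ 8 \<le> 100 * L ^ 8" by linarith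
      also have "\<dots> \<le> L * L ^ 8" using L_ge by (intro mult_right_mono) auto
      finally show "6 * L ^ 4 + 64 * L ^ 8 \<le> L ^ 9" by (simp add: power_numeral_reduce)
    qed simp
    finally show "m \<le> L ^ 9 / real n" .
  qed
  have cI: "0 < real (card I)" using iso(1,2) by (simp add: card_gt_0_iff)
  define Q where "Q = Ex / (c * real (card I))"
  have cc0: "0 < c * real (card I)" using c0 cI by simp
  have "c * real (card I) * exp (- (\<epsilon> + m)) \<le> Ex"
  proof -
    have "c * exp (- \<epsilon>) * (real (card I) * exp (- m)) \<le> c * exp (- \<epsilon>) * S" using mom c0 by (intro mult_left_mono) auto
    moreover have "exp (- (\<epsilon> + m)) = exp (- \<epsilon>) * exp (- m)" by (simp flip: exp_add)
    ultimately show ?thesis using E1 by (simp add: mult_ac)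
  qed
  then have Q1: "exp (- (\<epsilon> + m)) \<le> Q" unfolding Q_def using cc0 by (simp add: le_divide_eq mult.commute)
  have "Ex \<le> c * real (card I) * exp (\<epsilon> + m)"
  proof -
    have "c * exp \<epsilon> * S \<le> c * exp \<epsilon> * (real (card I) * exp m)" using mom c0 by (intro mult_left_mono) auto
    then show ?thesis using E1 by (simp add: exp_add mult_ac)
  qed
  then have Q2: "Q \<le> exp (\<epsilon> + m)" unfolding Q_def using cc0 by (simp add: divide_le_eq mult.commute)
  have Q0: "0 < Q" using Q1 exp_gt_zero less_le_trans by blast
  define \<delta>1 where "\<delta>1 = ln Q"
  have \<delta>1: "\<bar>\<delta>1\<bar> \<le> \<epsilon> + m"
  proof -
    have "ln (exp (- (\<epsilon> + m))) \<le> ln Q" by (rule ln_mono[OF Q1 exp_gt_zero])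
    moreover have "ln Q \<le> ln (exp (\<epsilon> + m))" by (rule ln_mono[OF Q2 Q0])
    ultimately show ?thesis unfolding \<delta>1_def by simp
  qed
  define q where "q = ln (real n / (real n - 1))"
  have np: "0 < real n - 1" using n2 by simp
  have q1: "1 / real n \<le> q"
  proof -
    have "ln ((real n - 1) / real n) \<le> (real n - 1) / real n - 1" using np n0 by (intro ln_le_minus_one) auto
    moreover have "ln ((real n - 1) / real n) = - q" unfolding q_def using np n0 by (simp add: ln_div)
    moreover have "(real n - 1) / real n - 1 = - (1 / real n)" using n0 by (simp add: field_simps)
    ultimately show ?thesis by simp
  qed
  have q2: "q \<le> 1 / (real n - 1)"
  proof -
    have "q \<le> real n / (real n - 1) - 1" unfolding q_def using np n0 by (intro ln_le_minus_one) auto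
    also have "\<dots> = 1 / (real n - 1)" using np by (simp add: field_simps)
    finally show ?thesis .
  qed
  define \<delta>2 where "\<delta>2 = real (n * x) * q - real x"
  have \<delta>2: "\<bar>\<delta>2\<bar> \<le> 2 * L / real n"
  proof -
    have "real (n * x) * (1 / real n) \<le> real (n * x) * q" using q1 by (intro mult_left_mono) auto
    then have "0 \<le> \<delta>2" unfolding \<delta>2_def using n0 by simp
    have "real (n * x) * q \<le> real (n * x) * (1 / (real n - 1))" using q2 by (intro mult_left_mono) auto
    then have "\<delta>2 \<le> real x * (1 / (real n - 1))" unfolding \<delta>2_def using np by (simp add: field_simps)
    also have "\<dots> \<le> L * (2 / real n)"
    proof (rule mult_mono)
      show "1 / (real n - 1) \<le> 2 / real n" using np n2 n0 by (simp add: field_simps)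
    qed (use x L_pos np in auto)
    finally show ?thesis using \<open>0 \<le> \<delta>2\<close> by (simp add: mult.commute)
  qed
  have pw: "(lam * real n / (real n - 1)) ^ (n * x) = lam ^ (n * x) * exp (real x + \<delta>2)"
  proof -
    have "(lam * real n / (real n - 1)) ^ (n * x) = lam ^ (n * x) * (real n / (real n - 1)) ^ (n * x)"
      by (simp add: power_mult_distrib[symmetric])
    also have "real n / (real n - 1) = exp q" unfolding q_def using np n0 by simp
    also have "exp q ^ (n * x) = exp (real (n * x) * q)" by (rule exp_of_nat_mult[symmetric])
    also have "real (n * x) * q = real x + \<delta>2" by (simp add: \<delta>2_def)
    finally show ?thesis .
  qed
  have eQ: "exp \<delta>1 = Q" unfolding \<delta>1_def by (rule exp_ln[OF Q0])
  have "Ex = c * real (card I) * exp \<delta>1" unfolding eQ unfolding Q_def using c0 cI by simp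
  also have "\<dots> = lam ^ (n * x) * exp (real x + \<delta>2) * real (card I) * exp (Mn + (\<delta>1 - \<delta>2))"
  proof -
    have "exp (real x + Mn) * exp \<delta>1 = exp (real x + \<delta>2) * exp (Mn + (\<delta>1 - \<delta>2))" by (simp flip: exp_add)
    then show ?thesis unfolding c_def by (simp add: mult_ac)
  qed
  finally have fin: "Ex = (lam * real n / (real n - 1)) ^ (n * x) * real (card I) * exp (Mn + (\<delta>1 - \<delta>2))" unfolding pw .
  have "\<bar>\<delta>1 - \<delta>2\<bar> \<le> 2 * L ^ 26 / r + L ^ 9 / real n + 2 * L / real n" using \<delta>1 \<delta>2 mb(2) unfolding \<epsilon>_def by linarith
  also have "\<dots> \<le> 2 * L ^ 26 / r + L ^ 26 / r + 2 * L ^ 26 / r"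
  proof (intro add_mono frac_le order_refl)
    show "L ^ 9 \<le> L ^ 26" using L_ge by (intro power_increasing) auto
    have "L ^ 1 \<le> L ^ 26" using L_ge by (intro power_increasing) auto
    then show "2 * L \<le> 2 * L ^ 26" by simp
  qed (use rn r_pos L_pos in auto)
  also have "\<dots> = 5 * L ^ 26 / r" by (simp add: add_divide_distrib[symmetric])
  also have "\<dots> \<le> L ^ 27 / r"
  proof (rule divide_right_mono)
    have "5 * L ^ 26 \<le> L * L ^ 26" using L_ge by (intro mult_right_mono) auto
    then show "5 * L ^ 26 \<le> L ^ 27" by (simp add: power_numeral_reduce)
  qed (use r_pos in simp)
  finally show ?thesis using fin unfolding Ex_def I_def Mn_def by blast
qed

section \<open>Arc-disjoint copies as copies in the complement\<close>

lemma finite_arcs_on: "finite (arcs_on n)"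
  by (rule finite_subset[of _ "{..<n} \<times> {..<n}"]) (auto simp: arcs_on_def)

lemma arcs_on_deg: "v < n \<Longrightarrow> outdeg (arcs_on n) v = n - 1" "v < n \<Longrightarrow> indeg (arcs_on n) v = n - 1"
proof -
  assume v: "v < n"
  have "{w. (v,w) \<in> arcs_on n} = {..<n} - {v}" "{w. (w,v) \<in> arcs_on n} = {..<n} - {v}"
    using v by (auto simp: arcs_on_def)
  then show "outdeg (arcs_on n) v = n - 1" "indeg (arcs_on n) v = n - 1"
    using v by (simp_all add: outdeg_def indeg_def)
qed

lemma complement_digraphs_deg:
  assumes "G \<in> digraphs_deg n s t"
  shows "arcs_on n - G \<in> digraphs_deg n (\<lambda>v. n - 1 - s v) (\<lambda>v. n - 1 - t v)"
proof -
  have G: "G \<subseteq> arcs_on n" using assms by (simp add: digraphs_deg_def)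
  show ?thesis using assms outdeg_Diff[OF G finite_arcs_on] indeg_Diff[OF G finite_arcs_on] arcs_on_deg
    by (auto simp: digraphs_deg_def)
qed

lemma bij_betw_complement:
  assumes "\<And>v. v < n \<Longrightarrow> s v \<le> n - 1 \<and> t v \<le> n - 1"
  shows "bij_betw (\<lambda>G. arcs_on n - G) (digraphs_deg n s t) (digraphs_deg n (\<lambda>v. n - 1 - s v) (\<lambda>v. n - 1 - t v))"
proof (rule bij_betw_byWitness[where f' = "\<lambda>G. arcs_on n - G"])
  show "(\<lambda>G. arcs_on n - G) ` digraphs_deg n s t \<subseteq> digraphs_deg n (\<lambda>v. n - 1 - s v) (\<lambda>v. n - 1 - t v)"
    using complement_digraphs_deg by blast
  have "digraphs_deg n (\<lambda>v. n - 1 - (n - 1 - s v)) (\<lambda>v. n - 1 - (n - 1 - t v)) = digraphs_deg n s t"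
  proof -
    have e: "n - 1 - (n - 1 - s v) = s v" "n - 1 - (n - 1 - t v) = t v" if "v < n" for v
      using assms[OF that] by (intro diff_diff_cancel; simp)+
    show ?thesis unfolding digraphs_deg_def by (simp only: e cong: imp_cong)
  qed
  then show "(\<lambda>G. arcs_on n - G) ` digraphs_deg n (\<lambda>v. n - 1 - s v) (\<lambda>v. n - 1 - t v) \<subseteq> digraphs_deg n s t"
    using complement_digraphs_deg[of _ n "\<lambda>v. n - 1 - s v" "\<lambda>v. n - 1 - t v"] by auto
qed (auto simp: digraphs_deg_def)

lemma expect_unif_reindex:
  assumes "bij_betw f S S'" shows "expect_unif S' g = expect_unif S (\<lambda>G. g (f G))"
  unfolding expect_unif_def using sum.reindex_bij_betw[OF assms, of g] bij_betw_same_card[OF assms] by simp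

text \<open>The complement has density \<open>l = 1 - lam - 1/n\<close>, since its diagonal stays
  empty as well. Then \<open>l * n / (n - 1)\<close> is exactly 1 - p, and only in the exponent does
  \<open>l\<close> have to be changed to \<open>1 - lam\<close>. The threshold has 16*L because
  \<open>expected_copies\<close> is used at \<open>2 * L\<close>.\<close>

lemma expected_disjoint_copies:
  assumes nr: "near_regular n L lam s t (Id_on {..<n})" and T: "real (\<Sum>v<n. s v) = lam * real n ^ 2"
    and L16: "(16 * L) ^ 20 \<le> real n" and H: "H \<subseteq> arcs_on n"
    and deg: "\<forall>v<n. outdeg H v = x \<and> indeg H v = x" and x: "real x \<le> L"
  shows "\<exists>\<delta>. \<bar>\<delta>\<bar> \<le> (2 * L) ^ 28 / rt n \<and>
    expect_unif (digraphs_deg n s t) (\<lambda>G. real (card {H' \<in> iso_copies n H. H' \<inter> G = {}})) =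
      (1 - lam * real n / (real n - 1)) ^ (n * x) * real (card (iso_copies n H)) *
      exp (- lam * real x * (real x - 2) / (2 * (1 - lam))
        - ((\<Sum>v<n. (real (s v) - lam * real n)\<^sup>2) + (\<Sum>v<n. (real (t v) - lam * real n)\<^sup>2)) * real x / (2 * (1 - lam)\<^sup>2 * real n ^ 2) + \<delta>)"
proof -
  interpret near_regular n L lam s t "Id_on {..<n}" by (rule nr)
  define l where "l = 1 - lam - 1 / real n"
  define s' where "s' v = n - 1 - s v" for v
  define t' where "t' v = n - 1 - t v" for v
  have n0: "0 < real n" using n_pos by simp
  have rn: "r \<le> real n" unfolding n_eq using r_ge_100 by simp
  have n2: "2 \<le> real n" using rn r_ge_100 by linarith
  have gap: "lam * real n + L * r \<le> real n - 1"
  proof -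
    have "1 / L * real n \<le> (1 - lam) * real n" by (intro mult_right_mono lam_bounds) auto
    moreover have "1 \<le> L * r" using L_le_Lr L_ge by linarith
    ultimately show ?thesis using big_gap(2) by (simp add: algebra_simps)
  qed
  have le: "s v \<le> n - 1 \<and> t v \<le> n - 1" if "v < n" for v
  proof -
    have "real (s v) \<le> real n - 1" "real (t v) \<le> real n - 1" using s_near[OF that] t_near[OF that] gap by linarith+
    then show ?thesis using n_pos by linarith
  qed
  have rs: "real (s' v) = real n - 1 - real (s v)" if "v < n" for v
  proof -
    have "s' v + s v + 1 = n" unfolding s'_def using le[OF that] n_pos by linarith
    then have "real (s' v + s v + 1) = real n" by (rule arg_cong)
    then show ?thesis by simp
  qed
  have rt': "real (t' v) = real n - 1 - real (t v)" if "v < n" for v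
  proof -
    have "t' v + t v + 1 = n" unfolding t'_def using le[OF that] n_pos by linarith
    then have "real (t' v + t v + 1) = real n" by (rule arg_cong)
    then show ?thesis by simp
  qed
  have ln: "l * real n = real n - 1 - lam * real n" using n0 by (simp add: l_def field_simps)
  have ds: "real (s' v) - l * real n = - (real (s v) - lam * real n)" if "v < n" for v using rs[OF that] ln by simp
  have dt: "real (t' v) - l * real n = - (real (t v) - lam * real n)" if "v < n" for v using rt'[OF that] ln by simp
  have ss: "real (\<Sum>v<n. s' v) = l * real n ^ 2"
  proof -
    have "real (\<Sum>v<n. s' v) = (\<Sum>v<n. real n - 1 - real (s v))" unfolding of_nat_sum by (intro sum.cong) (auto simp: rs)
    also have "\<dots> = real n * (real n - 1) - real (\<Sum>v<n. s v)" by (simp add: sum_subtractf)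
    also have "\<dots> = l * real n ^ 2" unfolding T l_def using n0 by (simp add: field_simps power2_eq_square)
    finally show ?thesis .
  qed
  have inv: "1 / real n \<le> 1 / (4 * L)"
  proof -
    have "4 * L \<le> r" using r_ge_const[of 1] L_pos by simp
    then show ?thesis using rn L_pos by (intro divide_left_mono) auto
  qed
  have l_lo: "1 / (2 * L) \<le> l"
  proof -
    have "1 / L - 1 / (4 * L) \<le> l" using lam_bounds inv unfolding l_def by linarith
    moreover have "1 / (2 * L) \<le> 1 / L - 1 / (4 * L)" using L_pos by (simp add: field_simps)
    ultimately show ?thesis by linarith
  qed
  have lv: "1 / (2 * L) \<le> l * (1 - l)"
  proof -
    have "l * (1 - l) = lam * (1 - lam) + (1 - 2 * lam) / real n - 1 / real n * (1 / real n)"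
      unfolding l_def using n0 by (simp add: field_simps)
    moreover have "- (1 / real n) \<le> (1 - 2 * lam) / real n"
    proof -
      have "(- 1) / real n \<le> (1 - 2 * lam) / real n" using lam_bounds by (intro divide_right_mono) auto
      then show ?thesis by simp
    qed
    moreover have "1 / real n * (1 / real n) \<le> 1 / real n * 1" using n2 by (intro mult_left_mono) auto
    moreover have "1 / (2 * L) = 1 / L - 2 * (1 / (4 * L))" using L_pos by (simp add: field_simps)
    ultimately show ?thesis using lam_var inv by linarith
  qed
  have nr': "near_regular n (2 * L) l s' t' (Id_on {..<n})"
  proof
    show "100 \<le> 2 * L" using L_ge by simp
    have "(2 * L) ^ 20 \<le> (16 * L) ^ 20" using L_pos by (intro power_mono) auto
    then show "(2 * L) ^ 20 \<le> real n" using L16 by linarith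
    have Lr: "0 \<le> L * r" using L_pos r_pos by simp
    show "\<bar>real (s' v) - l * real n\<bar> \<le> 2 * L * r" if "v < n" for v
      unfolding ds[OF that] abs_minus_cancel using s_near[OF that] Lr by linarith
    show "\<bar>real (t' v) - l * real n\<bar> \<le> 2 * L * r" if "v < n" for v
      unfolding dt[OF that] abs_minus_cancel using t_near[OF that] Lr by linarith
    show "(\<Sum>v<n. s' v) = (\<Sum>v<n. t' v)"
    proof -
      have e: "s' v + s v = n - 1" "t' v + t v = n - 1" if "v < n" for v
        unfolding s'_def t'_def using le[OF that] by linarith+
      have "(\<Sum>v<n. s' v) + (\<Sum>v<n. s v) = (\<Sum>v<n. n - 1)" unfolding sum.distrib[symmetric] by (intro sum.cong) (auto simp only: e lessThan_iff)
      moreover have "(\<Sum>v<n. t' v) + (\<Sum>v<n. t v) = (\<Sum>v<n. n - 1)" unfolding sum.distrib[symmetric] by (intro sum.cong) (auto simp only: e lessThan_iff)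
      ultimately show ?thesis using sum_st by linarith
    qed
    show "\<bar>real (\<Sum>v<n. s' v) - l * (real n)\<^sup>2\<bar> \<le> 2 * L * real n" unfolding ss using L_pos by simp
    show "real (outdeg (Id_on {..<n}) v) \<le> 2 * L" "real (indeg (Id_on {..<n}) v) \<le> 2 * L" if "v < n" for v
      using that L_ge by (simp_all add: Id_on_deg)
  qed (use n_large lv F_sub in auto)
  have L8': "(8 * (2 * L)) ^ 20 \<le> real n" using L16 by simp
  have x': "real x \<le> 2 * L" using x L_pos by linarith
  define RC where "RC = (\<Sum>v<n. (real (s v) - lam * real n)\<^sup>2) + (\<Sum>v<n. (real (t v) - lam * real n)\<^sup>2)"
  have RC': "(\<Sum>v<n. (real (s' v) - l * real n)\<^sup>2) + (\<Sum>v<n. (real (t' v) - l * real n)\<^sup>2) = RC"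
    unfolding RC_def by (intro arg_cong2[of _ _ _ _ "(+)"] sum.cong) (auto simp: ds dt power2_commute)
  obtain \<delta> where \<delta>: "\<bar>\<delta>\<bar> \<le> (2 * L) ^ 27 / r" and eq: "expect_unif (digraphs_deg n s' t') (\<lambda>G. real (card {H' \<in> iso_copies n H. H' \<subseteq> G})) =
      (l * real n / (real n - 1)) ^ (n * x) * real (card (iso_copies n H)) *
      exp (- (1 - l) * real x * (real x - 2) / (2 * l) - RC * real x / (2 * l\<^sup>2 * real n ^ 2) + \<delta>)"
    using expected_copies[OF nr' ss L8' H deg x'] unfolding RC' by blast
  have ex: "expect_unif (digraphs_deg n s' t') (\<lambda>G. real (card {H' \<in> iso_copies n H. H' \<subseteq> G}))
     = expect_unif (digraphs_deg n s t) (\<lambda>G. real (card {H' \<in> iso_copies n H. H' \<inter> G = {}}))"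
  proof -
    have "{H' \<in> iso_copies n H. H' \<subseteq> arcs_on n - G} = {H' \<in> iso_copies n H. H' \<inter> G = {}}" for G
      using iso_copies_regular(3)[OF H deg] by blast
    then show ?thesis using expect_unif_reindex[OF bij_betw_complement[of n s t], of "\<lambda>G. real (card {H' \<in> iso_copies n H. H' \<subseteq> G})"] le
      unfolding s'_def t'_def by simp
  qed
  have pp: "l * real n / (real n - 1) = 1 - lam * real n / (real n - 1)"
    unfolding ln using n2 by (simp add: diff_divide_distrib[symmetric] field_simps)
  define u where "u = 1 - lam"
  \<comment> \<open>The exponent depends on the density only through 1/l and 1/l^2. As
    \<open>w\<close> is at most 2*L^2/n, both replacements are absorbed in the error.\<close>
  define w where "w = 1 / l - 1 / u"
  have u0: "0 < u" "1 / u \<le> L"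
  proof -
    show "0 < u" using lam_bounds by (simp add: u_def)
    have "1 / u \<le> 1 / (1 / L)" using lam_bounds L_pos by (intro divide_left_mono mult_pos_pos) (auto simp: u_def)
    then show "1 / u \<le> L" by simp
  qed
  have l0: "0 < l" "1 / l \<le> 2 * L"
  proof -
    have p: "0 < 1 / (2 * L)" using L_pos by simp
    then show l: "0 < l" using l_lo by linarith
    have "1 / l \<le> 1 / (1 / (2 * L))" by (intro divide_left_mono mult_pos_pos l p l_lo) simp
    then show "1 / l \<le> 2 * L" by simp
  qed
  have wb: "0 \<le> w" "w \<le> 2 * L\<^sup>2 / real n"
  proof -
    have lu: "u - l = 1 / real n" by (simp add: u_def l_def)
    have "w = (u - l) / (l * u)" unfolding w_def using l0 u0 by (simp add: field_simps)
    then have w: "w = (1 / l) * (1 / u) / real n" unfolding lu by simp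
    then show "0 \<le> w" using l0 u0 by simp
    have "(1 / l) * (1 / u) \<le> (2 * L) * L" using l0 u0 L_pos by (intro mult_mono) auto
    then have "(1 / l) * (1 / u) / real n \<le> (2 * L) * L / real n" by (intro divide_right_mono) auto
    then show "w \<le> 2 * L\<^sup>2 / real n" unfolding w by (simp add: power2_eq_square)
  qed
  define e1 where "e1 = real x * (real x - 2) / 2 * w"
  define e2 where "e2 = RC * real x / (2 * real n ^ 2) * (w * (1 / l + 1 / u))"
  have d1: "- (1 - l) * real x * (real x - 2) / (2 * l) = - lam * real x * (real x - 2) / (2 * (1 - lam)) - e1"
  proof -
    have A: "- (1 - k) * X * Y / (2 * k) = - (X * Y / 2) * (1 / k) + X * Y / 2" if "k > 0" for k X Y :: real
      using that by (simp add: field_simps)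
    have lamu: "lam = 1 - u" "1 - lam = u" by (simp_all add: u_def)
    have B: "- lam * real x * (real x - 2) / (2 * (1 - lam)) = - (real x * (real x - 2) / 2) * (1 / u) + real x * (real x - 2) / 2"
      unfolding lamu(2) unfolding lamu(1) by (rule A[OF u0(1)])
    have "- z * p + z = - z * q + z - z * (p - q)" for z p q :: real by (simp add: algebra_simps)
    then show ?thesis unfolding A[OF l0(1)] B e1_def w_def by blast
  qed
  have d2: "RC * real x / (2 * l\<^sup>2 * real n ^ 2) = RC * real x / (2 * (1 - lam)\<^sup>2 * real n ^ 2) + e2"
  proof -
    have "1 / l\<^sup>2 - 1 / u\<^sup>2 = w * (1 / l + 1 / u)" unfolding w_def by (simp add: power2_eq_square algebra_simps)
    then have "e2 = RC * real x / (2 * real n ^ 2) * (1 / l\<^sup>2 - 1 / u\<^sup>2)" unfolding e2_def by simp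
    also have "\<dots> = RC * real x / (2 * l\<^sup>2 * real n ^ 2) - RC * real x / (2 * u\<^sup>2 * real n ^ 2)"
    proof -
      have "R / (2 * N) * (1 / p - 1 / q) = R / (2 * p * N) - R / (2 * q * N)" if "0 < p" "0 < q" "0 < N" for R p q N :: real
        using that by (simp add: field_simps)
      note gen = this
      show ?thesis by (rule gen) (use l0 u0 n0 in auto)
    qed
    finally show ?thesis by (simp add: u_def)
  qed
  have e1b: "\<bar>e1\<bar> \<le> 4 * L ^ 4 / real n"
  proof -
    have "\<bar>real x * (real x - 2) / 2\<bar> \<le> 2 * L\<^sup>2"
    proof -
      have "\<bar>real x - 2\<bar> \<le> L" using x L_ge by auto
      then have "real x * \<bar>real x - 2\<bar> \<le> L * L" using x L_pos by (intro mult_mono) auto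
      moreover have "0 \<le> L * L" by simp
      ultimately have "real x * \<bar>real x - 2\<bar> \<le> 4 * (L * L)" by linarith
      then show ?thesis by (simp add: abs_mult power2_eq_square)
    qed
    then have "\<bar>real x * (real x - 2) / 2\<bar> * w \<le> 2 * L\<^sup>2 * (2 * L\<^sup>2 / real n)" using wb by (intro mult_mono) auto
    moreover have "2 * L\<^sup>2 * (2 * L\<^sup>2 / real n) = 4 * L ^ 4 / real n" by (simp flip: power_add)
    ultimately show ?thesis unfolding e1_def abs_mult[of _ w] using wb by simp
  qed
  have e2b: "\<bar>e2\<bar> \<le> 6 * L ^ 6 / real n"
  proof -
    have sq: "(\<Sum>v<n. (f v)\<^sup>2) \<le> real n * (L\<^sup>2 * real n)" if "\<And>v. v < n \<Longrightarrow> \<bar>f v\<bar> \<le> L * r" for f :: "nat \<Rightarrow> real"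
    proof -
      have "(\<Sum>v<n. (f v)\<^sup>2) \<le> (\<Sum>v<n. L\<^sup>2 * real n)"
      proof (rule sum_mono)
        fix v assume "v \<in> {..<n}"
        then have "\<bar>f v\<bar>\<^sup>2 \<le> (L * r)\<^sup>2" using that by (intro power_mono) auto
        then show "(f v)\<^sup>2 \<le> L\<^sup>2 * real n" by (simp add: n_eq power2_eq_square mult_ac)
      qed
      then show ?thesis by simp
    qed
    have "RC \<le> real n * (L\<^sup>2 * real n) + real n * (L\<^sup>2 * real n)"
      unfolding RC_def by (intro add_mono sq s_near t_near)
    then have RCb: "RC \<le> 2 * L\<^sup>2 * real n ^ 2" by (simp add: power2_eq_square algebra_simps)
    have RC0: "0 \<le> RC" unfolding RC_def by (intro add_nonneg_nonneg sum_nonneg) auto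
    have "RC * real x \<le> (2 * L\<^sup>2 * real n ^ 2) * L" using RCb RC0 x L_pos by (intro mult_mono) auto
    then have "RC * real x / (2 * real n ^ 2) \<le> (2 * L\<^sup>2 * real n ^ 2) * L / (2 * real n ^ 2)" by (intro divide_right_mono) auto
    also have "\<dots> = L ^ 3" using n0 by (simp add: power_numeral_reduce)
    finally have A: "RC * real x / (2 * real n ^ 2) \<le> L ^ 3" .
    have B: "w * (1 / l + 1 / u) \<le> 2 * L\<^sup>2 / real n * (3 * L)" using wb l0 u0 by (intro mult_mono) auto
    have w0: "0 \<le> w * (1 / l + 1 / u)" using wb l0 u0 by simp
    have "e2 \<le> L ^ 3 * (2 * L\<^sup>2 / real n * (3 * L))" unfolding e2_def by (rule mult_mono[OF A B _ w0]) (use L_pos in simp)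
    also have "\<dots> = 6 * L ^ 6 / real n" by (simp add: power_numeral_reduce)
    finally have "e2 \<le> 6 * L ^ 6 / real n" .
    moreover have "0 \<le> e2" unfolding e2_def by (rule mult_nonneg_nonneg[OF _ w0]) (use RC0 in simp)
    ultimately show ?thesis by simp
  qed
  have "\<bar>\<delta> - e1 - e2\<bar> \<le> (2 * L) ^ 27 / r + 4 * L ^ 4 / real n + 6 * L ^ 6 / real n" using \<delta> e1b e2b by linarith
  also have "\<dots> \<le> (2 * L) ^ 27 / r + 4 * (2 * L) ^ 27 / r + 6 * (2 * L) ^ 27 / r"
  proof (intro add_mono frac_le order_refl)
    have "L ^ 4 \<le> (2 * L) ^ 4" "L ^ 6 \<le> (2 * L) ^ 6" using L_pos by (intro power_mono; simp)+
    moreover have "(2 * L) ^ 4 \<le> (2 * L) ^ 27" "(2 * L) ^ 6 \<le> (2 * L) ^ 27" using L_ge by (intro power_increasing; simp)+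
    ultimately show "4 * L ^ 4 \<le> 4 * (2 * L) ^ 27" "6 * L ^ 6 \<le> 6 * (2 * L) ^ 27" by linarith+
  qed (use rn r_pos L_pos in auto)
  also have "\<dots> = 11 * (2 * L) ^ 27 / r" by (simp add: add_divide_distrib[symmetric])
  also have "\<dots> \<le> (2 * L) ^ 28 / r"
  proof (rule divide_right_mono)
    have "11 * (2 * L) ^ 27 \<le> (2 * L) * (2 * L) ^ 27" using L_ge by (intro mult_right_mono) auto
    then show "11 * (2 * L) ^ 27 \<le> (2 * L) ^ 28" by (simp add: power_numeral_reduce)
  qed (use r_pos in simp)
  finally have db: "\<bar>\<delta> - e1 - e2\<bar> \<le> (2 * L) ^ 28 / r" .
  have "- (1 - l) * real x * (real x - 2) / (2 * l) - RC * real x / (2 * l\<^sup>2 * real n ^ 2) + \<delta>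
     = - lam * real x * (real x - 2) / (2 * (1 - lam)) - RC * real x / (2 * (1 - lam)\<^sup>2 * real n ^ 2) + (\<delta> - e1 - e2)"
    unfolding d1 d2 by linarith
  then have "expect_unif (digraphs_deg n s t) (\<lambda>G. real (card {H' \<in> iso_copies n H. H' \<inter> G = {}})) =
      (1 - lam * real n / (real n - 1)) ^ (n * x) * real (card (iso_copies n H)) *
      exp (- lam * real x * (real x - 2) / (2 * (1 - lam)) - RC * real x / (2 * (1 - lam)\<^sup>2 * real n ^ 2) + (\<delta> - e1 - e2))"
    using eq[unfolded ex pp] by (simp only:)
  then show ?thesis using db unfolding RC_def by blast
qed

section \<open>Choice of the scale \<open>L\<close> and uniformity in n\<close>

lemma eventually_le_powr:
  fixes c d :: real
  assumes "0 < d" shows "\<forall>\<^sub>F n in sequentially. c \<le> real n powr d"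
proof -
  have "filterlim (\<lambda>n. real n powr d) at_top sequentially" using assms by real_asymp
  then show ?thesis by (simp add: filterlim_at_top)
qed

theorem theorem3p4:
  fixes a b :: real
  assumes "a > 0" and "b > 0" and "a + b < 1/2"
  shows "\<exists>\<epsilon>0>0. \<forall>\<epsilon>. 0 < \<epsilon> \<and> \<epsilon> < \<epsilon>0 \<longrightarrow>
    (\<forall>K>0. \<exists>C N. \<forall>(n::nat) (s::nat \<Rightarrow> nat) (t::nat \<Rightarrow> nat) (H::(nat \<times> nat) set) (x::nat).
      (let sa = (\<Sum>j<n. real (s j)) / real n;
           lam = sa / real n;
           A = lam * (1 - lam) / 2;
           p = sa / (real n - 1);
           R = (\<Sum>j<n. (real (s j) - sa)^2);
           Cs = (\<Sum>j<n. (real (t j) - sa)^2);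
           X = card H;
           D = digraphs_deg n s t;
           I = iso_copies n H
       in
       N \<le> n \<and>
       (\<forall>j<n. s j \<ge> 1 \<and> t j \<ge> 1) \<and>
       (\<Sum>j<n. s j) = (\<Sum>j<n. t j) \<and>
       H \<subseteq> arcs_on n \<and>
       (\<forall>j<n. outdeg H j = x \<and> indeg H j = x) \<and>
       (\<forall>j<n. \<bar>real (s j) - sa\<bar> \<le> K * real n powr (1/2 + \<epsilon>) \<and>
              \<bar>real (t j) - sa\<bar> \<le> K * real n powr (1/2 + \<epsilon>)) \<and>
       real x \<le> K * real n powr (1/2 + \<epsilon>) \<and>
       real X \<le> K * real n powr (1 + 2 * \<epsilon>) \<and>
       (1 - 2 * lam)^2 \<le> 3 * A * (a * ln (real n))
       \<longrightarrow>
       (\<exists>\<delta>. \<bar>\<delta>\<bar> \<le> C * real n powr (- b) \<and>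
          expect_unif D (\<lambda>G. real (card {H' \<in> I. H' \<subseteq> G})) =
            p ^ X * real (card I) *
            exp (- (1 - lam) * real x * (real x - 2) / (2 * lam)
                 - (R + Cs) * real x / (2 * lam^2 * (real n)^2) + \<delta>)) \<and>
       (\<exists>\<delta>. \<bar>\<delta>\<bar> \<le> C * real n powr (- b) \<and>
          expect_unif D (\<lambda>G. real (card {H' \<in> I. H' \<inter> G = {}})) =
            (1 - p) ^ X * real (card I) *
            exp (- lam * real x * (real x - 2) / (2 * (1 - lam))
                 - (R + Cs) * real x / (2 * (1 - lam)^2 * (real n)^2) + \<delta>))))"
proof -
  \<comment> \<open>The scale will be \<open>L = n powr \<eta>\<close>, and the errors are below
    \<open>(2 * L)^30 / sqrt n\<close>. With this value 30*\<eta> is half of 1/2 - b, and the other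
    half pays for the factor 2^30.\<close>
  define \<eta> where "\<eta> = (1/2 - b) / 60"
  have \<eta>: "0 < \<eta>" "\<eta> \<le> 1 / 120" "1/2 - b - 30 * \<eta> > 0" using assms by (auto simp: \<eta>_def field_simps)
  show ?thesis
  \<comment> \<open>With \<open>\<epsilon> < \<eta> / 4\<close>, both K*n^\<epsilon> and
    K*n^(2*\<epsilon>) are eventually at most \<open>L\<close>; the first governs the deviations of
    the degrees of G, the second the degree of H.\<close>
  proof (rule exI[of _ "\<eta> / 4"], intro conjI allI impI, goal_cases)
    case 1
    then show ?case using \<eta> by simp
  next
    case (2 \<epsilon> K)
    then have \<epsilon>: "0 < \<epsilon>" "\<epsilon> < \<eta> / 4" and K: "0 < K" by auto
    have "\<forall>\<^sub>F n in sequentially. 100 \<le> real n powr \<eta>" using \<eta> by (intro eventually_le_powr) simp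
    moreover have "\<forall>\<^sub>F n in sequentially. 16 ^ 20 \<le> real n powr (1 - 20 * \<eta>)" using \<eta> by (intro eventually_le_powr) simp
    moreover have "\<forall>\<^sub>F n in sequentially. 2 * real n ^ 3 \<le> 2 powr sqrt (real n)" by real_asymp
    moreover have "\<forall>\<^sub>F n in sequentially. K \<le> real n powr (\<eta> - \<epsilon>)" using \<epsilon> \<eta> by (intro eventually_le_powr) linarith
    moreover have "\<forall>\<^sub>F n in sequentially. K \<le> real n powr (\<eta> - 2 * \<epsilon>)" using \<epsilon> \<eta> by (intro eventually_le_powr) linarith
    moreover have "\<forall>\<^sub>F n in sequentially. 8 + 6 * a / \<eta> \<le> real n powr (\<eta> / 2)" using \<eta> by (intro eventually_le_powr) simp
    moreover have "\<forall>\<^sub>F n in sequentially. 2 ^ 30 \<le> real n powr (1/2 - b - 30 * \<eta>)" using \<eta> by (intro eventually_le_powr) simp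
    ultimately have "\<forall>\<^sub>F n in sequentially. 100 \<le> real n powr \<eta> \<and> 16 ^ 20 \<le> real n powr (1 - 20 * \<eta>) \<and>
      2 * real n ^ 3 \<le> 2 powr sqrt (real n) \<and> K \<le> real n powr (\<eta> - \<epsilon>) \<and> K \<le> real n powr (\<eta> - 2 * \<epsilon>) \<and>
      8 + 6 * a / \<eta> \<le> real n powr (\<eta> / 2) \<and> 2 ^ 30 \<le> real n powr (1/2 - b - 30 * \<eta>)"
      by (simp only: eventually_conj_iff)
    then obtain N where N: "\<And>n. N \<le> n \<Longrightarrow> 100 \<le> real n powr \<eta> \<and> 16 ^ 20 \<le> real n powr (1 - 20 * \<eta>) \<and>
      2 * real n ^ 3 \<le> 2 powr sqrt (real n) \<and> K \<le> real n powr (\<eta> - \<epsilon>) \<and> K \<le> real n powr (\<eta> - 2 * \<epsilon>) \<and>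
      8 + 6 * a / \<eta> \<le> real n powr (\<eta> / 2) \<and> 2 ^ 30 \<le> real n powr (1/2 - b - 30 * \<eta>)"
      unfolding eventually_sequentially by blast
    show ?case
    proof (intro exI[of _ "1::real"] exI[of _ N] allI, unfold Let_def, intro impI, goal_cases)
      case (1 n s t H x)
      note A = this
      let ?sa = "(\<Sum>j<n. real (s j)) / real n"
      define L where "L = real n powr \<eta>"
      define lam where "lam = ?sa / real n"
      have Nn: "N \<le> n" using A by blast
      note E = N[OF Nn]
      have n0: "0 < real n"
      proof (rule ccontr)
        assume "\<not> 0 < real n"
        \<comment> \<open>By convention 0 powr \<eta> is 0, which contradicts the lower bound
          100.\<close>
        then have "real n powr \<eta> = 0" by simp
        then show False using E by simp
      qed
      have n1: "1 \<le> real n" using n0 by simp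
      have sa: "?sa = lam * real n" using n0 by (simp add: lam_def)
      have rt: "rt n = real n powr (1/2)" by (simp add: rt_def powr_half_sqrt)
      have L0: "100 \<le> L" using E by (simp add: L_def)
      have Lp: "L ^ m = real n powr (real m * \<eta>)" for m unfolding L_def using n0 by (simp add: powr_realpow[symmetric] powr_powr mult.commute)
      have L16: "(16 * L) ^ 20 \<le> real n"
      proof -
        have "(16 * L) ^ 20 = 16 ^ 20 * real n powr (20 * \<eta>)" by (simp add: power_mult_distrib Lp)
        also have "\<dots> \<le> real n powr (1 - 20 * \<eta>) * real n powr (20 * \<eta>)" using E by (intro mult_right_mono) auto
        also have "\<dots> = real n" using n0 by (simp add: powr_add[symmetric])
        finally show ?thesis .
      qed
      have LK: "K * real n powr (1/2 + \<epsilon>) \<le> L * rt n"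
      proof -
        have "K * real n powr (1/2 + \<epsilon>) \<le> real n powr (\<eta> - \<epsilon>) * real n powr (1/2 + \<epsilon>)" using E by (intro mult_right_mono) auto
        also have "\<dots> = L * rt n" unfolding L_def rt using n0 by (simp add: powr_add[symmetric] algebra_simps)
        finally show ?thesis .
      qed
      have T: "real (\<Sum>v<n. s v) = lam * real n ^ 2" using n0 by (simp add: lam_def power2_eq_square)
      have H: "H \<subseteq> arcs_on n" and deg: "\<forall>j<n. outdeg H j = x \<and> indeg H j = x" using A by blast+
      have cH: "card H = n * x"
      proof -
        have "H \<subseteq> {..<n} \<times> {..<n}" using H by (auto simp: arcs_on_def)
        from sum_outdeg[OF this] show ?thesis using deg by simp
      qed
      \<comment> \<open>Since X = n*x, the bound on the number of arcs limits the degree to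
        K*n^(2*\<epsilon>).\<close>
      have xL: "real x \<le> L"
      proof -
        have "real n * real x \<le> K * real n powr (1 + 2 * \<epsilon>)" using A unfolding cH by simp
        also have "\<dots> \<le> real n powr (\<eta> - 2 * \<epsilon>) * real n powr (1 + 2 * \<epsilon>)" using E by (intro mult_right_mono) auto
        also have "\<dots> = real n * L" unfolding L_def using n0 by (simp add: powr_add[symmetric] powr_mult_base add.commute)
        finally show ?thesis using n0 by simp
      qed
      \<comment> \<open>With w = lam*(1 - lam) the hypothesis reads 1 - 4*w \<le> (3/2)*w*a*log n,
        so w is positive and at least 2/(8 + 3*a*log n). A logarithm is at most a constant times
        n^(\<eta>/2), so the denominator is at most \<open>L\<close> for large n.\<close>
      have lamv: "1 / L \<le> lam * (1 - lam)"
      proof -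
        define y where "y = real n powr (\<eta> / 2)"
        define w where "w = lam * (1 - lam)"
        have Ly: "L = y * y" unfolding L_def y_def by (simp add: powr_add[symmetric])
        have y1: "1 \<le> y" unfolding y_def using n1 \<eta> by (simp add: ge_one_powr_ge_zero)
        have ln0: "0 \<le> ln (real n)" using n1 by simp
        have "ln (real n) \<le> real n powr (\<eta> / 2) / (\<eta> / 2)" using \<eta> n1 by (intro ln_powr_bound) auto
        then have "3 * a * ln (real n) \<le> 3 * a * (y / (\<eta> / 2))" using assms(1) unfolding y_def by (intro mult_left_mono) auto
        then have "8 + 3 * a * ln (real n) \<le> 8 * y + 6 * a / \<eta> * y" using y1 by simp
        also have "\<dots> = (8 + 6 * a / \<eta>) * y" by (simp add: algebra_simps)
        also have "\<dots> \<le> y * y" using E y1 unfolding y_def by (intro mult_right_mono) auto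
        finally have bd: "8 + 3 * a * ln (real n) \<le> L" by (simp only: Ly)
        have "(1 - 2 * lam)\<^sup>2 \<le> 3 * (w / 2) * (a * ln (real n))" using A unfolding lam_def w_def by blast
        moreover have "(1 - 2 * lam)\<^sup>2 = 1 - 4 * w" unfolding w_def by (simp add: power2_eq_square algebra_simps)
        ultimately have "2 \<le> w * (8 + 3 * a * ln (real n))" by (simp add: algebra_simps)
        moreover have p8: "0 < 8 + 3 * a * ln (real n)" using assms(1) ln0 by (simp add: add_pos_nonneg)
        ultimately have w0: "0 < w" using zero_less_mult_pos2 by (smt (verit) mult_nonpos_nonneg)
        have "1 \<le> w * (8 + 3 * a * ln (real n))" using \<open>2 \<le> w * (8 + 3 * a * ln (real n))\<close> by linarith
        also have "\<dots> \<le> w * L" using bd w0 by (intro mult_left_mono) auto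
        finally show ?thesis unfolding w_def using L0 by (simp add: divide_le_eq mult.commute)
      qed
      have nr: "near_regular n L lam s t (Id_on {..<n})"
      proof
        show "100 \<le> L" by (rule L0)
        have "L ^ 20 \<le> (16 * L) ^ 20" using L0 by (intro power_mono) auto
        then show "L ^ 20 \<le> real n" using L16 by linarith
        show "2 * real n ^ 3 \<le> 2 powr rt n" unfolding rt_def using E by blast
        show "1 / L \<le> lam * (1 - lam)" by (rule lamv)
        show "\<bar>real (s v) - lam * real n\<bar> \<le> L * rt n" "\<bar>real (t v) - lam * real n\<bar> \<le> L * rt n" if "v < n" for v
          using A LK that unfolding sa by fastforce+
        show "(\<Sum>v<n. s v) = (\<Sum>v<n. t v)" using A by blast
        show "\<bar>real (\<Sum>v<n. s v) - lam * (real n)\<^sup>2\<bar> \<le> L * real n" unfolding T using L0 by simp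
        show "Id_on {..<n} \<subseteq> {..<n} \<times> {..<n}" by auto
        have "outdeg (Id_on {..<n}) v = 1" "indeg (Id_on {..<n}) v = 1" if "v < n" for v
        proof -
          have "{w. (v,w) \<in> Id_on {..<n}} = {v}" "{w. (w,v) \<in> Id_on {..<n}} = {v}" using that by auto
          then show "outdeg (Id_on {..<n}) v = 1" "indeg (Id_on {..<n}) v = 1" by (simp_all add: outdeg_def indeg_def)
        qed
        then show "real (outdeg (Id_on {..<n}) v) \<le> L" "real (indeg (Id_on {..<n}) v) \<le> L" if "v < n" for v
          using that L0 by simp_all
      qed
      have err: "(2 * L) ^ 28 / rt n \<le> 1 * real n powr (- b)" "L ^ 27 / rt n \<le> 1 * real n powr (- b)"
      proof -
        have r0: "0 < rt n" unfolding rt using n0 by simp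
        have "(2 * L) ^ 30 / rt n = 2 ^ 30 * real n powr (30 * \<eta> - 1/2)"
          unfolding rt powr_diff by (simp add: power_mult_distrib Lp)
        also have "\<dots> \<le> real n powr (1/2 - b - 30 * \<eta>) * real n powr (30 * \<eta> - 1/2)" using E by (intro mult_right_mono) auto
        also have "\<dots> = real n powr (- b)" by (simp add: powr_add[symmetric])
        finally have e: "(2 * L) ^ 30 / rt n \<le> real n powr (- b)" .
        have "(2 * L) ^ 28 \<le> (2 * L) ^ 30" using L0 by (intro power_increasing) auto
        then have "(2 * L) ^ 28 / rt n \<le> (2 * L) ^ 30 / rt n" using r0 by (intro divide_right_mono) auto
        then show "(2 * L) ^ 28 / rt n \<le> 1 * real n powr (- b)" using e by linarith
        have "L ^ 27 \<le> (2 * L) ^ 27" using L0 by (intro power_mono) auto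
        also have "\<dots> \<le> (2 * L) ^ 30" using L0 by (intro power_increasing) auto
        finally have "L ^ 27 / rt n \<le> (2 * L) ^ 30 / rt n" using r0 by (intro divide_right_mono) auto
        then show "L ^ 27 / rt n \<le> 1 * real n powr (- b)" using e by linarith
      qed
      have L8: "(8 * L) ^ 20 \<le> real n"
      proof -
        have "(8 * L) ^ 20 \<le> (16 * L) ^ 20" using L0 by (intro power_mono) auto
        then show ?thesis using L16 by linarith
      qed
      have ll: "lam * real n / real n = lam" using n0 by simp
      from expected_copies[OF nr T L8 H deg xL] expected_disjoint_copies[OF nr T L16 H deg xL] err
      show ?case
        unfolding sa ll cH by (meson order_trans)
    qed
  qed
qed

end
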